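(* Let $\Gamma$ be a finitely generated group, $p$ a prime number and $r$ the $p$-rank of $\Gamma$. Then: (1) $\chi^i_{Sing}(\Gamma,PSL(p,\mathbb{C}))$ is the union of $\frac{p^r-1}{p-1}$ pseudo-components (one for each normal subgroup $K$ of index $p$ in $\Gamma$). (2) The intersection of two different pseudo-components (i.e. those associated to two different normal subgroups $K\neq K'$ of index $p$) is finite of cardinality $p-1$. All its elements are conjugacy classes of abelian irreducible representations. (3) Conversely, any conjugacy class of abelian irreducible representations from $\Gamma$ to $PSL(p,\mathbb{C})$ belongs to exactly $p+1$ pseudo-components. (4) There are exactly $\frac{(p^r-1)(p^{r-1}-1)}{p^2-1}$ conjugacy classes of abelian irreducible representations from $\Gamma$ to $PSL(p,\mathbb{C})$.
   Context: The $p$-rank of $\Gamma$ is $\dim_{\mathbb{Z}/p}(\Gamma^{Ab}/p\Gamma^{Ab})$. A subgroup of $PSL(p,\mathbb{C})$ is irreducible if it is not contained in any (proper) parabolic subgroup; an irreducible subgroup is bad if its centralizer in $PSL(p,\mathbb{C})$ is non-trivial. A representation is irreducible (resp. bad, abelian) if its image is. $\chi^i(\Gamma,PSL(p,\mathbb{C}))$ is the set of conjugacy classes (under $PSL(p,\mathbb{C})$) of irreducible representations $\Gamma\to PSL(p,\mathbb{C})$, and $\chi^i_{Sing}(\Gamma,PSL(p,\mathbb{C}))$ is the subset of conjugacy classes of bad representations. Let $\xi$ be a primitive $p$-th root of unity. For $M\in SL(p,\mathbb{C})$, $\overline{M}$ is its image in $PSL(p,\mathbb{C})$; rows and columns are indexed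 by $\mathbb{Z}/p$, with canonical basis $(e_i)$; $D\subset SL(p,\mathbb{C})$ is the diagonal subgroup and $\overline{D}$ its image. For $p$ odd, $M_c$ is the permutation matrix with $M_ce_i=e_{i+1}$; for $p=2$, $M_c=\begin{pmatrix}0&\sqrt{-1}\\\sqrt{-1}&0\end{pmatrix}$. $\overline{D}\rtimes\langle\overline{M_c}\rangle$ is a subgroup of $PSL(p,\mathbb{C})$ and $q:\overline{D}\rtimes\langle\overline{M_c}\rangle\to\langle\overline{M_c}\rangle$ is the natural projection ($\overline{M_c}$ has order $p$). For each normal subgroup $K$ of index $p$ in $\Gamma$, fix a morphism $\overline{\rho}_K:\Gamma\to\langle\overline{M_c}\rangle$ with kernel $K$. The pseudo-component associated to $K$ is the set of classes $[\rho]\in\chi^i(\Gamma,PSL(p,\mathbb{C}))$ of irreducible representations $\rho:\Gamma\to PSL(p,\mathbb{C})$ with image in $\overline{D}\rtimes\langle\overline{M_c}\rangle$ and $q\circ\rho=\overline{\rho}_K$ (this set does not depend on the choice of $\overline{\rho}_K$). Pseudo-components are counted as indexed by $K$. *)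

theory Defs
  imports
    "HOL-Algebra.Generated_Groups"
    "HOL-Number_Theory.Residues"
    "Jordan_Normal_Form.Determinant"
    "Jordan_Normal_Form.VS_Connect"
begin

section \<open>Group-theoretic notions\<close>

definition finitely_generated :: "('a, 'b) monoid_scheme \<Rightarrow> bool" where
  "finitely_generated G \<longleftrightarrow> (\<exists>S. finite S \<and> S \<subseteq> carrier G \<and> generate G S = carrier G)"

definition centralizer :: "('a, 'b) monoid_scheme \<Rightarrow> 'a set \<Rightarrow> 'a set" where
  "centralizer G S = {x \<in> carrier G. \<forall>s\<in>S. x \<otimes>\<^bsub>G\<^esub> s = s \<otimes>\<^bsub>G\<^esub> x}"

definition center :: "('a, 'b) monoid_scheme \<Rightarrow> 'a set" where
  "center G = centralizer G (carrier G)"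

definition normal_of_index :: "('a, 'b) monoid_scheme \<Rightarrow> nat \<Rightarrow> 'a set set" where
  "normal_of_index G n = {K. K \<lhd> G \<and> card (rcosets\<^bsub>G\<^esub> K) = n}"

definition abelianization :: "('a, 'b) monoid_scheme \<Rightarrow> 'a set monoid" where
  "abelianization G = G Mod (derived G (carrier G))"

text \<open>The group \<open>A / pA\<close> for \<open>A\<close> the abelianization (written multiplicatively, so that
  \<open>pA\<close> is the set of \<open>p\<close>-th powers).\<close>

definition ab_mod_p :: "('a, 'b) monoid_scheme \<Rightarrow> nat \<Rightarrow> 'a set set monoid" where
  "ab_mod_p G p =
     abelianization G Mod ((\<lambda>x. x [^]\<^bsub>abelianization G\<^esub> p) ` carrier (abelianization G))"

text \<open>The same group as a module over \<open>\<int>/p\<close>; the ring multiplication fields of the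
  record are not used by modules.\<close>

definition ab_mod_p_space ::
  "('a, 'b) monoid_scheme \<Rightarrow> nat \<Rightarrow> (int, 'a set set) module" where
  "ab_mod_p_space G p =
     \<lparr>carrier = carrier (ab_mod_p G p),
      monoid.mult = undefined,
      one = undefined,
      zero = \<one>\<^bsub>ab_mod_p G p\<^esub>,
      add = (\<lambda>x y. x \<otimes>\<^bsub>ab_mod_p G p\<^esub> y),
      smult = (\<lambda>k x. x [^]\<^bsub>ab_mod_p G p\<^esub> k)\<rparr>"

definition p_rank :: "('a, 'b) monoid_scheme \<Rightarrow> nat \<Rightarrow> nat" where
  "p_rank G p = vectorspace.dim (residue_ring (int p)) (ab_mod_p_space G p)"


section \<open>The projective special linear group\<close>

definition SL :: "nat \<Rightarrow> complex mat monoid" where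
  "SL n = \<lparr>carrier = {A \<in> carrier_mat n n. det A = 1}, monoid.mult = (*), one = 1\<^sub>m n\<rparr>"

definition PSL :: "nat \<Rightarrow> complex mat set monoid" where
  "PSL n = SL n Mod center (SL n)"

definition to_PSL :: "nat \<Rightarrow> complex mat \<Rightarrow> complex mat set" where
  "to_PSL n A = center (SL n) #>\<^bsub>SL n\<^esub> A"

text \<open>A parabolic subgroup is the stabilizer of a flag, that is, of a chain of linear
  subspaces. Chains consisting only of the zero space and the whole space are allowed and
  have the whole group as stabilizer, hence the properness condition in irreducibility.\<close>

definition flag :: "nat \<Rightarrow> complex vec set set \<Rightarrow> bool" where
  "flag n F \<longleftrightarrow>
     (\<forall>W\<in>F. subspace class_ring W (module_vec TYPE(complex) n)) \<and> chain\<^sub>\<subseteq> F"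

definition parabolic :: "nat \<Rightarrow> complex mat set set \<Rightarrow> bool" where
  "parabolic n P \<longleftrightarrow>
     (\<exists>F. flag n F \<and>
        P = to_PSL n ` {A \<in> carrier (SL n). \<forall>W\<in>F. (\<lambda>v. A *\<^sub>v v) ` W = W})"

definition irreducible_subgroup :: "nat \<Rightarrow> complex mat set set \<Rightarrow> bool" where
  "irreducible_subgroup n H \<longleftrightarrow>
     subgroup H (PSL n) \<and> \<not> (\<exists>P. parabolic n P \<and> P \<noteq> carrier (PSL n) \<and> H \<subseteq> P)"

definition bad_subgroup :: "nat \<Rightarrow> complex mat set set \<Rightarrow> bool" where
  "bad_subgroup n H \<longleftrightarrow>
     irreducible_subgroup n H \<and> centralizer (PSL n) H \<noteq> {\<one>\<^bsub>PSL n\<^esub>}"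


section \<open>Representations and their conjugacy classes\<close>

text \<open>Representations are required to be extensional, so that they are determined by their
  values on the group.\<close>

definition reps :: "('a, 'b) monoid_scheme \<Rightarrow> nat \<Rightarrow> ('a \<Rightarrow> complex mat set) set" where
  "reps G n = hom G (PSL n) \<inter> extensional (carrier G)"

definition irreducible_reps ::
  "('a, 'b) monoid_scheme \<Rightarrow> nat \<Rightarrow> ('a \<Rightarrow> complex mat set) set" where
  "irreducible_reps G n = {\<rho> \<in> reps G n. irreducible_subgroup n (\<rho> ` carrier G)}"

definition bad_reps ::
  "('a, 'b) monoid_scheme \<Rightarrow> nat \<Rightarrow> ('a \<Rightarrow> complex mat set) set" where
  "bad_reps G n = {\<rho> \<in> reps G n. bad_subgroup n (\<rho> ` carrier G)}"

definition abelian_irreducible_reps ::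
  "('a, 'b) monoid_scheme \<Rightarrow> nat \<Rightarrow> ('a \<Rightarrow> complex mat set) set" where
  "abelian_irreducible_reps G n =
     {\<rho> \<in> irreducible_reps G n. comm_group (PSL n\<lparr>carrier := \<rho> ` carrier G\<rparr>)}"

definition conj_class ::
  "('a, 'b) monoid_scheme \<Rightarrow> nat \<Rightarrow> ('a \<Rightarrow> complex mat set) \<Rightarrow> ('a \<Rightarrow> complex mat set) set"
  where
  "conj_class G n \<rho> =
     {\<sigma> \<in> reps G n. \<exists>g\<in>carrier (PSL n). \<forall>x\<in>carrier G.
        \<sigma> x = g \<otimes>\<^bsub>PSL n\<^esub> \<rho> x \<otimes>\<^bsub>PSL n\<^esub> inv\<^bsub>PSL n\<^esub> g}"

definition chi_irr ::
  "('a, 'b) monoid_scheme \<Rightarrow> nat \<Rightarrow> ('a \<Rightarrow> complex mat set) set set" where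
  "chi_irr G n = conj_class G n ` irreducible_reps G n"

definition chi_sing ::
  "('a, 'b) monoid_scheme \<Rightarrow> nat \<Rightarrow> ('a \<Rightarrow> complex mat set) set set" where
  "chi_sing G n = {c \<in> chi_irr G n. \<exists>\<rho>\<in>bad_reps G n. c = conj_class G n \<rho>}"

definition chi_abelian ::
  "('a, 'b) monoid_scheme \<Rightarrow> nat \<Rightarrow> ('a \<Rightarrow> complex mat set) set set" where
  "chi_abelian G n = conj_class G n ` abelian_irreducible_reps G n"


section \<open>Pseudo-components\<close>

text \<open>For \<open>p = 2\<close> the permutation matrix has determinant \<open>-1\<close> and is rescaled by \<open>\<i>\<close>.\<close>

definition M_cyc :: "nat \<Rightarrow> complex mat" where
  "M_cyc p =
     (if p = 2 then mat 2 2 (\<lambda>(i, j). if i = j then 0 else \<i>)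
      else mat p p (\<lambda>(i, j). if i = (j + 1) mod p then 1 else 0))"

definition D_bar :: "nat \<Rightarrow> complex mat set set" where
  "D_bar p = to_PSL p ` {A \<in> carrier (SL p). diagonal_mat A}"

definition C_bar :: "nat \<Rightarrow> complex mat set set" where
  "C_bar p = generate (PSL p) {to_PSL p (M_cyc p)}"

text \<open>\<open>D_bar p <#> C_bar p\<close> is an internal semidirect product; \<open>quot_map p\<close> sends \<open>d c\<close>
  to \<open>c\<close>; the factorization is unique since a power of the cyclic matrix is diagonal only
  if it is central.\<close>

definition quot_map :: "nat \<Rightarrow> complex mat set \<Rightarrow> complex mat set" where
  "quot_map p x = (THE c. c \<in> C_bar p \<and> (\<exists>d\<in>D_bar p. x = d \<otimes>\<^bsub>PSL p\<^esub> c))"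

text \<open>The pseudo-component of the kernel of a given surjection \<open>\<phi>\<close> onto \<open>C_bar p\<close>.\<close>

definition pseudo_component ::
  "('a, 'b) monoid_scheme \<Rightarrow> nat \<Rightarrow> ('a \<Rightarrow> complex mat set) \<Rightarrow>
   ('a \<Rightarrow> complex mat set) set set" where
  "pseudo_component G p \<phi> =
     {conj_class G p \<rho> | \<rho>. \<rho> \<in> irreducible_reps G p \<and>
        \<rho> ` carrier G \<subseteq> D_bar p <#>\<^bsub>PSL p\<^esub> C_bar p \<and>
        (\<forall>x\<in>carrier G. quot_map p (\<rho> x) = \<phi> x)}"

end

theory Submission
  imports Defs "Jordan_Normal_Form.Spectral_Radius"
begin

text \<open>
  Commuting elements of PSL lift to matrices that commute up to a \<open>p\<close>-th root of unity. If \<open>S\<close>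
  centralizes the image of a representation \<open>\<rho>\<close>, comparing lifts of \<open>S\<close> and of \<open>\<rho> x\<close> therefore
  yields a character \<open>x \<mapsto> \<chi> x\<close> of \<open>\<Gamma>\<close> with values in the \<open>p\<close>-th roots of unity, a \<^emph>\<open>twist\<close> of \<open>\<rho>\<close>;
  when \<open>\<rho>\<close> is irreducible, Schur's lemma shows that \<open>\<chi>\<close> determines \<open>S\<close> (\<open>twisted_unique\<close>).
  The twists form a subgroup of the group \<open>V\<close> of all characters, and the theorem is about these subgroups: \<open>V\<close> is the
  dual of \<open>\<Gamma>\<^sup>A\<^sup>b / p\<close>, so it has \<open>p ^ r\<close> elements (\<open>card_chars\<close>), and the normal subgroups of index
  \<open>p\<close> are the kernels of the nontrivial characters, one for each line in \<open>V\<close>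
  (\<open>card_index_p_subgroups\<close>).

  What links twists to matrices is the uniqueness of Weyl pairs: two matrices of determinant 1 that
  commute up to a primitive \<open>p\<close>-th root of unity \<open>z\<close> are simultaneously conjugate to a multiple of
  \<open>diag(1, z, z\<^sup>2, \<dots>)\<close> and to the cyclic matrix (\<open>Weyl_pair_canonical_form\<close>). The group
  \<open>D \<rtimes> \<langle>M\<^sub>c\<rangle>\<close> is the centralizer in PSL of the class of that diagonal matrix, and its
  projection \<open>q\<close> reads off the commutation scalar. Hence an irreducible class \<open>[\<rho>]\<close> lies in the
  pseudo-component of \<open>K\<close> exactly when the character with kernel \<open>K\<close> is a twist of \<open>\<rho>\<close>
  (\<open>pseudo_component_iff\<close>).

  (1) \<open>\<rho>\<close> is bad iff it has a nontrivial twist, and a power of this twist is the character chosen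
  for its kernel. (2) If \<open>\<rho>\<close> has two independent twists, the elements \<open>S\<close> and \<open>T\<close> realizing them form
  a Weyl pair; since each \<open>\<rho> x\<close> is determined by its commutation scalars with \<open>S\<close> and \<open>T\<close>, the
  representation is abelian, and its class is determined by the commutator of \<open>S\<close> and \<open>T\<close>, which
  can be any of the \<open>p - 1\<close> nontrivial \<open>p\<close>-th roots of unity (\<open>classes_with_two_twists\<close>). (3) The
  image of an abelian irreducible \<open>\<rho>\<close> contains a Weyl pair, and a twist may take arbitrary values there; so
  the twists form a plane, which contains \<open>p + 1\<close> lines (\<open>card_twists_abelian\<close>). (4) follows
  by counting in two ways the triples of an abelian class and two distinct pseudo-components
  containing it.
\<close>

section \<open>Roots of unity of prime order\<close>

lemma root_of_unity_power_eq_1_iff: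
  fixes z :: complex
  assumes "prime p" "z ^ p = 1" "z \<noteq> 1"
  shows "z ^ k = 1 \<longleftrightarrow> p dvd k"
proof
  assume zk: "z ^ k = 1"
  show "p dvd k"
  proof (rule ccontr)
    assume "\<not> p dvd k"
    with \<open>prime p\<close> have "coprime k p"
      by (metis coprime_commute prime_imp_coprime)
    moreover have "k \<noteq> 0" using \<open>\<not> p dvd k\<close> by (cases k) auto
    ultimately obtain a b where "k * a = p * b + 1"
      using bezout_nat[of k p] by auto
    then have "z ^ (k * a) = z ^ (p * b + 1)" by simp
    then have "z = 1" using zk assms(2) by (simp add: power_mult)
    with assms(3) show False by simp
  qed
next
  assume "p dvd k"
  then show "z ^ k = 1" using assms(2) by (auto simp: power_mult elim!: dvdE)
qed

lemma root_of_unity_power_inj: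
  fixes z :: complex
  assumes "prime p" "z ^ p = 1" "z \<noteq> 1" "i < p" "j < p" "z ^ i = z ^ j"
  shows "i = j"
proof -
  have aux: "b = a" if "a \<le> b" "b < p" "z ^ a = z ^ b" for a b
  proof -
    have "z \<noteq> 0" using assms(1,2) by (metis power_0_left prime_gt_0_nat zero_neq_one less_irrefl)
    moreover have "z ^ b = z ^ a * z ^ (b - a)" using that by (subst power_add[symmetric]) simp
    ultimately have "z ^ (b - a) = 1" using that by simp
    then have "p dvd b - a" using root_of_unity_power_eq_1_iff assms by blast
    then show ?thesis using that by (metis dvd_imp_le less_imp_diff_less not_less diff_is_0_eq le_antisym neq0_conv)
  qed
  from nat_le_linear[of i j] show ?thesis
  proof
    assume "i \<le> j" from aux[OF this assms(5,6)] show ?thesis ..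
  next
    assume "j \<le> i" from aux[OF this assms(4) assms(6)[symmetric]] show ?thesis .
  qed
qed

lemma root_of_unity_powers:
  fixes z w :: complex
  assumes "prime p" "z ^ p = 1" "z \<noteq> 1" "w ^ p = 1"
  obtains k where "k < p" "w = z ^ k"
proof -
  have p: "p > 0" using assms(1) prime_gt_0_nat by blast
  have "inj_on (\<lambda>i. z ^ i) {..<p}"
    using root_of_unity_power_inj[OF assms(1-3)] by (auto intro!: inj_onI)
  then have "card ((\<lambda>i. z ^ i) ` {..<p}) = card {x::complex. x ^ p = 1}"
    using p by (simp add: card_image card_roots_unity_eq)
  moreover have "(\<lambda>i. z ^ i) ` {..<p} \<subseteq> {x::complex. x ^ p = 1}"
    using assms(2) by (auto simp: power_mult[symmetric] mult.commute[of _ p]) (simp add: power_mult)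
  ultimately have "(\<lambda>i. z ^ i) ` {..<p} = {x::complex. x ^ p = 1}"
    using p by (intro card_subset_eq finite_roots_unity) auto
  then show thesis using that assms(4) by blast
qed

lemma primitive_root_exists:
  assumes "prime p"
  obtains z :: complex where "z ^ p = 1" "z \<noteq> 1"
proof -
  have "card {x::complex. x ^ p = 1} = p"
    using assms prime_gt_0_nat by (simp add: card_roots_unity_eq)
  moreover have "p > 1" using assms prime_gt_1_nat by blast
  ultimately have "\<not> {x::complex. x ^ p = 1} \<subseteq> {1}"
    by (metis card.empty card.insert card_mono empty_iff finite.emptyI finite.insertI leD One_nat_def)
  then show thesis using that by auto
qed

lemma complex_root_exists:
  fixes c :: complex
  assumes "n > 0"
  obtains x where "x ^ n = c"
proof (cases "c = 0")
  case True
  then show ?thesis using that[of 0] assms by simp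
next
  case False
  have "card {z::complex. z ^ n = c} = n" by (rule card_nth_roots) (use False assms in auto)
  then have "{z::complex. z ^ n = c} \<noteq> {}" using assms by (metis card.empty less_irrefl)
  then show ?thesis using that by blast
qed


section \<open>Clock and shift matrices\<close>

definition clock :: "nat \<Rightarrow> complex \<Rightarrow> complex mat" where
  "clock p z = mat_diag p (\<lambda>i. z ^ i)"

lemma dim_mat_diag [simp]: "dim_row (mat_diag n f) = n" "dim_col (mat_diag n f) = n"
  by (simp_all add: mat_diag_def)

lemma clock_carrier [simp]: "clock p z \<in> carrier_mat p p"
  by (simp add: clock_def)

lemma dim_clock [simp]: "dim_row (clock p z) = p" "dim_col (clock p z) = p"
  using clock_carrier[of p z] by blast+

lemma det_mat_diag: "det (mat_diag n f) = (\<Prod>i<n. f i)" for f :: "nat \<Rightarrow> 'a :: comm_ring_1"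
proof -
  have "det (mat_diag n f) = prod_list (diag_mat (mat_diag n f))"
    by (rule det_upper_triangular[of _ n]) (auto simp: mat_diag_def)
  also have "diag_mat (mat_diag n f) = map f [0..<n]"
    by (auto simp: diag_mat_def mat_diag_def)
  also have "prod_list (map f [0..<n]) = (\<Prod>i<n. f i)"
    by (simp add: prod.distinct_set_conv_list[symmetric] atLeast0LessThan)
  finally show ?thesis .
qed

lemma det_clock_nonzero:
  assumes "z \<noteq> 0"
  shows "det (clock p z) \<noteq> 0"
  using assms by (simp add: clock_def det_mat_diag)

definition shift :: "nat \<Rightarrow> complex mat" where
  "shift p = mat p p (\<lambda>(i, j). if i = (j + 1) mod p then 1 else 0)"

text \<open>The permutation matrix of a \<open>p\<close>-cycle has determinant \<open>-1\<close> for \<open>p = 2\<close>; the scale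
  restores determinant 1.\<close>

definition shift_scale :: "nat \<Rightarrow> complex" where
  "shift_scale p = (if p = 2 then \<i> else 1)"

lemma shift_scale_nonzero [simp]: "shift_scale p \<noteq> 0"
  by (simp add: shift_scale_def)

lemma M_cyc_shift: "M_cyc p = shift_scale p \<cdot>\<^sub>m shift p"
proof (cases "p = 2")
  case True
  have "i \<noteq> j \<longleftrightarrow> i = Suc j mod 2" if "i < 2" "j < 2" for i j :: nat
    using that by (cases i; cases j) (auto simp: less_Suc_eq numeral_2_eq_2)
  with True show ?thesis
    by (intro eq_matI) (auto simp: M_cyc_def shift_scale_def shift_def)
next
  case False
  then show ?thesis by (intro eq_matI) (auto simp: M_cyc_def shift_scale_def shift_def)
qed

lemma M_cyc_carrier [simp]: "M_cyc p \<in> carrier_mat p p"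
  by (simp add: M_cyc_shift shift_def)

lemma dim_M_cyc [simp]: "dim_row (M_cyc p) = p" "dim_col (M_cyc p) = p"
  using M_cyc_carrier[of p] by blast+

lemma M_cyc_entry:
  "i < p \<Longrightarrow> j < p \<Longrightarrow>
    M_cyc p $$ (i, j) = (if i = (j + 1) mod p then shift_scale p else 0)"
  by (simp add: M_cyc_shift shift_def)

lemma det_M_cyc:
  assumes "prime p"
  shows "det (M_cyc p) = 1"
proof (cases "p = 2")
  case True
  have "shift 2 = swaprows_mat 2 0 1"
  proof (rule eq_matI)
    fix i j :: nat assume "i < dim_row (swaprows_mat 2 0 1 :: complex mat)"
      "j < dim_col (swaprows_mat 2 0 1 :: complex mat)"
    then have "i = 0 \<or> i = 1" "j = 0 \<or> j = 1" by (auto simp: swaprows_mat_def)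
    then show "shift 2 $$ (i, j) = swaprows_mat 2 0 1 $$ (i, j)"
      by (auto simp: shift_def swaprows_mat_def)
  qed (auto simp: shift_def swaprows_mat_def)
  moreover have "det (swaprows_mat 2 0 1 :: complex mat) = - 1"
    by (rule det_swaprows_mat) auto
  ultimately show ?thesis
    using True by (simp add: M_cyc_shift det_smult shift_scale_def shift_def swaprows_mat_def)
next
  case False
  then have p: "odd p" "p > 0" using assms prime_odd_nat[of p] prime_ge_2_nat[of p] by force+
  \<comment> \<open>The determinant \<open>d\<close> satisfies \<open>d\<^sup>2 = 1\<close> (the matrix is orthogonal) and \<open>d ^ p = 1\<close>
    (it has order \<open>p\<close>); as \<open>p\<close> is odd, \<open>d = 1\<close>.\<close>
  have sc: "shift p \<in> carrier_mat p p" by (simp add: shift_def)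
  have rows: "shift p * transpose_mat (shift p) = 1\<^sub>m p"
  proof (rule eq_matI)
    fix i j assume ij: "i < dim_row (1\<^sub>m p)" "j < dim_col (1\<^sub>m p)"
    define k where "k = (if i = 0 then p - 1 else i - 1)"
    have kp: "k < p" using ij unfolding k_def by auto
    have k: "(i = (l + 1) mod p) = (l = k)" if "l < p" for l
      using ij that unfolding k_def by (auto simp: mod_Suc)
    have "(shift p * transpose_mat (shift p)) $$ (i, j) =
      (\<Sum>l = 0..<p. (if i = (l + 1) mod p then 1 else 0) * (if j = (l + 1) mod p then 1 else 0))"
      using ij by (simp add: shift_def scalar_prod_def)
    also have "\<dots> = (\<Sum>l = 0..<p. if l = k then (if j = (l + 1) mod p then 1 else 0) else 0)"
      by (rule sum.cong) (simp_all only: k atLeastLessThan_iff, auto)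
    also have "\<dots> = (if j = (k + 1) mod p then 1 else 0)" using kp by simp
    also have "(k + 1) mod p = i"
      using k[OF kp] by simp
    also have "(if j = i then 1 else 0) = 1\<^sub>m p $$ (i, j)" using ij by simp
    finally show "(shift p * transpose_mat (shift p)) $$ (i, j) = 1\<^sub>m p $$ (i, j)" .
  qed (auto simp: shift_def)
  have sq: "det (shift p) * det (shift p) = 1"
    using arg_cong[OF rows, of det] sc by (simp add: det_mult[of _ p] det_transpose)
  have pow: "shift p ^\<^sub>m k = mat p p (\<lambda>(i, j). if i = (j + k) mod p then 1 else 0)" for k
  proof (induction k)
    case 0
    show ?case by (rule eq_matI) (auto simp: shift_def)
  next
    case (Suc k)
    show ?case
    proof (rule eq_matI)
      fix i j assume ij: "i < dim_row (mat p p (\<lambda>(i, j). if i = (j + Suc k) mod p then 1 else (0::complex)))"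
        "j < dim_col (mat p p (\<lambda>(i, j). if i = (j + Suc k) mod p then 1 else (0::complex)))"
      have "(shift p ^\<^sub>m Suc k) $$ (i, j) =
        (\<Sum>l = 0..<p. (if i = (l + k) mod p then 1 else 0) * (if l = (j + 1) mod p then 1 else 0))"
        using ij Suc by (simp add: shift_def scalar_prod_def)
      also have "\<dots> = (\<Sum>l = 0..<p. if l = (j + 1) mod p then (if i = (l + k) mod p then 1 else 0) else 0)"
        by (rule sum.cong) auto
      also have "\<dots> = (if i = ((j + 1) mod p + k) mod p then 1 else 0)" using p by simp
      also have "((j + 1) mod p + k) mod p = (j + Suc k) mod p" by (simp add: mod_simps)
      finally show "(shift p ^\<^sub>m Suc k) $$ (i, j) =
         mat p p (\<lambda>(i, j). if i = (j + Suc k) mod p then 1 else 0) $$ (i, j)"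
        using ij by simp
    qed (auto simp: shift_def Suc)
  qed
  have ord: "shift p ^\<^sub>m p = 1\<^sub>m p" unfolding pow by (rule eq_matI) auto
  have "det (shift p ^\<^sub>m k) = det (shift p) ^ k" for k
    by (induction k) (use sc in \<open>auto simp: det_mult[of _ p] pow_carrier_mat\<close>)
  from this[of p] ord have "det (shift p) ^ p = 1" by simp
  moreover from sq have "det (shift p) = 1 \<or> det (shift p) = - 1" by (simp only: square_eq_1_iff)
  ultimately have "det (shift p) = 1" using p by auto
  with False show ?thesis
    by (simp add: M_cyc_shift det_smult shift_scale_def)
qed

lemma clock_M_cyc_commute:
  assumes "z ^ p = 1" "p > 0"
  shows "clock p z * M_cyc p = z \<cdot>\<^sub>m (M_cyc p * clock p z)"
proof (rule eq_matI)
  fix i j assume "i < dim_row (z \<cdot>\<^sub>m (M_cyc p * clock p z))" "j < dim_col (z \<cdot>\<^sub>m (M_cyc p * clock p z))"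
  then have ij: "i < p" "j < p" by (auto simp: clock_def M_cyc_shift shift_def mat_diag_def)
  have "z ^ ((j + 1) mod p) = z * z ^ j"
    using assms ij by (cases "j + 1 = p") auto
  then show "(clock p z * M_cyc p) $$ (i, j) = (z \<cdot>\<^sub>m (M_cyc p * clock p z)) $$ (i, j)"
    using ij unfolding clock_def
    by (simp add: mat_diag_mult_left[of _ p p] mat_diag_mult_right[of _ p p] M_cyc_entry)
qed (auto simp: clock_def M_cyc_shift shift_def)

text \<open>The point is that the eigenvalues \<open>z ^ i\<close> of the clock matrix are distinct.\<close>

lemma commutes_with_clock_diagonal:
  assumes p: "prime p" and z: "z ^ p = 1" "z \<noteq> 1"
    and X: "X \<in> carrier_mat p p" "clock p z * X = X * clock p z"
  obtains f where "X = mat_diag p f"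
proof
  show "X = mat_diag p (\<lambda>i. X $$ (i, i))"
  proof (rule eq_matI)
    fix i j assume "i < dim_row (mat_diag p (\<lambda>i. X $$ (i, i)))" "j < dim_col (mat_diag p (\<lambda>i. X $$ (i, i)))"
    then have ij: "i < p" "j < p" by (auto simp: mat_diag_def)
    have "z ^ i * X $$ (i, j) = X $$ (i, j) * z ^ j"
      using arg_cong[OF X(2), of "\<lambda>M. M $$ (i, j)"] ij X(1) unfolding clock_def
      by (simp add: mat_diag_mult_left[of _ p p] mat_diag_mult_right[of _ p p])
    then have "i = j \<or> X $$ (i, j) = 0"
      using root_of_unity_power_inj[OF p z ij] by auto
    with ij show "X $$ (i, j) = mat_diag p (\<lambda>i. X $$ (i, i)) $$ (i, j)"
      by (auto simp: mat_diag_def)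
  qed (use X in \<open>auto simp: mat_diag_def\<close>)
qed


lemma clock_mult_vec:
  assumes "v \<in> carrier_vec p"
  shows "clock p z *\<^sub>v v = vec p (\<lambda>i. z ^ i * v $ i)"
proof (rule eq_vecI)
  fix i assume "i < dim_vec (vec p (\<lambda>i. z ^ i * v $ i))"
  then have i: "i < p" by simp
  have "(clock p z *\<^sub>v v) $ i = (\<Sum>j = 0..<p. (if i = j then z ^ j else 0) * v $ j)"
    using i assms by (simp add: clock_def mat_diag_def scalar_prod_def)
  also have "\<dots> = (\<Sum>j = 0..<p. if j = i then z ^ i * v $ i else 0)"
    by (rule sum.cong) auto
  finally show "(clock p z *\<^sub>v v) $ i = vec p (\<lambda>i. z ^ i * v $ i) $ i" using i by simp
qed (simp add: clock_def)

text \<open>Up to a factor \<open>p\<close>, the projection onto the \<open>j\<close>-th coordinate line is the polynomial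
  \<open>\<Sum>k<p. (C / z ^ j) ^ k\<close> in the clock matrix \<open>C\<close>, because the sum of the \<open>k\<close>-th powers of
  \<open>z ^ i / z ^ j\<close> vanishes for \<open>i \<noteq> j\<close>; so it maps an invariant subspace to itself.\<close>

lemma clock_invariant_unit_vec:
  assumes p: "prime p" and z: "z ^ p = 1" "z \<noteq> 1"
    and W: "W \<subseteq> carrier_vec p" "\<And>v w. v \<in> W \<Longrightarrow> w \<in> W \<Longrightarrow> v + w \<in> W"
      "\<And>c v. v \<in> W \<Longrightarrow> c \<cdot>\<^sub>v v \<in> W"
      "\<And>v. v \<in> W \<Longrightarrow> clock p z *\<^sub>v v \<in> W"
    and w: "w \<in> W" "j < p" "w $ j \<noteq> 0"
  shows "unit_vec p j \<in> W"
proof -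
  have z0: "z \<noteq> 0" using z(1) w(2) by (metis gr_implies_not0 power_0_left zero_neq_one)
  have wc: "w \<in> carrier_vec p" using W(1) w(1) by auto
  \<comment> \<open>The powers of \<open>C / z ^ j\<close> applied to \<open>w\<close>, then their partial sums.\<close>
  have u: "vec p (\<lambda>i. (z ^ i / z ^ j) ^ k * w $ i) \<in> W" for k
  proof (induction k)
    case 0
    have "vec p (\<lambda>i. (z ^ i / z ^ j) ^ 0 * w $ i) = w" using wc by (intro eq_vecI) auto
    then show ?case using w(1) by simp
  next
    case (Suc k)
    have "vec p (\<lambda>i. (z ^ i / z ^ j) ^ Suc k * w $ i) =
        (1 / z ^ j) \<cdot>\<^sub>v (clock p z *\<^sub>v vec p (\<lambda>i. (z ^ i / z ^ j) ^ k * w $ i))"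
      by (subst clock_mult_vec) (auto intro!: eq_vecI)
    then show ?case using W(3)[OF W(4)[OF Suc]] by simp
  qed
  have S: "vec p (\<lambda>i. (\<Sum>k<m. (z ^ i / z ^ j) ^ k) * w $ i) \<in> W" for m
  proof (induction m)
    case 0
    have "vec p (\<lambda>i. (\<Sum>k<0. (z ^ i / z ^ j) ^ k) * w $ i) = 0 \<cdot>\<^sub>v w"
      using wc by (intro eq_vecI) auto
    then show ?case using W(3)[OF w(1)] by simp
  next
    case (Suc m)
    have "vec p (\<lambda>i. (\<Sum>k<Suc m. (z ^ i / z ^ j) ^ k) * w $ i) =
        vec p (\<lambda>i. (\<Sum>k<m. (z ^ i / z ^ j) ^ k) * w $ i) + vec p (\<lambda>i. (z ^ i / z ^ j) ^ m * w $ i)"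
      by (intro eq_vecI) (auto simp: algebra_simps)
    then show ?case using W(2)[OF Suc u] by simp
  qed
  have "(\<Sum>k<p. (z ^ i / z ^ j) ^ k) = (if i = j then of_nat p else 0)" if "i < p" for i
  proof (cases "i = j")
    case True then show ?thesis using z0 by simp
  next
    case False
    then have "z ^ i / z ^ j \<noteq> 1"
      using root_of_unity_power_inj[OF p z that w(2)] z0 by auto
    moreover have "(z ^ i / z ^ j) ^ p = 1"
    proof -
      have "(z ^ l) ^ p = (z ^ p) ^ l" for l by (simp only: power_mult[symmetric] mult.commute)
      then show ?thesis using z(1) by (simp add: power_divide)
    qed
    ultimately show ?thesis using False by (simp add: geometric_sum)
  qed
  with z0 have "vec p (\<lambda>i. (\<Sum>k<p. (z ^ i / z ^ j) ^ k) * w $ i) = (of_nat p * w $ j) \<cdot>\<^sub>v unit_vec p j"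
    by (intro eq_vecI) (auto simp: unit_vec_def)
  then have "(of_nat p * w $ j) \<cdot>\<^sub>v unit_vec p j \<in> W" using S[of p] by simp
  then have "(1 / (of_nat p * w $ j)) \<cdot>\<^sub>v ((of_nat p * w $ j) \<cdot>\<^sub>v unit_vec p j) \<in> W" by (rule W(3))
  then show ?thesis using w(2,3) by (simp add: smult_smult_assoc)
qed

lemma M_cyc_unit_vec:
  assumes "j < p"
  shows "M_cyc p *\<^sub>v unit_vec p j = shift_scale p \<cdot>\<^sub>v unit_vec p ((j + 1) mod p)"
proof (rule eq_vecI)
  fix i assume "i < dim_vec (shift_scale p \<cdot>\<^sub>v unit_vec p ((j + 1) mod p))"
  then have i: "i < p" by simp
  have "(M_cyc p *\<^sub>v unit_vec p j) $ i = row (M_cyc p) i \<bullet> unit_vec p j"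
    using i by simp
  also have "\<dots> = row (M_cyc p) i $ j" using assms by (rule scalar_prod_right_unit)
  also have "\<dots> = M_cyc p $$ (i, j)" using i assms by simp
  finally show "(M_cyc p *\<^sub>v unit_vec p j) $ i = (shift_scale p \<cdot>\<^sub>v unit_vec p ((j + 1) mod p)) $ i"
    using i assms by (simp add: M_cyc_entry unit_vec_def)
qed simp

lemma clock_shift_irreducible:
  assumes p: "prime p" and z: "z ^ p = 1" "z \<noteq> 1"
    and W: "W \<subseteq> carrier_vec p" "\<And>v w. v \<in> W \<Longrightarrow> w \<in> W \<Longrightarrow> v + w \<in> W"
      "\<And>c v. v \<in> W \<Longrightarrow> c \<cdot>\<^sub>v v \<in> W"
      "\<And>v. v \<in> W \<Longrightarrow> clock p z *\<^sub>v v \<in> W" "\<And>v. v \<in> W \<Longrightarrow> M_cyc p *\<^sub>v v \<in> W"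
    and w: "w \<in> W" "w \<noteq> 0\<^sub>v p"
  shows "W = carrier_vec p"
proof -
  have wc: "w \<in> carrier_vec p" using W(1) w(1) by auto
  obtain j where j: "j < p" "w $ j \<noteq> 0"
    using wc w(2) by (metis carrier_vecD eq_vecI index_zero_vec(1,2))
  have p0: "p > 0" using j by simp
  have unit: "unit_vec p ((j + k) mod p) \<in> W" for k
  proof (induction k)
    case 0
    show ?case using clock_invariant_unit_vec[OF p z W(1-4) w(1) j] j by simp
  next
    case (Suc k)
    have "M_cyc p *\<^sub>v unit_vec p ((j + k) mod p) \<in> W" using Suc W(5) by blast
    then have "(1 / shift_scale p) \<cdot>\<^sub>v (shift_scale p \<cdot>\<^sub>v unit_vec p (((j + k) mod p + 1) mod p)) \<in> W"
      using W(3) p0 by (simp add: M_cyc_unit_vec)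
    moreover have "((j + k) mod p + 1) mod p = (j + Suc k) mod p" by (simp add: mod_simps)
    ultimately show ?case by (simp add: smult_smult_assoc)
  qed
  have unit: "unit_vec p i \<in> W" if "i < p" for i
    using unit[of "p - j + i"] that j by simp
  have "v \<in> W" if v: "v \<in> carrier_vec p" for v
  proof -
    have "vec p (\<lambda>i. if i < m then v $ i else 0) \<in> W" if "m \<le> p" for m
      using that
    proof (induction m)
      case 0
      have "vec p (\<lambda>i. if i < 0 then v $ i else 0) = 0 \<cdot>\<^sub>v w" using wc by (intro eq_vecI) auto
      then show ?case using W(3)[OF w(1)] by simp
    next
      case (Suc m)
      have "vec p (\<lambda>i. if i < Suc m then v $ i else 0) =
          vec p (\<lambda>i. if i < m then v $ i else 0) + v $ m \<cdot>\<^sub>v unit_vec p m"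
        using Suc.prems by (intro eq_vecI) (auto simp: unit_vec_def less_Suc_eq)
      moreover have "vec p (\<lambda>i. if i < m then v $ i else 0) \<in> W" using Suc by simp
      moreover have "v $ m \<cdot>\<^sub>v unit_vec p m \<in> W" using unit W(3) Suc.prems by simp
      ultimately show ?case using W(2) by simp
    qed
    from this[of p] have "vec p (\<lambda>i. if i < p then v $ i else 0) \<in> W" by simp
    moreover have "vec p (\<lambda>i. if i < p then v $ i else 0) = v" using v by (intro eq_vecI) auto
    ultimately show ?thesis by simp
  qed
  then show ?thesis using W(1) by auto
qed

section \<open>Schur's lemma and the canonical form of a Weyl pair\<close>

definition acts_irreducibly :: "nat \<Rightarrow> complex mat set \<Rightarrow> bool" where
  "acts_irreducibly n S \<longleftrightarrow>
     (\<forall>W. subspace class_ring W (module_vec TYPE(complex) n) \<longrightarrow>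
        (\<forall>X\<in>S. \<forall>v\<in>W. X *\<^sub>v v \<in> W) \<longrightarrow> W = {0\<^sub>v n} \<or> W = carrier_vec n)"

lemma subspace_vec_iff:
  "subspace class_ring W (module_vec TYPE(complex) n) \<longleftrightarrow>
     W \<subseteq> carrier_vec n \<and> 0\<^sub>v n \<in> W \<and> (\<forall>v\<in>W. \<forall>w\<in>W. v + w \<in> W) \<and> (\<forall>c. \<forall>v\<in>W. c \<cdot>\<^sub>v v \<in> W)"
  (is "?L \<longleftrightarrow> ?R")
proof
  assume ?L
  then have "submodule class_ring W (module_vec TYPE(complex) n)"
    by (simp add: VectorSpace.subspace_def)
  then show ?R
    by (auto simp: submodule_def module_vec_simps class_ring_simps)
next
  assume ?R
  then show ?L
    by (auto simp: VectorSpace.subspace_def submodule_def module_vec_simps class_ring_simps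
        vec_module vec_vs)
qed

lemma eigenvector_exists:
  fixes A :: "complex mat"
  assumes "A \<in> carrier_mat n n" "n > 0"
  obtains v k where "v \<in> carrier_vec n" "v \<noteq> 0\<^sub>v n" "A *\<^sub>v v = k \<cdot>\<^sub>v v"
proof -
  from spectrum_non_empty[OF assms] obtain k where "eigenvalue A k"
    unfolding spectrum_def by auto
  then show thesis
    using that assms(1) unfolding eigenvalue_def eigenvector_def by auto
qed

lemma smult_mat_mult_vec:
  fixes A :: "complex mat"
  assumes "A \<in> carrier_mat m n" "v \<in> carrier_vec n"
  shows "(c \<cdot>\<^sub>m A) *\<^sub>v v = c \<cdot>\<^sub>v (A *\<^sub>v v)"
  using assms by (intro eq_vecI) auto

lemma mult_unit_vec_index:
  fixes A :: "complex mat"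
  assumes "A \<in> carrier_mat m n" "i < m" "j < n"
  shows "(A *\<^sub>v unit_vec n j) $ i = A $$ (i, j)"
proof -
  have "(A *\<^sub>v unit_vec n j) $ i = row A i \<bullet> unit_vec n j" using assms by simp
  also have "\<dots> = row A i $ j" by (rule scalar_prod_right_unit) (use assms in auto)
  finally show ?thesis using assms by simp
qed

text \<open>An eigenspace of a matrix that commutes with \<open>S\<close> is invariant under \<open>S\<close>, and there is a
  nonzero one over the complex numbers.\<close>

lemma Schur:
  assumes S: "acts_irreducibly n S" "S \<subseteq> carrier_mat n n" "n > 0"
    and A: "A \<in> carrier_mat n n" "\<And>X. X \<in> S \<Longrightarrow> A * X = X * A"
  obtains k where "A = k \<cdot>\<^sub>m 1\<^sub>m n"
proof -
  obtain v k where v: "v \<in> carrier_vec n" "v \<noteq> 0\<^sub>v n" "A *\<^sub>v v = k \<cdot>\<^sub>v v"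
    using eigenvector_exists[OF A(1) S(3)] by blast
  define W where "W = {v \<in> carrier_vec n. A *\<^sub>v v = k \<cdot>\<^sub>v v}"
  have "subspace class_ring W (module_vec TYPE(complex) n)"
    unfolding subspace_vec_iff W_def using A(1)
    by (auto simp: mult_add_distrib_mat_vec smult_add_distrib_vec mult_mat_vec smult_smult_assoc
        mult.commute)
  moreover have "X *\<^sub>v w \<in> W" if "X \<in> S" "w \<in> W" for X w
  proof -
    have X: "X \<in> carrier_mat n n" using that S(2) by auto
    have w: "w \<in> carrier_vec n" "A *\<^sub>v w = k \<cdot>\<^sub>v w" using that W_def by auto
    have "A *\<^sub>v (X *\<^sub>v w) = (A * X) *\<^sub>v w" using A(1) X w(1) by simp
    also have "\<dots> = (X * A) *\<^sub>v w" using A(2) that by simp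
    also have "\<dots> = X *\<^sub>v (A *\<^sub>v w)" using A(1) X w(1) by simp
    also have "\<dots> = k \<cdot>\<^sub>v (X *\<^sub>v w)" using w X by (simp add: mult_mat_vec)
    finally show ?thesis using X w unfolding W_def by simp
  qed
  moreover have "W \<noteq> {0\<^sub>v n}" using v W_def by blast
  ultimately have W: "W = carrier_vec n" using S(1) unfolding acts_irreducibly_def by blast
  have "A = k \<cdot>\<^sub>m 1\<^sub>m n"
  proof (rule eq_matI)
    fix i j assume "i < dim_row (k \<cdot>\<^sub>m 1\<^sub>m n)" "j < dim_col (k \<cdot>\<^sub>m 1\<^sub>m n)"
    then have ij: "i < n" "j < n" by auto
    have "unit_vec n j \<in> W" using W by simp
    then have "(A *\<^sub>v unit_vec n j) $ i = (k \<cdot>\<^sub>v unit_vec n j) $ i" unfolding W_def by simp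
    then show "A $$ (i, j) = (k \<cdot>\<^sub>m 1\<^sub>m n) $$ (i, j)"
      using ij mult_unit_vec_index[OF A(1)] by (simp add: unit_vec_def)
  qed (use A in auto)
  then show thesis by (rule that)
qed

lemma acts_irreducibly_conj:
  assumes S: "acts_irreducibly n S" "S \<subseteq> carrier_mat n n"
    and P: "P \<in> carrier_mat n n" "Q \<in> carrier_mat n n" "P * Q = 1\<^sub>m n" "Q * P = 1\<^sub>m n"
    and T: "\<And>A. A \<in> S \<Longrightarrow> P * A * Q \<in> T"
  shows "acts_irreducibly n T"
  unfolding acts_irreducibly_def
proof (intro allI impI)
  fix W assume W: "subspace class_ring W (module_vec TYPE(complex) n)"
    and inv: "\<forall>X\<in>T. \<forall>v\<in>W. X *\<^sub>v v \<in> W"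
  have Wv: "W \<subseteq> carrier_vec n" "0\<^sub>v n \<in> W" "\<And>v w. v \<in> W \<Longrightarrow> w \<in> W \<Longrightarrow> v + w \<in> W"
    "\<And>k v. v \<in> W \<Longrightarrow> k \<cdot>\<^sub>v v \<in> W" using W unfolding subspace_vec_iff by auto
  have PQ: "P *\<^sub>v (Q *\<^sub>v v) = v" and QP: "Q *\<^sub>v (P *\<^sub>v v) = v" if "v \<in> carrier_vec n" for v
    using that P by (simp_all flip: assoc_mult_mat_vec)
  have P0: "P *\<^sub>v 0\<^sub>v n = 0\<^sub>v n" using P(1) by (intro eq_vecI) auto
  define W' where "W' = {w \<in> carrier_vec n. P *\<^sub>v w \<in> W}"
  have "subspace class_ring W' (module_vec TYPE(complex) n)"
    unfolding subspace_vec_iff W'_def using Wv P P0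
    by (auto simp: mult_add_distrib_mat_vec mult_mat_vec)
  moreover have "A *\<^sub>v w \<in> W'" if A: "A \<in> S" and w: "w \<in> W'" for A w
  proof -
    have Ac: "A \<in> carrier_mat n n" and wc: "w \<in> carrier_vec n" "P *\<^sub>v w \<in> W"
      using A w S(2) by (auto simp: W'_def)
    have "(P * A * Q) *\<^sub>v (P *\<^sub>v w) \<in> W" using T[OF A] inv wc(2) by blast
    moreover have "(P * A * Q) *\<^sub>v (P *\<^sub>v w) = (P * A) *\<^sub>v (Q *\<^sub>v (P *\<^sub>v w))"
      by (rule assoc_mult_mat_vec) (use P Ac wc in auto)
    moreover have "\<dots> = P *\<^sub>v (A *\<^sub>v w)" using QP[OF wc(1)] P(1) Ac wc(1) by simp
    ultimately show ?thesis using Ac wc by (simp add: W'_def)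
  qed
  ultimately have "W' = {0\<^sub>v n} \<or> W' = carrier_vec n"
    using S(1) unfolding acts_irreducibly_def by blast
  moreover have WW': "W = (\<lambda>w. P *\<^sub>v w) ` W'"
  proof (intro equalityI subsetI)
    fix v assume v: "v \<in> W"
    then have vc: "v \<in> carrier_vec n" using Wv(1) by auto
    have "Q *\<^sub>v v \<in> W'" using v PQ[OF vc] P(2) vc by (simp add: W'_def)
    then show "v \<in> (\<lambda>w. P *\<^sub>v w) ` W'" using PQ[OF vc, symmetric] by (rule image_eqI[rotated])
  qed (auto simp: W'_def)
  moreover have "(\<lambda>w. P *\<^sub>v w) ` carrier_vec n = carrier_vec n"
  proof (intro equalityI subsetI)
    fix v assume v: "v \<in> (carrier_vec n :: complex vec set)"
    then have "Q *\<^sub>v v \<in> carrier_vec n" using P(2) by simp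
    then show "v \<in> (\<lambda>w. P *\<^sub>v w) ` carrier_vec n" using PQ[OF v, symmetric] by (rule image_eqI[rotated])
  qed (use P(1) in auto)
  ultimately show "W = {0\<^sub>v n} \<or> W = carrier_vec n" using P0 by auto
qed

lemma inverse_of_det_nonzero:
  fixes P :: "complex mat"
  assumes "P \<in> carrier_mat n n" "det P \<noteq> 0"
  obtains Q where "Q \<in> carrier_mat n n" "P * Q = 1\<^sub>m n" "Q * P = 1\<^sub>m n"
proof -
  from det_non_zero_imp_unit[OF assms]
  have "P \<in> Units (ring_mat TYPE(complex) n ())" .
  then obtain Q where "Q \<in> carrier_mat n n" "P * Q = 1\<^sub>m n" "Q * P = 1\<^sub>m n"
    by (auto simp: Units_def ring_mat_simps)
  then show thesis by (rule that)
qed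

text \<open>Starting from an eigenvector \<open>v\<close> of \<open>A\<close>, the vectors \<open>B ^ j v\<close> are eigenvectors for
  distinct eigenvalues. In the resulting basis \<open>A\<close> becomes a multiple of the clock matrix and
  \<open>B\<close> the shift, up to one entry that is fixed by the determinant.\<close>

lemma Weyl_pair_canonical_form:
  assumes p: "prime p" and z: "z ^ p = 1" "z \<noteq> 1"
    and A: "A \<in> carrier_mat p p" "det A = 1" and B: "B \<in> carrier_mat p p" "det B = 1"
    and AB: "A * B = z \<cdot>\<^sub>m (B * A)"
  obtains P c where "P \<in> carrier_mat p p" "det P = 1" "A * P = c \<cdot>\<^sub>m (P * clock p z)"
    "B * P = P * M_cyc p"
proof -
  have p0: "p > 0" using p prime_gt_0_nat by blast
  obtain v k where v: "v \<in> carrier_vec p" "v \<noteq> 0\<^sub>v p" "A *\<^sub>v v = k \<cdot>\<^sub>v v"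
    using eigenvector_exists[OF A(1) p0] by blast
  have injA: "w = 0\<^sub>v p" if "A *\<^sub>v w = 0\<^sub>v p" "w \<in> carrier_vec p" for w
    using that A det_0_iff_vec_prod_zero[OF A(1)] by auto
  have injB: "w = 0\<^sub>v p" if "B *\<^sub>v w = 0\<^sub>v p" "w \<in> carrier_vec p" for w
    using that B det_0_iff_vec_prod_zero[OF B(1)] by auto
  have zero_smult: "0 \<cdot>\<^sub>v w = 0\<^sub>v p" if "w \<in> carrier_vec p" for w :: "complex vec"
    using that by (intro eq_vecI) auto
  have smult_zero: "c \<cdot>\<^sub>v 0\<^sub>v p = (0\<^sub>v p :: complex vec)" for c
    by (intro eq_vecI) auto
  have k0: "k \<noteq> 0"
    using injA[OF _ v(1)] v zero_smult by auto
  have cancel: "x = y" if "c \<cdot>\<^sub>v x = c \<cdot>\<^sub>v y" "c \<noteq> 0" for c :: complex and x y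
  proof -
    have "w = (1 / c) \<cdot>\<^sub>v (c \<cdot>\<^sub>v w)" for w using that(2) by (simp add: smult_smult_assoc)
    then show ?thesis using that(1) by metis
  qed
  define t where "t = shift_scale p"
  have t0: "t \<noteq> 0" by (simp add: t_def)
  \<comment> \<open>The factor \<open>1 / t\<close> makes \<open>B\<close> act on the basis as the shift with entries \<open>t\<close>, which is
    the cyclic matrix also for \<open>p = 2\<close>.\<close>
  define u where "u = rec_nat v (\<lambda>_ w. (1 / t) \<cdot>\<^sub>v (B *\<^sub>v w))"
  have u0: "u 0 = v" and uS: "u (Suc j) = (1 / t) \<cdot>\<^sub>v (B *\<^sub>v u j)" for j
    by (simp_all add: u_def)
  have uc: "u j \<in> carrier_vec p" for j
    by (induction j) (use v B in \<open>auto simp: u0 uS\<close>)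
  have Bu: "B *\<^sub>v u j = t \<cdot>\<^sub>v u (Suc j)" for j
    using t0 by (simp add: uS smult_smult_assoc)
  have Au: "A *\<^sub>v u j = (k * z ^ j) \<cdot>\<^sub>v u j" for j
  proof (induction j)
    case 0
    show ?case using v by (simp add: u0)
  next
    case (Suc j)
    have "A *\<^sub>v (B *\<^sub>v u j) = (A * B) *\<^sub>v u j" using A(1) B(1) uc[of j] by simp
    also have "\<dots> = z \<cdot>\<^sub>v ((B * A) *\<^sub>v u j)"
      unfolding AB by (rule smult_mat_mult_vec[of _ p p]) (use A(1) B(1) uc in auto)
    also have "(B * A) *\<^sub>v u j = B *\<^sub>v (A *\<^sub>v u j)" using A(1) B(1) uc[of j] by simp
    also have "\<dots> = (k * z ^ j) \<cdot>\<^sub>v (B *\<^sub>v u j)"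
      unfolding Suc by (rule mult_mat_vec) (use B(1) uc in auto)
    finally have AB': "A *\<^sub>v (B *\<^sub>v u j) = (k * z ^ Suc j) \<cdot>\<^sub>v (B *\<^sub>v u j)"
      by (simp add: smult_smult_assoc mult_ac)
    have "A *\<^sub>v u (Suc j) = (1 / t) \<cdot>\<^sub>v (A *\<^sub>v (B *\<^sub>v u j))"
      unfolding uS by (rule mult_mat_vec) (use A(1) B(1) uc[of j] in auto)
    then show ?case unfolding AB' by (simp add: uS smult_smult_assoc mult_ac)
  qed
  have un0: "u j \<noteq> 0\<^sub>v p" for j
  proof (induction j)
    case 0
    show ?case using v by (simp add: u0)
  next
    case (Suc j)
    then show ?case using injB[OF _ uc] Bu[of j] smult_zero by auto
  qed
  define P where "P = mat p p (\<lambda>(i, j). u j $ i)"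
  have Pc: "P \<in> carrier_mat p p" by (simp add: P_def)
  have colP: "col P j = u j" if "j < p" for j
    using that uc[of j] by (intro eq_vecI) (auto simp: P_def)
  have AP: "A * P = k \<cdot>\<^sub>m (P * clock p z)"
  proof (rule eq_matI)
    fix i j assume "i < dim_row (k \<cdot>\<^sub>m (P * clock p z))" "j < dim_col (k \<cdot>\<^sub>m (P * clock p z))"
    then have ij: "i < p" "j < p" by (auto simp: P_def)
    have "(A * P) $$ (i, j) = (A *\<^sub>v u j) $ i" using ij A(1) Pc by (simp add: colP)
    also have "\<dots> = (k * z ^ j) * u j $ i" using ij uc[of j] by (simp add: Au)
    also have "\<dots> = (k \<cdot>\<^sub>m (P * clock p z)) $$ (i, j)"
      using ij Pc unfolding clock_def
      by (simp add: mat_diag_mult_right[OF Pc]) (simp add: P_def)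
    finally show "(A * P) $$ (i, j) = (k \<cdot>\<^sub>m (P * clock p z)) $$ (i, j)" .
  qed (use A(1) Pc in auto)
  have APv: "A *\<^sub>v (P *\<^sub>v w) = k \<cdot>\<^sub>v (P *\<^sub>v (clock p z *\<^sub>v w))" if "w \<in> carrier_vec p" for w
  proof -
    have "A *\<^sub>v (P *\<^sub>v w) = (k \<cdot>\<^sub>m (P * clock p z)) *\<^sub>v w"
      unfolding AP[symmetric] by (rule assoc_mult_mat_vec[symmetric]) (use A(1) Pc that in auto)
    also have "\<dots> = k \<cdot>\<^sub>v ((P * clock p z) *\<^sub>v w)"
      by (rule smult_mat_mult_vec[of _ p p]) (use Pc that in auto)
    also have "(P * clock p z) *\<^sub>v w = P *\<^sub>v (clock p z *\<^sub>v w)"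
      by (rule assoc_mult_mat_vec) (use Pc that in auto)
    finally show ?thesis .
  qed
  have Pe: "P *\<^sub>v unit_vec p j = u j" if "j < p" for j
  proof (rule eq_vecI)
    fix i assume "i < dim_vec (u j)"
    then have i: "i < p" using uc[of j] by simp
    show "(P *\<^sub>v unit_vec p j) $ i = u j $ i"
      using i that mult_unit_vec_index[OF Pc] by (simp add: P_def)
  qed (use uc[of j] Pc in simp)
  have "det P \<noteq> 0"
  proof
    assume "det P = 0"
    then obtain w where w: "w \<in> carrier_vec p" "w \<noteq> 0\<^sub>v p" "P *\<^sub>v w = 0\<^sub>v p"
      using det_0_iff_vec_prod_zero[OF Pc] by blast
    obtain j where j: "j < p" "w $ j \<noteq> 0"
      using w by (metis carrier_vecD eq_vecI index_zero_vec(1,2))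
    define W where "W = {w \<in> carrier_vec p. P *\<^sub>v w = 0\<^sub>v p}"
    have "unit_vec p j \<in> W"
    proof (rule clock_invariant_unit_vec[OF p z _ _ _ _ _ j])
      fix x assume "x \<in> W"
      then have x: "x \<in> carrier_vec p" "P *\<^sub>v x = 0\<^sub>v p" by (auto simp: W_def)
      have "A *\<^sub>v 0\<^sub>v p = 0\<^sub>v p" using A(1) by (intro eq_vecI) auto
      then have "k \<cdot>\<^sub>v (P *\<^sub>v (clock p z *\<^sub>v x)) = k \<cdot>\<^sub>v 0\<^sub>v p"
        using APv[OF x(1)] x(2) smult_zero by simp
      then have "P *\<^sub>v (clock p z *\<^sub>v x) = 0\<^sub>v p" using cancel k0 by blast
      moreover have "clock p z *\<^sub>v x \<in> carrier_vec p"
        using clock_carrier x(1) by (rule mult_mat_vec_carrier)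
      ultimately show "clock p z *\<^sub>v x \<in> W" by (simp add: W_def)
    qed (use w Pc smult_zero in \<open>auto simp: W_def mult_add_distrib_mat_vec mult_mat_vec\<close>)
    then show False using un0[of j] j Pe by (simp add: W_def)
  qed
  then obtain Q where Q: "Q \<in> carrier_mat p p" "P * Q = 1\<^sub>m p" "Q * P = 1\<^sub>m p"
    using inverse_of_det_nonzero[OF Pc] by blast
  have PQ: "P *\<^sub>v (Q *\<^sub>v w) = w" and QP: "Q *\<^sub>v (P *\<^sub>v w) = w" if "w \<in> carrier_vec p" for w
    using that Pc Q by (simp_all flip: assoc_mult_mat_vec)
  \<comment> \<open>\<open>u p\<close> is a \<open>k\<close>-eigenvector of \<open>A\<close>, hence a multiple of \<open>u 0\<close>.\<close>
  define w where "w = Q *\<^sub>v u p"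
  have wc: "w \<in> carrier_vec p" using Q(1) uc[of p] by (simp add: w_def)
  have cwc: "clock p z *\<^sub>v w \<in> carrier_vec p" using clock_carrier wc by (rule mult_mat_vec_carrier)
  have "k \<cdot>\<^sub>v (P *\<^sub>v (clock p z *\<^sub>v w)) = k \<cdot>\<^sub>v u p"
    using APv[OF wc] Au[of p] z(1) by (simp add: w_def PQ uc)
  then have "P *\<^sub>v (clock p z *\<^sub>v w) = u p" using cancel k0 by blast
  then have cw: "clock p z *\<^sub>v w = w"
    using QP[OF cwc] by (simp add: w_def)
  have wi: "w $ i = 0" if "i < p" "i \<noteq> 0" for i
  proof -
    have "z ^ i * w $ i = w $ i"
      using arg_cong[OF cw, of "\<lambda>x. x $ i"] that wc by (simp add: clock_mult_vec)
    moreover have "z ^ i \<noteq> 1" using root_of_unity_power_inj[OF p z that(1) p0] that by auto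
    ultimately show ?thesis by simp
  qed
  define m where "m = w $ 0"
  have up: "u p = m \<cdot>\<^sub>v u 0"
  proof -
    have "w = m \<cdot>\<^sub>v unit_vec p 0" using wi wc by (intro eq_vecI) (auto simp: m_def unit_vec_def)
    then have "P *\<^sub>v w = m \<cdot>\<^sub>v u 0" using Pe[OF p0] mult_mat_vec[OF Pc, of "unit_vec p 0" m] by simp
    then show ?thesis by (simp add: w_def PQ uc)
  qed
  \<comment> \<open>In the basis \<open>u 0, \<dots>, u (p - 1)\<close> the matrix \<open>B\<close> is the cyclic one except for a factor
    \<open>m\<close> in the last column. Both have determinant 1, so \<open>m = 1\<close>.\<close>
  define E where "E = mat_diag p (\<lambda>j. if j = p - 1 then m else 1)"
  have Ec: "E \<in> carrier_mat p p" by (simp add: E_def)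
  have BP: "B * P = P * (M_cyc p * E)"
  proof (rule eq_matI)
    fix i j assume "i < dim_row (P * (M_cyc p * E))" "j < dim_col (P * (M_cyc p * E))"
    then have ij: "i < p" "j < p" by (auto simp: P_def E_def)
    have "(B * P) $$ (i, j) = (B *\<^sub>v u j) $ i" using ij B(1) Pc by (simp add: colP)
    also have "\<dots> = t * u (Suc j) $ i"
      unfolding Bu using ij uc[of "Suc j"] by simp
    also have "\<dots> = (if j = p - 1 then m else 1) * (t * u (Suc j mod p) $ i)"
      using ij up uc[of 0] by (cases "j = p - 1") auto
    also have "\<dots> = (\<Sum>l = 0..<p. if l = Suc j mod p then u l $ i * (t * (if j = p - 1 then m else 1)) else 0)"
      using p0 by simp
    also have "\<dots> = (\<Sum>l = 0..<p. u l $ i * ((if l = Suc j mod p then t else 0) * (if j = p - 1 then m else 1)))"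
      by (rule sum.cong) auto
    also have "\<dots> = (P * (M_cyc p * E)) $$ (i, j)"
      using ij unfolding E_def t_def
      by (simp add: mat_diag_mult_right[OF M_cyc_carrier] scalar_prod_def P_def M_cyc_entry)
    finally show "(B * P) $$ (i, j) = (P * (M_cyc p * E)) $$ (i, j)" .
  qed (use B(1) Pc Ec in auto)
  have "det (B * P) = det B * det P" by (rule det_mult) (use B Pc in auto)
  moreover have "det (P * (M_cyc p * E)) = det P * det (M_cyc p * E)"
    by (rule det_mult[of _ p]) (use Pc Ec M_cyc_carrier in auto)
  moreover have "det (M_cyc p * E) = det (M_cyc p) * det E"
    by (rule det_mult[OF M_cyc_carrier Ec])
  ultimately have "det E = 1" using B(2) BP \<open>det P \<noteq> 0\<close> det_M_cyc[OF p] by simp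
  moreover have "det E = m" using p0 by (simp add: E_def det_mat_diag prod.delta)
  ultimately have "m = 1" by simp
  then have "E = 1\<^sub>m p" unfolding E_def by (simp add: mat_diag_one cong: if_cong)
  then have BP: "B * P = P * M_cyc p" using BP M_cyc_carrier[of p] by simp
  obtain s where s: "s ^ p = 1 / det P" using complex_root_exists[OF p0] by blast
  show thesis
  proof (rule that[of "s \<cdot>\<^sub>m P" k])
    show "det (s \<cdot>\<^sub>m P) = 1" using s Pc \<open>det P \<noteq> 0\<close> by (simp add: det_smult)
    have "A * (s \<cdot>\<^sub>m P) = s \<cdot>\<^sub>m (A * P)" by (rule mult_smult_distrib[OF A(1) Pc])
    moreover have "s \<cdot>\<^sub>m P * clock p z = s \<cdot>\<^sub>m (P * clock p z)"
      by (rule mult_smult_assoc_mat[OF Pc clock_carrier])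
    ultimately show "A * (s \<cdot>\<^sub>m P) = k \<cdot>\<^sub>m (s \<cdot>\<^sub>m P * clock p z)"
      using AP by (intro eq_matI) (auto simp: mult_ac)
    show "B * (s \<cdot>\<^sub>m P) = s \<cdot>\<^sub>m P * M_cyc p"
      using mult_smult_distrib[OF B(1) Pc] mult_smult_assoc_mat[OF Pc M_cyc_carrier] BP by simp
  qed (use Pc in simp)
qed

section \<open>The groups SL and PSL\<close>

lemma (in group) center_normal: "center G \<lhd> G"
proof -
  have sub: "subgroup (center G) G"
  proof (rule subgroupI)
    show "center G \<subseteq> carrier G" "center G \<noteq> {}"
      unfolding center_def centralizer_def by auto
  next
    fix a assume a: "a \<in> center G"
    then have ac: "a \<in> carrier G" by (auto simp: center_def centralizer_def)
    have "inv a \<otimes> s = s \<otimes> inv a" if "s \<in> carrier G" for s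
    proof -
      have "a \<otimes> s = s \<otimes> a" using a that by (auto simp: center_def centralizer_def)
      then show ?thesis using ac that by (metis inv_closed inv_solve_left inv_solve_right m_assoc m_closed)
    qed
    then show "inv a \<in> center G" using ac by (auto simp: center_def centralizer_def)
  next
    fix a b assume "a \<in> center G" "b \<in> center G"
    then have ab: "a \<in> carrier G" "b \<in> carrier G"
      "\<And>s. s \<in> carrier G \<Longrightarrow> a \<otimes> s = s \<otimes> a" "\<And>s. s \<in> carrier G \<Longrightarrow> b \<otimes> s = s \<otimes> b"
      by (auto simp: center_def centralizer_def)
    have "a \<otimes> b \<otimes> s = s \<otimes> (a \<otimes> b)" if s: "s \<in> carrier G" for s
    proof -
      have "a \<otimes> b \<otimes> s = a \<otimes> (s \<otimes> b)" using ab(1,2) ab(4)[OF s] s by (simp add: m_assoc)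
      also have "\<dots> = s \<otimes> a \<otimes> b" using ab(1,2) ab(3)[OF s] s by (simp flip: m_assoc)
      finally show ?thesis using ab(1,2) s by (simp add: m_assoc)
    qed
    then show "a \<otimes> b \<in> center G" using ab(1,2) by (auto simp: center_def centralizer_def)
  qed
  moreover have "x \<otimes> h \<otimes> inv x \<in> center G" if "x \<in> carrier G" "h \<in> center G" for x h
  proof -
    have "h \<in> carrier G" "x \<otimes> h = h \<otimes> x" using that by (auto simp: center_def centralizer_def)
    then have "x \<otimes> h \<otimes> inv x = h" using that by (simp add: m_assoc)
    then show ?thesis using that by simp
  qed
  ultimately show ?thesis by (simp add: normal_inv_iff)
qed

lemma SL_carrier_iff: "A \<in> carrier (SL n) \<longleftrightarrow> A \<in> carrier_mat n n \<and> det A = 1"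
  by (simp add: SL_def)

lemma SL_mult [simp]: "A \<otimes>\<^bsub>SL n\<^esub> B = A * B"
  by (simp add: SL_def)

lemma SL_one [simp]: "\<one>\<^bsub>SL n\<^esub> = 1\<^sub>m n"
  by (simp add: SL_def)

lemma SL_carrier_mat: "A \<in> carrier (SL n) \<Longrightarrow> A \<in> carrier_mat n n"
  by (simp add: SL_def)

lemma SL_group: "group (SL n)"
proof (rule groupI)
  fix x y assume "x \<in> carrier (SL n)" "y \<in> carrier (SL n)"
  then show "x \<otimes>\<^bsub>SL n\<^esub> y \<in> carrier (SL n)"
    by (auto simp: SL_carrier_iff det_mult[of _ n])
next
  fix x assume x: "x \<in> carrier (SL n)"
  then obtain y where y: "y \<in> carrier_mat n n" "x * y = 1\<^sub>m n" "y * x = 1\<^sub>m n"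
    using inverse_of_det_nonzero[of x n] by (auto simp: SL_carrier_iff)
  then have "det y * det x = 1" using det_mult[of y n x] x by (simp add: SL_carrier_iff)
  then show "\<exists>y\<in>carrier (SL n). y \<otimes>\<^bsub>SL n\<^esub> x = \<one>\<^bsub>SL n\<^esub>"
    using x y by (auto simp: SL_carrier_iff)
qed (auto simp: SL_carrier_iff)

lemma SL_inverse:
  assumes "A \<in> carrier (SL n)"
  obtains B where "B \<in> carrier (SL n)" "A * B = 1\<^sub>m n" "B * A = 1\<^sub>m n" "inv\<^bsub>SL n\<^esub> A = B"
  using group.inv_closed[OF SL_group assms] group.r_inv[OF SL_group assms]
    group.l_inv[OF SL_group assms] that by simp

lemma SL_nonzero:
  assumes "A \<in> carrier (SL n)" "n > 0" "c \<cdot>\<^sub>m A = d \<cdot>\<^sub>m A"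
  shows "c = d"
proof -
  obtain B where B: "B \<in> carrier (SL n)" "A * B = 1\<^sub>m n" using SL_inverse[OF assms(1)] by blast
  have "c \<cdot>\<^sub>m (A * B) = d \<cdot>\<^sub>m (A * B)"
    using assms(3) B(1) assms(1) by (metis mult_smult_assoc_mat SL_carrier_mat)
  then have "(c \<cdot>\<^sub>m 1\<^sub>m n) $$ (0,0) = (d \<cdot>\<^sub>m 1\<^sub>m n) $$ (0,0)" using B by simp
  then show ?thesis using assms(2) by simp
qed

locale prime_degree =
  fixes p :: nat
  assumes prime: "prime p"
begin

lemma p_pos: "p > 0" using prime prime_gt_0_nat by blast
lemma p_gt_1: "p > 1" using prime prime_gt_1_nat by blast

definition clock_scale :: "complex \<Rightarrow> complex" where
  "clock_scale z = (SOME c. c ^ p * det (clock p z) = 1)"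

lemma clock_scale: "z \<noteq> 0 \<Longrightarrow> clock_scale z ^ p * det (clock p z) = 1"
proof -
  assume z: "z \<noteq> 0"
  obtain c where "c ^ p = 1 / det (clock p z)" using complex_root_exists[OF p_pos] by blast
  then have "\<exists>c. c ^ p * det (clock p z) = 1" using det_clock_nonzero[OF z] by (intro exI[of _ c]) simp
  then show ?thesis unfolding clock_scale_def by (rule someI_ex)
qed

text \<open>The multiple of the clock matrix with determinant 1, up to the choice of a \<open>p\<close>-th root.\<close>

definition SL_clock :: "complex \<Rightarrow> complex mat" where
  "SL_clock z = clock_scale z \<cdot>\<^sub>m clock p z"

lemma root_nonzero: "z ^ p = 1 \<Longrightarrow> z \<noteq> (0::complex)"
  using p_pos by (auto simp: power_0_left)

lemma SL_clock_in_SL: "z ^ p = 1 \<Longrightarrow> SL_clock z \<in> carrier (SL p)"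
  using clock_scale[OF root_nonzero] by (simp add: SL_carrier_iff SL_clock_def det_smult)

lemma clock_scale_nonzero: "z ^ p = 1 \<Longrightarrow> clock_scale z \<noteq> 0"
  using clock_scale[OF root_nonzero, of z] p_pos by (auto simp: power_0_left)

lemma M_cyc_in_SL: "M_cyc p \<in> carrier (SL p)"
  by (simp add: SL_carrier_iff det_M_cyc prime)

text \<open>The next two lemmas make a Weyl pair act irreducibly, by transport from clock and shift
  along the conjugation to canonical form.\<close>

lemma clock_shift_acts_irreducibly:
  assumes z: "z ^ p = 1" "z \<noteq> 1" and c: "c \<noteq> 0"
  shows "acts_irreducibly p {c \<cdot>\<^sub>m clock p z, M_cyc p}"
  unfolding acts_irreducibly_def
proof (intro allI impI)
  fix W assume W: "subspace class_ring W (module_vec TYPE(complex) p)"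
    and inv: "\<forall>X\<in>{c \<cdot>\<^sub>m clock p z, M_cyc p}. \<forall>v\<in>W. X *\<^sub>v v \<in> W"
  have Wv: "W \<subseteq> carrier_vec p" "0\<^sub>v p \<in> W" "\<And>v w. v \<in> W \<Longrightarrow> w \<in> W \<Longrightarrow> v + w \<in> W"
    "\<And>k v. v \<in> W \<Longrightarrow> k \<cdot>\<^sub>v v \<in> W" using W unfolding subspace_vec_iff by auto
  have clock: "clock p z *\<^sub>v v \<in> W" if v: "v \<in> W" for v
  proof -
    have "(c \<cdot>\<^sub>m clock p z) *\<^sub>v v = c \<cdot>\<^sub>v (clock p z *\<^sub>v v)"
      by (rule smult_mat_mult_vec[of _ p p]) (use v Wv in auto)
    then have "c \<cdot>\<^sub>v (clock p z *\<^sub>v v) \<in> W" using inv v by auto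
    then have "(1 / c) \<cdot>\<^sub>v (c \<cdot>\<^sub>v (clock p z *\<^sub>v v)) \<in> W" using Wv by blast
    then show ?thesis using c by (simp add: smult_smult_assoc)
  qed
  show "W = {0\<^sub>v p} \<or> W = carrier_vec p"
  proof (cases "W \<subseteq> {0\<^sub>v p}")
    case True
    then show ?thesis using Wv(2) by blast
  next
    case False
    then obtain w where "w \<in> W" "w \<noteq> 0\<^sub>v p" by blast
    then have "W = carrier_vec p"
      using clock_shift_irreducible[OF prime z Wv(1,3,4) clock] inv by blast
    then show ?thesis ..
  qed
qed

lemma Weyl_pair_acts_irreducibly:
  assumes A: "A \<in> carrier (SL p)" and B: "B \<in> carrier (SL p)"
    and AB: "A * B = z \<cdot>\<^sub>m (B * A)" and z: "z ^ p = 1" "z \<noteq> 1"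
  shows "acts_irreducibly p {A, B}"
proof -
  have Ac: "A \<in> carrier_mat p p" "det A = 1" and Bc: "B \<in> carrier_mat p p" "det B = 1"
    using A B by (auto simp: SL_carrier_iff)
  obtain P c where P: "P \<in> carrier_mat p p" "det P = 1" and AP: "A * P = c \<cdot>\<^sub>m (P * clock p z)"
    and BP: "B * P = P * M_cyc p"
    using Weyl_pair_canonical_form[OF prime z Ac Bc AB] by blast
  obtain Q where Q: "Q \<in> carrier_mat p p" "P * Q = 1\<^sub>m p" "Q * P = 1\<^sub>m p"
    using inverse_of_det_nonzero[OF P(1)] P(2) by auto
  have c: "c \<noteq> 0"
  proof
    assume "c = 0"
    then have "det (A * P) = 0"
      using P(1) p_pos by (simp add: AP det_smult power_0_left)
    then show False using det_mult[OF Ac(1) P(1)] Ac P by simp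
  qed
  have XPQ: "X * P * Q = X" if "X \<in> carrier_mat p p" for X
    using assoc_mult_mat[OF that P(1) Q(1)] Q(2) that by simp
  have "P * (c \<cdot>\<^sub>m clock p z) * Q = A"
    using mult_smult_distrib[OF P(1) clock_carrier, of c z] AP XPQ[OF Ac(1)] by simp
  moreover have "P * M_cyc p * Q = B" using BP XPQ[OF Bc(1)] by simp
  ultimately show ?thesis
    by (intro acts_irreducibly_conj[OF clock_shift_acts_irreducibly[OF z c] _ P(1) Q]) auto
qed

lemma SL_clock_M_cyc: 
  assumes "z ^ p = 1"
  shows "SL_clock z * M_cyc p = z \<cdot>\<^sub>m (M_cyc p * SL_clock z)"
proof -
  have "SL_clock z * M_cyc p = clock_scale z \<cdot>\<^sub>m (clock p z * M_cyc p)"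
    unfolding SL_clock_def by (rule mult_smult_assoc_mat[OF clock_carrier M_cyc_carrier])
  also have "clock p z * M_cyc p = z \<cdot>\<^sub>m (M_cyc p * clock p z)"
    by (rule clock_M_cyc_commute[OF assms p_pos])
  finally have l: "SL_clock z * M_cyc p = clock_scale z \<cdot>\<^sub>m (z \<cdot>\<^sub>m (M_cyc p * clock p z))" .
  have "M_cyc p * SL_clock z = clock_scale z \<cdot>\<^sub>m (M_cyc p * clock p z)"
    unfolding SL_clock_def by (rule mult_smult_distrib[OF M_cyc_carrier clock_carrier])
  then show ?thesis unfolding l
    by (intro eq_matI) (auto simp: mult_ac)
qed

lemma SL_acts_irreducibly: "acts_irreducibly p (carrier (SL p))"
proof -
  obtain z :: complex where z: "z ^ p = 1" "z \<noteq> 1" using primitive_root_exists[OF prime] by blast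
  have "acts_irreducibly p {SL_clock z, M_cyc p}"
    by (rule Weyl_pair_acts_irreducibly[OF SL_clock_in_SL[OF z(1)] M_cyc_in_SL SL_clock_M_cyc[OF z(1)] z])
  then show ?thesis using SL_clock_in_SL[OF z(1)] M_cyc_in_SL unfolding acts_irreducibly_def by blast
qed

text \<open>The center consists of scalars by Schur's lemma, since SL acts irreducibly.\<close>

lemma center_SL: "center (SL p) = {c \<cdot>\<^sub>m 1\<^sub>m p | c :: complex. c ^ p = 1}"
proof (intro equalityI subsetI)
  fix A assume "A \<in> center (SL p)"
  then have A: "A \<in> carrier (SL p)" "\<And>X. X \<in> carrier (SL p) \<Longrightarrow> A * X = X * A"
    by (auto simp: center_def centralizer_def)
  obtain c where c: "A = c \<cdot>\<^sub>m 1\<^sub>m p"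
    by (rule Schur[OF SL_acts_irreducibly _ p_pos _ A(2)]) (use A in \<open>auto simp: SL_carrier_mat\<close>)
  moreover have "c ^ p = 1" using A(1) unfolding c by (simp add: SL_carrier_iff det_smult)
  ultimately show "A \<in> {c \<cdot>\<^sub>m 1\<^sub>m p | c :: complex. c ^ p = 1}" by blast
next
  fix A assume "A \<in> {c \<cdot>\<^sub>m 1\<^sub>m p | c :: complex. c ^ p = 1}"
  then obtain c where c: "A = c \<cdot>\<^sub>m 1\<^sub>m p" "c ^ p = 1" by blast
  have "A \<in> carrier (SL p)" using c by (auto simp: SL_carrier_iff det_smult)
  moreover have "A * X = X * A" if "X \<in> carrier (SL p)" for X
    using mult_smult_assoc_mat[of "1\<^sub>m p" p p X p c] mult_smult_distrib[of X p p "1\<^sub>m p" p c]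
      SL_carrier_mat[OF that] by (simp add: c)
  ultimately show "A \<in> center (SL p)" by (auto simp: center_def centralizer_def)
qed

sublocale PSL: group "PSL p"
  unfolding PSL_def using normal.factorgroup_is_group group.center_normal SL_group by blast

abbreviation PSL_mult (infixl "\<diamondop>" 70) where "x \<diamondop> y \<equiv> x \<otimes>\<^bsub>PSL p\<^esub> y"
abbreviation Pinv ("Pinv _" [81] 80) where "Pinv x \<equiv> inv\<^bsub>PSL p\<^esub> x"
abbreviation conjugate where "conjugate g x \<equiv> g \<diamondop> x \<diamondop> Pinv g"

lemma to_PSL_hom: "to_PSL p \<in> hom (SL p) (PSL p)"
  using normal.r_coset_hom_Mod[OF group.center_normal[OF SL_group]]
  unfolding PSL_def to_PSL_def[abs_def] .

lemma to_PSL_closed [simp]: "A \<in> carrier (SL p) \<Longrightarrow> to_PSL p A \<in> carrier (PSL p)"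
  using to_PSL_hom by (auto simp: hom_def)

lemma to_PSL_mult:
  "A \<in> carrier (SL p) \<Longrightarrow> B \<in> carrier (SL p) \<Longrightarrow> to_PSL p A \<diamondop> to_PSL p B = to_PSL p (A * B)"
  using to_PSL_hom by (auto simp: hom_def)

lemma to_PSL_one: "to_PSL p (1\<^sub>m p) = \<one>\<^bsub>PSL p\<^esub>"
  using hom_one[OF to_PSL_hom SL_group PSL.is_group] by simp

lemma to_PSL_inv:
  "A \<in> carrier (SL p) \<Longrightarrow> Pinv (to_PSL p A) = to_PSL p (inv\<^bsub>SL p\<^esub> A)"
  using group_hom.hom_inv[of "SL p" "PSL p" "to_PSL p" A] to_PSL_hom SL_group PSL.is_group
  by (simp add: group_hom_def group_hom_axioms_def)

lemma PSL_cases: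
  assumes "S \<in> carrier (PSL p)"
  obtains A where "A \<in> carrier (SL p)" "S = to_PSL p A"
  using assms unfolding PSL_def carrier_FactGroup to_PSL_def[abs_def] by blast

lemma to_PSL_eq_iff:
  assumes "A \<in> carrier (SL p)" "B \<in> carrier (SL p)"
  shows "to_PSL p A = to_PSL p B \<longleftrightarrow> (\<exists>c. A = c \<cdot>\<^sub>m B)"
proof -
  interpret SL: group "SL p" by (rule SL_group)
  have sub: "subgroup (center (SL p)) (SL p)"
    using SL.center_normal by (rule normal_imp_subgroup)
  have coset: "A \<in> to_PSL p B \<longleftrightarrow> (\<exists>c. c ^ p = 1 \<and> A = c \<cdot>\<^sub>m B)"
  proof -
    have "to_PSL p B = {(c \<cdot>\<^sub>m 1\<^sub>m p) * B | c. c ^ p = 1}"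
      unfolding to_PSL_def center_SL r_coset_def by auto
    moreover have "(c \<cdot>\<^sub>m 1\<^sub>m p) * B = c \<cdot>\<^sub>m B" for c
      using mult_smult_assoc_mat[of "1\<^sub>m p" p p B p c] SL_carrier_mat[OF assms(2)] by simp
    ultimately show ?thesis by auto
  qed
  have "to_PSL p A = to_PSL p B \<longleftrightarrow> A \<in> to_PSL p B"
    using SL.repr_independence[OF _ assms(2) sub, of A] SL.rcos_self[OF assms(1) sub]
    unfolding to_PSL_def by auto
  also have "\<dots> \<longleftrightarrow> (\<exists>c. A = c \<cdot>\<^sub>m B)"
    unfolding coset using assms by (auto simp: SL_carrier_iff det_smult)
  finally show ?thesis .
qed

end

section \<open>Commutation up to a scalar\<close>

lemma smult_cancel:
  fixes X Y :: "complex mat"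
  assumes "c \<cdot>\<^sub>m X = c \<cdot>\<^sub>m Y" "c \<noteq> 0"
  shows "X = Y"
proof (rule eq_matI)
  show d: "dim_row X = dim_row Y" "dim_col X = dim_col Y"
    using arg_cong[OF assms(1), of dim_row] arg_cong[OF assms(1), of dim_col] by auto
  fix i j assume "i < dim_row Y" "j < dim_col Y"
  then show "X $$ (i, j) = Y $$ (i, j)"
    using arg_cong[OF assms(1), of "\<lambda>M. M $$ (i, j)"] d assms(2) by simp
qed

lemma smult_smult_mat: "c \<cdot>\<^sub>m (d \<cdot>\<^sub>m X) = (c * d) \<cdot>\<^sub>m X" for X :: "complex mat"
  by (intro eq_matI) auto

lemma one_smult_mat: "1 \<cdot>\<^sub>m X = X" for X :: "complex mat"
  by (intro eq_matI) auto

context prime_degree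
begin

text \<open>Lifts of two commuting elements of PSL commute up to a scalar \<open>s\<close>. Lifts differ by central
  scalars, which cancel, so \<open>s\<close> depends only on the two classes (\<open>comm_scalar_iff\<close>). A relation is
  used instead of a function because \<open>s\<close> exists only for commuting classes.\<close>

definition comm_scalar :: "complex mat set \<Rightarrow> complex mat set \<Rightarrow> complex \<Rightarrow> bool" where
  "comm_scalar S T s \<longleftrightarrow>
     (\<exists>A\<in>carrier (SL p). \<exists>B\<in>carrier (SL p). S = to_PSL p A \<and> T = to_PSL p B \<and> A * B = s \<cdot>\<^sub>m (B * A))"

lemma SL_mult_closed: "A \<in> carrier (SL p) \<Longrightarrow> B \<in> carrier (SL p) \<Longrightarrow> A * B \<in> carrier (SL p)"
  using monoid.m_closed[OF group.is_monoid[OF SL_group], of A p B] by simp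

lemma SL_smult_mult:
  assumes "A \<in> carrier (SL p)" "B \<in> carrier (SL p)"
  shows "(c \<cdot>\<^sub>m A) * B = c \<cdot>\<^sub>m (A * B)" "A * (c \<cdot>\<^sub>m B) = c \<cdot>\<^sub>m (A * B)"
  using mult_smult_assoc_mat[of A p p B p c] mult_smult_distrib[of A p p B p c] assms
  by (auto simp: SL_carrier_mat)

lemma SL_assoc:
  "A \<in> carrier (SL p) \<Longrightarrow> B \<in> carrier (SL p) \<Longrightarrow> C \<in> carrier (SL p) \<Longrightarrow> A * B * C = A * (B * C)"
  by (rule assoc_mult_mat[of _ p p _ p _ p]) (auto simp: SL_carrier_mat)

lemma SL_mult_one: "A \<in> carrier (SL p) \<Longrightarrow> A * 1\<^sub>m p = A"
  by (rule right_mult_one_mat[OF SL_carrier_mat])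

lemma SL_scalar_root:
  assumes "A \<in> carrier (SL p)" "B \<in> carrier (SL p)" "A = c \<cdot>\<^sub>m B"
  shows "c ^ p = 1"
  using assms by (auto simp: SL_carrier_iff det_smult)

lemma comm_scalar_iff:
  assumes "A \<in> carrier (SL p)" "B \<in> carrier (SL p)"
  shows "comm_scalar (to_PSL p A) (to_PSL p B) s \<longleftrightarrow> A * B = s \<cdot>\<^sub>m (B * A)"
proof
  assume "comm_scalar (to_PSL p A) (to_PSL p B) s"
  then obtain A' B' where AB: "A' \<in> carrier (SL p)" "B' \<in> carrier (SL p)"
    "to_PSL p A' = to_PSL p A" "to_PSL p B' = to_PSL p B" "A' * B' = s \<cdot>\<^sub>m (B' * A')"
    unfolding comm_scalar_def by metis
  obtain c where c: "A' = c \<cdot>\<^sub>m A" using AB to_PSL_eq_iff assms by blast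
  obtain d where d: "B' = d \<cdot>\<^sub>m B" using AB to_PSL_eq_iff assms by blast
  have cd: "c * d \<noteq> 0" using SL_scalar_root[OF AB(1) assms(1) c] SL_scalar_root[OF AB(2) assms(2) d]
      root_nonzero by simp
  have "A' * B' = (c * d) \<cdot>\<^sub>m (A * B)"
    using SL_smult_mult(1)[OF assms(1) AB(2), of c] SL_smult_mult(2)[OF assms, of d]
    by (simp add: c d smult_smult_mat)
  moreover have "B' * A' = (c * d) \<cdot>\<^sub>m (B * A)"
    using SL_smult_mult(1)[OF assms(2) AB(1), of d] SL_smult_mult(2)[OF assms(2,1), of c]
    by (simp add: c d smult_smult_mat mult.commute)
  ultimately have "(c * d) \<cdot>\<^sub>m (A * B) = (c * d) \<cdot>\<^sub>m (s \<cdot>\<^sub>m (B * A))"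
    using AB(5) by (simp add: smult_smult_mat mult_ac)
  then show "A * B = s \<cdot>\<^sub>m (B * A)" using cd by (rule smult_cancel)
next
  assume "A * B = s \<cdot>\<^sub>m (B * A)"
  then show "comm_scalar (to_PSL p A) (to_PSL p B) s" using assms unfolding comm_scalar_def by blast
qed

lemma comm_scalar_carrier:
  assumes "comm_scalar S T s"
  shows "S \<in> carrier (PSL p)" "T \<in> carrier (PSL p)"
  using assms unfolding comm_scalar_def by auto

lemma comm_scalar_root: "comm_scalar S T s \<Longrightarrow> s ^ p = 1"
  unfolding comm_scalar_def using SL_scalar_root SL_mult_closed by blast

lemma comm_scalar_nonzero: "comm_scalar S T s \<Longrightarrow> s \<noteq> 0"
  using comm_scalar_root root_nonzero by blast

lemma comm_scalar_unique:
  assumes "comm_scalar S T s" "comm_scalar S T t"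
  shows "s = t"
proof -
  obtain A B where AB: "A \<in> carrier (SL p)" "B \<in> carrier (SL p)"
    "S = to_PSL p A" "T = to_PSL p B" "A * B = s \<cdot>\<^sub>m (B * A)"
    using assms(1) unfolding comm_scalar_def by blast
  then have "A * B = t \<cdot>\<^sub>m (B * A)" using assms(2) comm_scalar_iff by blast
  with AB show ?thesis using SL_nonzero[OF SL_mult_closed p_pos, of B A s t] by simp
qed

lemma comm_scalar_mult_right:
  assumes "comm_scalar S T s" "comm_scalar S U t"
  shows "comm_scalar S (T \<diamondop> U) (s * t)"
proof -
  obtain A B where A: "A \<in> carrier (SL p)" "S = to_PSL p A" and B: "B \<in> carrier (SL p)" "T = to_PSL p B"
    and AB: "A * B = s \<cdot>\<^sub>m (B * A)"
    using assms(1) unfolding comm_scalar_def by blast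
  obtain C where C: "C \<in> carrier (SL p)" "U = to_PSL p C"
    using assms(2) unfolding comm_scalar_def by blast
  have AC: "A * C = t \<cdot>\<^sub>m (C * A)" using assms(2) comm_scalar_iff A C by blast
  have "A * (B * C) = (s \<cdot>\<^sub>m (B * A)) * C" using A B C AB by (simp flip: SL_assoc)
  also have "\<dots> = s \<cdot>\<^sub>m (B * (A * C))"
    using A B C by (simp add: SL_smult_mult SL_mult_closed SL_assoc)
  also have "B * (A * C) = t \<cdot>\<^sub>m (B * C * A)"
    unfolding AC using A B C by (simp add: SL_smult_mult SL_mult_closed SL_assoc)
  finally have "A * (B * C) = (s * t) \<cdot>\<^sub>m (B * C * A)" by (simp add: smult_smult_mat)
  then show ?thesis
    using A B C by (simp add: to_PSL_mult comm_scalar_iff SL_mult_closed)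
qed

lemma comm_scalar_sym:
  assumes "comm_scalar S T s"
  shows "comm_scalar T S (inverse s)"
proof -
  obtain A B where AB: "A \<in> carrier (SL p)" "B \<in> carrier (SL p)"
    "S = to_PSL p A" "T = to_PSL p B" "A * B = s \<cdot>\<^sub>m (B * A)"
    using assms unfolding comm_scalar_def by blast
  have "B * A = inverse s \<cdot>\<^sub>m (A * B)"
    using comm_scalar_nonzero[OF assms] by (simp add: AB smult_smult_mat one_smult_mat)
  then show ?thesis using AB unfolding comm_scalar_def by blast
qed

lemma comm_scalar_mult_left:
  assumes "comm_scalar S U s" "comm_scalar T U t"
  shows "comm_scalar (S \<diamondop> T) U (s * t)"
  using comm_scalar_sym[OF comm_scalar_mult_right[OF comm_scalar_sym[OF assms(1)] comm_scalar_sym[OF assms(2)]]]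
  by simp

lemma comm_scalar_one_right: "S \<in> carrier (PSL p) \<Longrightarrow> comm_scalar S \<one>\<^bsub>PSL p\<^esub> 1"
  by (erule PSL_cases) (auto simp: to_PSL_one[symmetric] comm_scalar_iff SL_carrier_iff)

lemma comm_scalar_self: "S \<in> carrier (PSL p) \<Longrightarrow> comm_scalar S S 1"
  by (erule PSL_cases) (auto simp: comm_scalar_iff SL_carrier_iff)

lemma comm_scalar_iff_commute:
  assumes "S \<in> carrier (PSL p)" "T \<in> carrier (PSL p)"
  shows "S \<diamondop> T = T \<diamondop> S \<longleftrightarrow> (\<exists>s. comm_scalar S T s)"
proof -
  obtain A where A: "A \<in> carrier (SL p)" "S = to_PSL p A" using assms(1) by (rule PSL_cases)
  obtain B where B: "B \<in> carrier (SL p)" "T = to_PSL p B" using assms(2) by (rule PSL_cases)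
  show ?thesis using A B by (simp add: to_PSL_mult to_PSL_eq_iff SL_mult_closed comm_scalar_iff)
qed

lemma comm_scalar_inv_right:
  assumes "comm_scalar S T s"
  shows "comm_scalar S (Pinv T) (inverse s)"
proof -
  have ST: "S \<in> carrier (PSL p)" "T \<in> carrier (PSL p)" using comm_scalar_carrier assms by auto
  have "S \<diamondop> T = T \<diamondop> S" using assms comm_scalar_iff_commute ST by blast
  then have "S \<diamondop> Pinv T = Pinv T \<diamondop> S"
    using ST by (metis PSL.inv_closed PSL.inv_solve_left PSL.inv_solve_right PSL.m_assoc PSL.m_closed)
  then obtain t where t: "comm_scalar S (Pinv T) t"
    using comm_scalar_iff_commute ST by blast
  have "comm_scalar S \<one>\<^bsub>PSL p\<^esub> (s * t)"
    using comm_scalar_mult_right[OF assms t] ST by simp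
  then have "s * t = 1" using comm_scalar_unique comm_scalar_one_right ST by blast
  then have "t = inverse s" by (metis inverse_unique)
  with t show ?thesis by simp
qed

lemma comm_scalar_inv_left:
  assumes "comm_scalar S T s"
  shows "comm_scalar (Pinv S) T (inverse s)"
  using comm_scalar_sym[OF comm_scalar_inv_right[OF comm_scalar_sym[OF assms]]] by simp

lemma comm_scalar_pow_right:
  assumes "comm_scalar S T s"
  shows "comm_scalar S (T [^]\<^bsub>PSL p\<^esub> (k::nat)) (s ^ k)"
proof (induction k)
  case 0
  show ?case using comm_scalar_one_right comm_scalar_carrier[OF assms] by simp
next
  case (Suc k)
  show ?case using comm_scalar_mult_right[OF Suc assms] by (simp add: mult.commute)
qed

lemma comm_scalar_pow_left:
  assumes "comm_scalar S T s"
  shows "comm_scalar (S [^]\<^bsub>PSL p\<^esub> (k::nat)) T (s ^ k)"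
  using comm_scalar_sym[OF comm_scalar_pow_right[OF comm_scalar_sym[OF assms], of k]]
  by (simp add: power_inverse)

lemma comm_scalar_conj:
  assumes ST: "comm_scalar S T s" and g: "g \<in> carrier (PSL p)"
  shows "comm_scalar (conjugate g S) (conjugate g T) s"
proof -
  obtain A B where A: "A \<in> carrier (SL p)" "S = to_PSL p A" and B: "B \<in> carrier (SL p)" "T = to_PSL p B"
    and AB: "A * B = s \<cdot>\<^sub>m (B * A)"
    using assms(1) unfolding comm_scalar_def by blast
  obtain P where P: "P \<in> carrier (SL p)" "g = to_PSL p P" using g by (rule PSL_cases)
  obtain Q where Q: "Q \<in> carrier (SL p)" "Q * P = 1\<^sub>m p" "inv\<^bsub>SL p\<^esub> P = Q"
    using SL_inverse[OF P(1)] by blast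
  have conj: "(P * X * Q) * (P * Y * Q) = P * (X * Y) * Q" if "X \<in> carrier (SL p)" "Y \<in> carrier (SL p)" for X Y
  proof -
    have "(P * X * Q) * (P * Y * Q) = P * X * (Q * P) * (Y * Q)"
      using P(1) Q(1) that by (simp add: SL_assoc SL_mult_closed)
    also have "\<dots> = P * X * (Y * Q)"
      using P(1) that by (simp add: Q(2) SL_mult_one SL_mult_closed)
    finally show ?thesis using P(1) Q(1) that by (simp add: SL_assoc SL_mult_closed)
  qed
  have "(P * A * Q) * (P * B * Q) = P * (s \<cdot>\<^sub>m (B * A)) * Q" using conj A B AB by simp
  also have "\<dots> = s \<cdot>\<^sub>m (P * (B * A) * Q)"
    using P(1) Q(1) A B by (simp add: SL_smult_mult SL_mult_closed)
  also have "\<dots> = s \<cdot>\<^sub>m ((P * B * Q) * (P * A * Q))" using conj A B by simp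
  finally show ?thesis
    using A B P Q by (simp add: to_PSL_mult to_PSL_inv comm_scalar_iff SL_mult_closed)
qed

subsection \<open>Weyl pairs in PSL\<close>

definition clock_bar :: "complex \<Rightarrow> complex mat set" where
  "clock_bar z = to_PSL p (SL_clock z)"

definition shift_bar :: "complex mat set" where
  "shift_bar = to_PSL p (M_cyc p)"

lemma clock_bar_closed [simp]: "z ^ p = 1 \<Longrightarrow> clock_bar z \<in> carrier (PSL p)"
  by (simp add: clock_bar_def SL_clock_in_SL)

lemma shift_bar_closed [simp]: "shift_bar \<in> carrier (PSL p)"
  by (simp add: shift_bar_def M_cyc_in_SL)

lemma comm_scalar_clock_shift:
  assumes "z ^ p = 1"
  shows "comm_scalar (clock_bar z) shift_bar z"
  unfolding clock_bar_def shift_bar_def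
  using SL_clock_M_cyc SL_clock_in_SL M_cyc_in_SL assms by (simp add: comm_scalar_iff)

text \<open>A Weyl pair acts irreducibly, so Schur's lemma applies to it. This is the source of all
  uniqueness statements below: an element of PSL is determined by its commutation scalars with
  a Weyl pair.\<close>

lemma Weyl_pair_commutant:
  assumes "comm_scalar S T z" "z \<noteq> 1" "comm_scalar X S 1" "comm_scalar X T 1"
  shows "X = \<one>\<^bsub>PSL p\<^esub>"
proof -
  obtain A B where A: "A \<in> carrier (SL p)" "S = to_PSL p A" and B: "B \<in> carrier (SL p)" "T = to_PSL p B"
    and AB: "A * B = z \<cdot>\<^sub>m (B * A)"
    using assms(1) unfolding comm_scalar_def by blast
  obtain C where C: "C \<in> carrier (SL p)" "X = to_PSL p C"
    using comm_scalar_carrier[OF assms(3)] PSL_cases by metis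
  have irr: "acts_irreducibly p {A, B}"
    using Weyl_pair_acts_irreducibly[OF A(1) B(1) AB comm_scalar_root[OF assms(1)] assms(2)] .
  have CA: "C * Y = Y * C" if "Y \<in> {A, B}" for Y
    using that assms(3,4) A B C by (auto simp: comm_scalar_iff)
  obtain k where k: "C = k \<cdot>\<^sub>m 1\<^sub>m p"
    by (rule Schur[OF irr _ p_pos _ CA]) (use A B C in \<open>auto simp: SL_carrier_mat\<close>)
  have "to_PSL p C = to_PSL p (1\<^sub>m p)"
    using k C by (subst to_PSL_eq_iff) (auto simp: SL_carrier_iff)
  then show ?thesis by (simp add: C to_PSL_one)
qed

lemma Weyl_pair_conj_clock_shift:
  assumes "comm_scalar S T z" "z \<noteq> 1"
  obtains g where "g \<in> carrier (PSL p)"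
    "S = conjugate g (clock_bar z)" "T = conjugate g shift_bar"
proof -
  obtain A B where A: "A \<in> carrier (SL p)" "S = to_PSL p A" and B: "B \<in> carrier (SL p)" "T = to_PSL p B"
    and AB: "A * B = z \<cdot>\<^sub>m (B * A)"
    using assms(1) unfolding comm_scalar_def by blast
  have z: "z ^ p = 1" using comm_scalar_root[OF assms(1)] .
  obtain P c where P: "P \<in> carrier_mat p p" "det P = 1" and AP: "A * P = c \<cdot>\<^sub>m (P * clock p z)"
    and BP: "B * P = P * M_cyc p"
    using Weyl_pair_canonical_form[OF prime z assms(2) _ _ _ _ AB] A(1) B(1)
    unfolding SL_carrier_iff by blast
  have PS: "P \<in> carrier (SL p)" using P by (simp add: SL_carrier_iff)
  have "P * SL_clock z = clock_scale z \<cdot>\<^sub>m (P * clock p z)"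
    unfolding SL_clock_def by (rule mult_smult_distrib[OF P(1) clock_carrier])
  then have "A * P = (c / clock_scale z) \<cdot>\<^sub>m (P * SL_clock z)"
    using clock_scale_nonzero[OF z] by (simp add: AP smult_smult_mat one_smult_mat)
  then have "to_PSL p (A * P) = to_PSL p (P * SL_clock z)"
    using to_PSL_eq_iff[OF SL_mult_closed[OF A(1) PS] SL_mult_closed[OF PS SL_clock_in_SL[OF z]]]
    by blast
  then have "S \<diamondop> to_PSL p P = to_PSL p P \<diamondop> clock_bar z"
    using A PS SL_clock_in_SL[OF z] by (simp add: clock_bar_def to_PSL_mult)
  moreover have "T \<diamondop> to_PSL p P = to_PSL p P \<diamondop> shift_bar"
    using B PS M_cyc_in_SL BP by (simp add: shift_bar_def to_PSL_mult)
  ultimately show thesis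
    using that[of "to_PSL p P"] PS PSL.inv_solve_right z comm_scalar_carrier[OF assms(1)] by simp
qed

lemma commutes_with_clock_bar_iff:
  assumes z: "z ^ p = 1" "z \<noteq> 1"
  shows "comm_scalar (clock_bar z) X 1 \<longleftrightarrow>
    (\<exists>f. mat_diag p f \<in> carrier (SL p) \<and> X = to_PSL p (mat_diag p f))"
proof -
  have iff: "comm_scalar (clock_bar z) (to_PSL p A) 1 \<longleftrightarrow> clock p z * A = A * clock p z"
    if A: "A \<in> carrier (SL p)" for A
  proof -
    have Ac: "A \<in> carrier_mat p p" using A by (rule SL_carrier_mat)
    have "SL_clock z * A = clock_scale z \<cdot>\<^sub>m (clock p z * A)"
      unfolding SL_clock_def by (rule mult_smult_assoc_mat[OF clock_carrier Ac])
    moreover have "A * SL_clock z = clock_scale z \<cdot>\<^sub>m (A * clock p z)"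
      unfolding SL_clock_def by (rule mult_smult_distrib[OF Ac clock_carrier])
    ultimately show ?thesis
      using A SL_clock_in_SL[OF z(1)] smult_cancel[OF _ clock_scale_nonzero[OF z(1)]]
      by (auto simp: clock_bar_def comm_scalar_iff one_smult_mat)
  qed
  show ?thesis
  proof
    assume comm: "comm_scalar (clock_bar z) X 1"
    then obtain A where A: "A \<in> carrier (SL p)" "X = to_PSL p A"
      using comm_scalar_carrier PSL_cases by metis
    then obtain f where "A = mat_diag p f"
      using commutes_with_clock_diagonal[OF prime z SL_carrier_mat[OF A(1)]] iff comm by blast
    then show "\<exists>f. mat_diag p f \<in> carrier (SL p) \<and> X = to_PSL p (mat_diag p f)" using A by blast
  next
    assume "\<exists>f. mat_diag p f \<in> carrier (SL p) \<and> X = to_PSL p (mat_diag p f)"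
    then show "comm_scalar (clock_bar z) X 1" using iff by (auto simp: clock_def mult.commute)
  qed
qed

text \<open>A matrix that occurs in a Weyl pair has distinct eigenvalues, so the matrices commuting with
  it are simultaneously diagonalizable.\<close>

lemma Weyl_element_centralizer_commutative:
  assumes "comm_scalar S T z" "z \<noteq> 1" "comm_scalar S U 1" "comm_scalar S V 1"
  shows "comm_scalar U V 1"
proof -
  have z: "z ^ p = 1" using comm_scalar_root[OF assms(1)] .
  obtain g where g: "g \<in> carrier (PSL p)" "S = conjugate g (clock_bar z)"
    using Weyl_pair_conj_clock_shift[OF assms(1,2)] by blast
  have cancel: "Pinv g \<diamondop> (conjugate g X) \<diamondop> Pinv (Pinv g) = X" "g \<diamondop> (Pinv g \<diamondop> X \<diamondop> Pinv (Pinv g)) \<diamondop> Pinv g = X"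
    if "X \<in> carrier (PSL p)" for X
  proof -
    have "Pinv g \<diamondop> (g \<diamondop> Y) = Y" "g \<diamondop> (Pinv g \<diamondop> Y) = Y" if "Y \<in> carrier (PSL p)" for Y
      using that g(1) by (simp_all flip: PSL.m_assoc)
    then show "Pinv g \<diamondop> (conjugate g X) \<diamondop> Pinv (Pinv g) = X" "g \<diamondop> (Pinv g \<diamondop> X \<diamondop> Pinv (Pinv g)) \<diamondop> Pinv g = X"
      using that g(1) by (simp_all add: PSL.m_assoc)
  qed
  define U' where "U' = Pinv g \<diamondop> U \<diamondop> Pinv (Pinv g)"
  define V' where "V' = Pinv g \<diamondop> V \<diamondop> Pinv (Pinv g)"
  have comm: "comm_scalar (clock_bar z) U' 1" "comm_scalar (clock_bar z) V' 1"
    using comm_scalar_conj[OF assms(3), of "Pinv g"] comm_scalar_conj[OF assms(4), of "Pinv g"] g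
      cancel(1)[OF clock_bar_closed[OF z]] unfolding U'_def V'_def by simp_all
  note diag = commutes_with_clock_bar_iff[OF z assms(2), THEN iffD1]
  obtain a where a: "mat_diag p a \<in> carrier (SL p)" "U' = to_PSL p (mat_diag p a)"
    using diag[OF comm(1)] by (elim exE conjE)
  obtain b where b: "mat_diag p b \<in> carrier (SL p)" "V' = to_PSL p (mat_diag p b)"
    using diag[OF comm(2)] by (elim exE conjE)
  have "comm_scalar U' V' 1"
    using a(1) b(1) by (simp add: a(2) b(2) comm_scalar_iff one_smult_mat mult.commute)
  from comm_scalar_conj[OF this g(1)] show ?thesis
    unfolding U'_def V'_def using cancel(2) comm_scalar_carrier(2) assms(3,4) by simp
qed

lemma Weyl_pairs_conjugate:
  assumes "comm_scalar S T z" "comm_scalar S' T' z" "z \<noteq> 1"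
  obtains g where "g \<in> carrier (PSL p)"
    "S' = conjugate g S" "T' = conjugate g T"
proof -
  obtain g where g: "g \<in> carrier (PSL p)"
    "S = conjugate g (clock_bar z)" "T = conjugate g shift_bar"
    using Weyl_pair_conj_clock_shift[OF assms(1,3)] by blast
  obtain h where h: "h \<in> carrier (PSL p)"
    "S' = conjugate h (clock_bar z)" "T' = conjugate h shift_bar"
    using Weyl_pair_conj_clock_shift[OF assms(2,3)] by blast
  have eq: "conjugate h X =
     (h \<diamondop> Pinv g) \<diamondop> (conjugate g X) \<diamondop> Pinv (h \<diamondop> Pinv g)"
    if "X \<in> carrier (PSL p)" for X
  proof -
    have "Pinv g \<diamondop> (g \<diamondop> Y) = Y" if "Y \<in> carrier (PSL p)" for Y
      using that g(1) by (simp flip: PSL.m_assoc)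
    then show ?thesis using g(1) h(1) that by (simp add: PSL.inv_mult_group PSL.m_assoc)
  qed
  show thesis
    by (rule that[of "h \<diamondop> Pinv g"])
      (use g h eq[OF clock_bar_closed[OF comm_scalar_root[OF assms(1)]]] eq[OF shift_bar_closed] in simp_all)
qed

end

section \<open>Irreducible subgroups of PSL\<close>

context prime_degree
begin

definition lifts :: "complex mat set set \<Rightarrow> complex mat set" where
  "lifts H = {A \<in> carrier (SL p). to_PSL p A \<in> H}"

text \<open>Stabilizers of proper nonzero subspaces are proper parabolic subgroups because SL itself acts
  irreducibly; conversely a proper parabolic subgroup stabilizes some proper nonzero subspace.\<close>

lemma irreducible_subgroup_iff:
  assumes H: "subgroup H (PSL p)"
  shows "irreducible_subgroup p H \<longleftrightarrow> acts_irreducibly p (lifts H)"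
proof
  assume irr: "irreducible_subgroup p H"
  show "acts_irreducibly p (lifts H)"
    unfolding acts_irreducibly_def
  proof (intro allI impI)
    fix W assume W: "subspace class_ring W (module_vec TYPE(complex) p)"
      and inv: "\<forall>X\<in>lifts H. \<forall>v\<in>W. X *\<^sub>v v \<in> W"
    have Wv: "W \<subseteq> carrier_vec p" "\<And>k v. v \<in> W \<Longrightarrow> k \<cdot>\<^sub>v v \<in> W"
      using W unfolding subspace_vec_iff by auto
    define stab where "stab = {A \<in> carrier (SL p). \<forall>U\<in>{W}. (\<lambda>v. A *\<^sub>v v) ` U = U}"
    have par: "parabolic p (to_PSL p ` stab)"
      unfolding parabolic_def stab_def flag_def
      by (rule exI[of _ "{W}"]) (use W in \<open>auto simp: chain_subset_def\<close>)
    have "H \<subseteq> to_PSL p ` stab"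
    proof
      fix h assume h: "h \<in> H"
      then obtain A where A: "A \<in> carrier (SL p)" "h = to_PSL p A"
        using subgroup.subset[OF H] PSL_cases by blast
      obtain B where B: "B \<in> carrier (SL p)" "A * B = 1\<^sub>m p" "inv\<^bsub>SL p\<^esub> A = B"
        using SL_inverse[OF A(1)] by blast
      have AL: "A \<in> lifts H" using A h by (simp add: lifts_def)
      have "Pinv h \<in> H" using h H by (rule subgroup.m_inv_closed[rotated])
      then have BL: "B \<in> lifts H" using A B by (simp add: lifts_def to_PSL_inv)
      have "v \<in> (\<lambda>v. A *\<^sub>v v) ` W" if v: "v \<in> W" for v
      proof -
        have "v \<in> carrier_vec p" using v Wv by auto
        then have "A *\<^sub>v (B *\<^sub>v v) = (A * B) *\<^sub>v v"
          using assoc_mult_mat_vec[OF SL_carrier_mat[OF A(1)] SL_carrier_mat[OF B(1)]] by simp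
        then have "A *\<^sub>v (B *\<^sub>v v) = v" using B \<open>v \<in> carrier_vec p\<close> by simp
        moreover have "B *\<^sub>v v \<in> W" using inv BL v by blast
        ultimately show ?thesis by (metis image_eqI)
      qed
      then have "(\<lambda>v. A *\<^sub>v v) ` W = W" using inv AL by auto
      then show "h \<in> to_PSL p ` stab" using A by (auto simp: stab_def)
    qed
    then have full: "to_PSL p ` stab = carrier (PSL p)"
      using irr par unfolding irreducible_subgroup_def by blast
    have "A *\<^sub>v v \<in> W" if A: "A \<in> carrier (SL p)" and v: "v \<in> W" for A v
    proof -
      obtain B where B: "B \<in> stab" "to_PSL p A = to_PSL p B" using full to_PSL_closed[OF A] by blast
      then have BS: "B \<in> carrier (SL p)" "B *\<^sub>v v \<in> W" using v by (auto simp: stab_def)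
      then obtain c where "A = c \<cdot>\<^sub>m B" using to_PSL_eq_iff[OF A] B by blast
      then have "A *\<^sub>v v = c \<cdot>\<^sub>v (B *\<^sub>v v)"
        using smult_mat_mult_vec[OF SL_carrier_mat[OF BS(1)]] v Wv by auto
      then show ?thesis using BS Wv by simp
    qed
    then show "W = {0\<^sub>v p} \<or> W = carrier_vec p"
      using SL_acts_irreducibly W unfolding acts_irreducibly_def by blast
  qed
next
  assume irr: "acts_irreducibly p (lifts H)"
  have "P = carrier (PSL p)" if P: "parabolic p P" and HP: "H \<subseteq> P" for P
  proof -
    obtain F where F: "flag p F"
      and PF: "P = to_PSL p ` {A \<in> carrier (SL p). \<forall>W\<in>F. (\<lambda>v. A *\<^sub>v v) ` W = W}"
      using P unfolding parabolic_def by blast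
    have triv: "W = {0\<^sub>v p} \<or> W = carrier_vec p" if W: "W \<in> F" for W
    proof -
      have Ws: "subspace class_ring W (module_vec TYPE(complex) p)" using F W by (simp add: flag_def)
      then have Wv: "W \<subseteq> carrier_vec p" "\<And>k v. v \<in> W \<Longrightarrow> k \<cdot>\<^sub>v v \<in> W"
        unfolding subspace_vec_iff by auto
      have "A *\<^sub>v v \<in> W" if A: "A \<in> lifts H" and v: "v \<in> W" for A v
      proof -
        have AS: "A \<in> carrier (SL p)" using A by (simp add: lifts_def)
        have "to_PSL p A \<in> P" using A HP by (auto simp: lifts_def)
        then obtain B where B: "B \<in> carrier (SL p)" "(\<lambda>v. B *\<^sub>v v) ` W = W" "to_PSL p A = to_PSL p B"
          using W unfolding PF by auto
        then obtain c where "A = c \<cdot>\<^sub>m B" using to_PSL_eq_iff[OF AS] by blast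
        then have "A *\<^sub>v v = c \<cdot>\<^sub>v (B *\<^sub>v v)"
          using smult_mat_mult_vec[OF SL_carrier_mat[OF B(1)]] v Wv by auto
        moreover have "B *\<^sub>v v \<in> W" using B(2) v by blast
        ultimately show ?thesis using Wv(2) by simp
      qed
      then show ?thesis using irr Ws unfolding acts_irreducibly_def by blast
    qed
    have "(\<lambda>v. A *\<^sub>v v) ` W = W" if A: "A \<in> carrier (SL p)" and W: "W \<in> F" for A W
    proof -
      have Ac: "A \<in> carrier_mat p p" using A by (rule SL_carrier_mat)
      obtain B where B: "B \<in> carrier (SL p)" "A * B = 1\<^sub>m p" using SL_inverse[OF A] by blast
      have "A *\<^sub>v 0\<^sub>v p = 0\<^sub>v p" using Ac by (intro eq_vecI) auto
      moreover have "(\<lambda>v. A *\<^sub>v v) ` carrier_vec p = carrier_vec p"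
      proof (intro equalityI subsetI)
        fix v assume v: "v \<in> (carrier_vec p :: complex vec set)"
        have "A *\<^sub>v (B *\<^sub>v v) = (A * B) *\<^sub>v v"
          using assoc_mult_mat_vec[OF Ac SL_carrier_mat[OF B(1)] v] by simp
        then have "v = A *\<^sub>v (B *\<^sub>v v)" using B v by simp
        moreover have "B *\<^sub>v v \<in> carrier_vec p" using SL_carrier_mat[OF B(1)] v by simp
        ultimately show "v \<in> (\<lambda>v. A *\<^sub>v v) ` carrier_vec p" by blast
      qed (use Ac in auto)
      ultimately show ?thesis using triv[OF W] by auto
    qed
    then have "{A \<in> carrier (SL p). \<forall>W\<in>F. (\<lambda>v. A *\<^sub>v v) ` W = W} = carrier (SL p)" by blast
    then show ?thesis unfolding PF by (auto elim: PSL_cases)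
  qed
  then show "irreducible_subgroup p H" using H unfolding irreducible_subgroup_def by blast
qed

lemma irreducible_is_subgroup: "irreducible_subgroup p H \<Longrightarrow> subgroup H (PSL p)"
  by (simp add: irreducible_subgroup_def)

lemma irreducible_commutant:
  assumes H: "irreducible_subgroup p H" and X: "X \<in> carrier (PSL p)"
    and comm: "\<And>T. T \<in> H \<Longrightarrow> comm_scalar X T 1"
  shows "X = \<one>\<^bsub>PSL p\<^esub>"
proof -
  obtain C where C: "C \<in> carrier (SL p)" "X = to_PSL p C" using X by (rule PSL_cases)
  have irr: "acts_irreducibly p (lifts H)"
    using irreducible_subgroup_iff[OF irreducible_is_subgroup[OF H]] H by blast
  have CA: "C * Y = Y * C" if "Y \<in> lifts H" for Y
    using comm[of "to_PSL p Y"] that C by (simp add: lifts_def comm_scalar_iff one_smult_mat)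
  obtain k where k: "C = k \<cdot>\<^sub>m 1\<^sub>m p"
    by (rule Schur[OF irr _ p_pos _ CA]) (use C in \<open>auto simp: SL_carrier_mat lifts_def\<close>)
  have "to_PSL p C = to_PSL p (1\<^sub>m p)"
    using k C by (subst to_PSL_eq_iff) (auto simp: SL_carrier_iff)
  then show ?thesis by (simp add: C to_PSL_one)
qed

lemma subgroup_containing_Weyl_pair_irreducible:
  assumes H: "subgroup H (PSL p)" and ST: "S \<in> H" "T \<in> H" "comm_scalar S T z" "z \<noteq> 1"
  shows "irreducible_subgroup p H"
proof -
  obtain A B where A: "A \<in> carrier (SL p)" "S = to_PSL p A" and B: "B \<in> carrier (SL p)" "T = to_PSL p B"
    and AB: "A * B = z \<cdot>\<^sub>m (B * A)"
    using ST(3) unfolding comm_scalar_def by blast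
  have "acts_irreducibly p {A, B}"
    using Weyl_pair_acts_irreducibly[OF A(1) B(1) AB comm_scalar_root[OF ST(3)] ST(4)] .
  moreover have "{A, B} \<subseteq> lifts H" using A B ST by (auto simp: lifts_def)
  ultimately have "acts_irreducibly p (lifts H)" unfolding acts_irreducibly_def by blast
  then show ?thesis using irreducible_subgroup_iff[OF H] by blast
qed

lemma irreducible_nontrivial:
  assumes "irreducible_subgroup p H"
  shows "H \<noteq> {\<one>\<^bsub>PSL p\<^esub>}"
proof
  assume H: "H = {\<one>\<^bsub>PSL p\<^esub>}"
  obtain z :: complex where z: "z ^ p = 1" "z \<noteq> 1" using primitive_root_exists[OF prime] by blast
  have "shift_bar = \<one>\<^bsub>PSL p\<^esub>"
    by (rule irreducible_commutant[OF assms]) (auto simp: H comm_scalar_one_right)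
  then have "comm_scalar (clock_bar z) shift_bar 1" using z by (simp add: comm_scalar_one_right)
  then show False using comm_scalar_clock_shift[OF z(1)] comm_scalar_unique z(2) by blast
qed

lemma irreducible_subgroup_conj:
  assumes H: "irreducible_subgroup p H" and g: "g \<in> carrier (PSL p)" and H': "subgroup H' (PSL p)"
    and conj: "\<And>h. h \<in> H \<Longrightarrow> conjugate g h \<in> H'"
  shows "irreducible_subgroup p H'"
proof -
  obtain P where P: "P \<in> carrier (SL p)" "g = to_PSL p P" using g by (rule PSL_cases)
  obtain Q where Q: "Q \<in> carrier (SL p)" "P * Q = 1\<^sub>m p" "Q * P = 1\<^sub>m p" "inv\<^bsub>SL p\<^esub> P = Q"
    using SL_inverse[OF P(1)] by blast
  have "acts_irreducibly p (lifts H)"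
    using irreducible_subgroup_iff[OF irreducible_is_subgroup[OF H]] H by blast
  then have "acts_irreducibly p (lifts H')"
  proof (rule acts_irreducibly_conj[OF _ _ _ _ Q(2,3)])
    fix A assume "A \<in> lifts H"
    then have A: "A \<in> carrier (SL p)" "to_PSL p A \<in> H" by (auto simp: lifts_def)
    then have "g \<diamondop> to_PSL p A \<diamondop> Pinv g = to_PSL p (P * A * Q)"
      using P Q by (simp add: to_PSL_inv to_PSL_mult SL_mult_closed)
    then show "P * A * Q \<in> lifts H'"
      using conj[OF A(2)] A P Q by (simp add: lifts_def SL_mult_closed)
  qed (use P Q in \<open>auto simp: lifts_def SL_carrier_mat\<close>)
  then show ?thesis using irreducible_subgroup_iff[OF H'] by blast
qed

end

section \<open>The centralizer of the clock element\<close>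

text \<open>The semidirect product of \<open>D_bar\<close> and \<open>C_bar\<close> is the centralizer of \<open>clock_bar z\<close>; the
  commutation scalar with \<open>clock_bar z\<close> is trivial on the first factor and faithful on the second,
  so it carries the same information as \<open>quot_map\<close>.\<close>

locale prime_degree_root = prime_degree +
  fixes z :: complex
  assumes z_root: "z ^ p = 1" and z_neq_1: "z \<noteq> 1"
begin

lemma clock_shift: "comm_scalar (clock_bar z) shift_bar z"
  using comm_scalar_clock_shift[OF z_root] .

lemma D_bar_iff: "X \<in> D_bar p \<longleftrightarrow> comm_scalar (clock_bar z) X 1"
proof -
  have "diagonal_mat A \<longleftrightarrow> (\<exists>f. A = mat_diag p f)" if "A \<in> carrier (SL p)" for A
  proof
    assume "diagonal_mat A"
    then have "A = mat_diag p (\<lambda>i. A $$ (i, i))"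
      using SL_carrier_mat[OF that] by (intro eq_matI) (auto simp: mat_diag_def diagonal_mat_def)
    then show "\<exists>f. A = mat_diag p f" by blast
  qed (auto simp: diagonal_mat_def mat_diag_def)
  then show ?thesis unfolding commutes_with_clock_bar_iff[OF z_root z_neq_1] D_bar_def by auto
qed

lemma shift_bar_pow_p: "shift_bar [^]\<^bsub>PSL p\<^esub> p = \<one>\<^bsub>PSL p\<^esub>"
proof (rule Weyl_pair_commutant[OF clock_shift z_neq_1])
  show "comm_scalar (shift_bar [^]\<^bsub>PSL p\<^esub> p) (clock_bar z) 1"
    using comm_scalar_sym[OF comm_scalar_pow_right[OF clock_shift, of p]] z_root by simp
  show "comm_scalar (shift_bar [^]\<^bsub>PSL p\<^esub> p) shift_bar 1"
    using comm_scalar_pow_left[OF comm_scalar_self[OF shift_bar_closed], of p] by simp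
qed

lemma C_bar_powers: "C_bar p = range (\<lambda>k::nat. shift_bar [^]\<^bsub>PSL p\<^esub> k)"
proof (intro equalityI subsetI)
  fix c assume "c \<in> C_bar p"
  then have "c \<in> generate (PSL p) {shift_bar}" by (simp add: C_bar_def shift_bar_def)
  then have "\<exists>k::nat. c = shift_bar [^]\<^bsub>PSL p\<^esub> k"
  proof induction
    case one
    show ?case by (rule exI[of _ 0]) simp
  next
    case (incl h)
    then show ?case by (intro exI[of _ 1]) simp
  next
    case (inv h)
    have "shift_bar [^]\<^bsub>PSL p\<^esub> (p - 1) \<diamondop> shift_bar = \<one>\<^bsub>PSL p\<^esub>"
      using PSL.nat_pow_Suc[of shift_bar "p - 1"] shift_bar_pow_p p_pos by simp
    then have "Pinv shift_bar = shift_bar [^]\<^bsub>PSL p\<^esub> (p - 1)"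
      by (intro PSL.inv_equality) auto
    then show ?case using inv by auto
  next
    case (eng h1 h2)
    then obtain a b :: nat where "h1 = shift_bar [^]\<^bsub>PSL p\<^esub> a" "h2 = shift_bar [^]\<^bsub>PSL p\<^esub> b" by blast
    then show ?case by (intro exI[of _ "a + b"]) (simp add: PSL.nat_pow_mult)
  qed
  then show "c \<in> range (\<lambda>k::nat. shift_bar [^]\<^bsub>PSL p\<^esub> k)" by blast
next
  fix c assume "c \<in> range (\<lambda>k::nat. shift_bar [^]\<^bsub>PSL p\<^esub> k)"
  then obtain k :: nat where k: "c = shift_bar [^]\<^bsub>PSL p\<^esub> k" by blast
  have "shift_bar [^]\<^bsub>PSL p\<^esub> k \<in> generate (PSL p) {shift_bar}"
    by (induction k) (auto intro: generate.one generate.incl generate.eng)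
  then show "c \<in> C_bar p" by (simp add: k C_bar_def shift_bar_def)
qed

lemma C_bar_closed: "c \<in> C_bar p \<Longrightarrow> c \<in> carrier (PSL p)"
  by (auto simp: C_bar_powers)

lemma C_bar_subgroup: "subgroup (C_bar p) (PSL p)"
  unfolding C_bar_def using PSL.generate_is_subgroup shift_bar_closed by (simp add: shift_bar_def)

lemma C_bar_comm_scalar:
  assumes "c \<in> C_bar p"
  obtains s where "comm_scalar (clock_bar z) c s"
  using assms comm_scalar_pow_right[OF clock_shift] by (auto simp: C_bar_powers)

lemma C_bar_inj:
  assumes "c \<in> C_bar p" "d \<in> C_bar p" "comm_scalar (clock_bar z) c s" "comm_scalar (clock_bar z) d s"
  shows "c = d"
proof -
  have clock: "comm_scalar (clock_bar z) (c \<diamondop> Pinv d) 1"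
    using comm_scalar_mult_right[OF assms(3) comm_scalar_inv_right[OF assms(4)]]
      comm_scalar_nonzero[OF assms(3)] by simp
  have pow: "comm_scalar shift_bar x 1" if "x \<in> C_bar p" for x
    using that comm_scalar_pow_right[OF comm_scalar_self[OF shift_bar_closed]]
    by (auto simp: C_bar_powers)
  have shift: "comm_scalar shift_bar (c \<diamondop> Pinv d) 1"
    using comm_scalar_mult_right[OF pow[OF assms(1)] comm_scalar_inv_right[OF pow[OF assms(2)]]] by simp
  then have "c \<diamondop> Pinv d = \<one>\<^bsub>PSL p\<^esub>"
    using Weyl_pair_commutant[OF clock_shift z_neq_1] comm_scalar_sym[OF clock] comm_scalar_sym[OF shift]
    by simp
  then show ?thesis
    using C_bar_closed assms by (metis PSL.inv_closed PSL.inv_equality PSL.inv_inv)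
qed

lemma C_bar_surj:
  assumes "s ^ p = 1"
  obtains c where "c \<in> C_bar p" "comm_scalar (clock_bar z) c s"
proof -
  obtain k where "s = z ^ k" using root_of_unity_powers[OF prime z_root z_neq_1 assms] by blast
  then show thesis
    using that[of "shift_bar [^]\<^bsub>PSL p\<^esub> k"] comm_scalar_pow_right[OF clock_shift, of k]
    by (auto simp: C_bar_powers)
qed

lemma semidirect_decomposition:
  assumes "comm_scalar (clock_bar z) X s" "c \<in> C_bar p" "comm_scalar (clock_bar z) c s"
  shows "\<exists>d\<in>D_bar p. X = d \<diamondop> c"
proof
  have X: "X \<in> carrier (PSL p)" and c: "c \<in> carrier (PSL p)"
    using comm_scalar_carrier assms by blast+
  show "X \<diamondop> Pinv c \<in> D_bar p"
    using comm_scalar_mult_right[OF assms(1) comm_scalar_inv_right[OF assms(3)]]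
      comm_scalar_nonzero[OF assms(1)] by (simp add: D_bar_iff)
  show "X = X \<diamondop> Pinv c \<diamondop> c" using X c by (simp add: PSL.m_assoc)
qed

lemma in_semidirect_iff:
  "X \<in> D_bar p <#>\<^bsub>PSL p\<^esub> C_bar p \<longleftrightarrow> (\<exists>s. comm_scalar (clock_bar z) X s)"
proof
  assume "X \<in> D_bar p <#>\<^bsub>PSL p\<^esub> C_bar p"
  then obtain d c where dc: "d \<in> D_bar p" "c \<in> C_bar p" "X = d \<diamondop> c"
    by (auto simp: set_mult_def)
  obtain s where "comm_scalar (clock_bar z) c s" using C_bar_comm_scalar[OF dc(2)] .
  then show "\<exists>s. comm_scalar (clock_bar z) X s"
    using comm_scalar_mult_right dc(1) unfolding dc(3) D_bar_iff by blast
next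
  assume "\<exists>s. comm_scalar (clock_bar z) X s"
  then obtain s where s: "comm_scalar (clock_bar z) X s" ..
  obtain c where c: "c \<in> C_bar p" "comm_scalar (clock_bar z) c s"
    using C_bar_surj[OF comm_scalar_root[OF s]] .
  then show "X \<in> D_bar p <#>\<^bsub>PSL p\<^esub> C_bar p"
    using semidirect_decomposition[OF s c] by (auto simp: set_mult_def)
qed

lemma quot_map_eq_iff:
  assumes c: "c \<in> C_bar p" "comm_scalar (clock_bar z) c s" and X: "comm_scalar (clock_bar z) X t"
  shows "quot_map p X = c \<longleftrightarrow> t = s"
proof -
  obtain e where e: "e \<in> C_bar p" "comm_scalar (clock_bar z) e t"
    using C_bar_surj[OF comm_scalar_root[OF X]] .
  have "quot_map p X = e"
    unfolding quot_map_def
  proof (rule the_equality)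
    show "e \<in> C_bar p \<and> (\<exists>d\<in>D_bar p. X = d \<diamondop> e)"
      using semidirect_decomposition[OF X e] e by blast
  next
    fix f assume "f \<in> C_bar p \<and> (\<exists>d\<in>D_bar p. X = d \<diamondop> f)"
    then obtain d where f: "f \<in> C_bar p" and d: "d \<in> D_bar p" "X = d \<diamondop> f" by blast
    obtain u where u: "comm_scalar (clock_bar z) f u" using C_bar_comm_scalar[OF f] .
    have "comm_scalar (clock_bar z) X (1 * u)"
      using comm_scalar_mult_right[OF _ u] d unfolding d(2) D_bar_iff by blast
    then have "u = t" using comm_scalar_unique[OF X] by simp
    then show "f = e" using C_bar_inj[OF f e(1) u] e(2) by simp
  qed
  then show ?thesis using C_bar_inj[OF c(1) e(1) c(2)] e(2) c(2) comm_scalar_unique by auto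
qed

end

section \<open>Characters of order p\<close>

definition roots_of_unity_group :: "nat \<Rightarrow> complex monoid" where
  "roots_of_unity_group n = \<lparr>carrier = {s. s ^ n = 1}, monoid.mult = (*), one = 1\<rparr>"

definition chars :: "('a, 'b) monoid_scheme \<Rightarrow> nat \<Rightarrow> ('a \<Rightarrow> complex) set" where
  "chars G n = hom G (roots_of_unity_group n) \<inter> extensional (carrier G)"

definition trivial_char :: "('a, 'b) monoid_scheme \<Rightarrow> 'a \<Rightarrow> complex" where
  "trivial_char G = (\<lambda>x\<in>carrier G. 1)"

definition char_pow :: "('a, 'b) monoid_scheme \<Rightarrow> ('a \<Rightarrow> complex) \<Rightarrow> nat \<Rightarrow> 'a \<Rightarrow> complex" where
  "char_pow G \<chi> k = (\<lambda>x\<in>carrier G. \<chi> x ^ k)"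

definition char_kernel :: "('a, 'b) monoid_scheme \<Rightarrow> ('a \<Rightarrow> complex) \<Rightarrow> 'a set" where
  "char_kernel G \<chi> = {x \<in> carrier G. \<chi> x = 1}"

lemma roots_of_unity_group: "n > 0 \<Longrightarrow> comm_group (roots_of_unity_group n)"
proof (rule comm_groupI)
  fix x assume n: "n > 0" and x: "x \<in> carrier (roots_of_unity_group n)"
  then have "x \<noteq> 0" by (auto simp: roots_of_unity_group_def power_0_left)
  then show "\<exists>y\<in>carrier (roots_of_unity_group n).
      y \<otimes>\<^bsub>roots_of_unity_group n\<^esub> x = \<one>\<^bsub>roots_of_unity_group n\<^esub>"
    using x by (intro bexI[of _ "inverse x"]) (auto simp: roots_of_unity_group_def power_inverse)
qed (auto simp: roots_of_unity_group_def power_mult_distrib)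

lemma chars_iff:
  "\<chi> \<in> chars G n \<longleftrightarrow> \<chi> \<in> extensional (carrier G) \<and> (\<forall>x\<in>carrier G. \<chi> x ^ n = 1) \<and>
     (\<forall>x\<in>carrier G. \<forall>y\<in>carrier G. \<chi> (x \<otimes>\<^bsub>G\<^esub> y) = \<chi> x * \<chi> y)"
  by (auto simp: chars_def hom_def roots_of_unity_group_def)

locale prime_degree_reps = prime_degree_root p z + group G for p z and G (structure)
begin

lemma char_root: "\<chi> \<in> chars G p \<Longrightarrow> x \<in> carrier G \<Longrightarrow> \<chi> x ^ p = 1"
  by (simp add: chars_iff)

lemma char_mult: "\<chi> \<in> chars G p \<Longrightarrow> x \<in> carrier G \<Longrightarrow> y \<in> carrier G \<Longrightarrow> \<chi> (x \<otimes> y) = \<chi> x * \<chi> y"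
  by (simp add: chars_iff)

lemma char_nonzero: "\<chi> \<in> chars G p \<Longrightarrow> x \<in> carrier G \<Longrightarrow> \<chi> x \<noteq> 0"
  using char_root root_nonzero by blast

lemma char_group_hom: "\<chi> \<in> chars G p \<Longrightarrow> group_hom G (roots_of_unity_group p) \<chi>"
  using roots_of_unity_group[OF p_pos] by (simp add: chars_def group_hom_def group_hom_axioms_def
      comm_group_def is_group)

lemma char_one: "\<chi> \<in> chars G p \<Longrightarrow> \<chi> \<one> = 1"
  using group_hom.hom_one[OF char_group_hom] by (simp add: roots_of_unity_group_def)

lemma char_inv: "\<chi> \<in> chars G p \<Longrightarrow> x \<in> carrier G \<Longrightarrow> \<chi> (inv x) = inverse (\<chi> x)"
  using char_mult[of \<chi> x "inv x"] char_one[of \<chi>] by (simp add: inverse_unique)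

lemma char_power: "\<chi> \<in> chars G p \<Longrightarrow> x \<in> carrier G \<Longrightarrow> \<chi> (x [^] (k::nat)) = \<chi> x ^ k"
  by (induction k) (auto simp: char_one char_mult mult.commute)

lemma chars_eqI:
  assumes "\<chi> \<in> chars G p" "\<psi> \<in> chars G p" "\<And>x. x \<in> carrier G \<Longrightarrow> \<chi> x = \<psi> x"
  shows "\<chi> = \<psi>"
  using assms by (auto simp: chars_def intro: extensionalityI)

lemma trivial_char_in_chars: "trivial_char G \<in> chars G p"
  by (auto simp: chars_iff trivial_char_def)

lemma char_pow_in_chars: "\<chi> \<in> chars G p \<Longrightarrow> char_pow G \<chi> k \<in> chars G p"
  unfolding chars_iff char_pow_def
  by (auto simp: power_mult_distrib) (metis mult.commute power_mult power_one)

lemma nontrivial_char: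
  assumes "\<chi> \<in> chars G p" "\<chi> \<noteq> trivial_char G"
  obtains x where "x \<in> carrier G" "\<chi> x \<noteq> 1"
  using assms chars_eqI[OF assms(1) trivial_char_in_chars] by (auto simp: trivial_char_def)

lemma nontrivial_char_surj:
  assumes "\<chi> \<in> chars G p" "\<chi> \<noteq> trivial_char G" "s ^ p = 1"
  obtains x where "x \<in> carrier G" "\<chi> x = s"
proof -
  obtain y where y: "y \<in> carrier G" "\<chi> y \<noteq> 1" using nontrivial_char[OF assms(1,2)] .
  obtain k where "s = \<chi> y ^ k"
    using root_of_unity_powers[OF prime char_root[OF assms(1) y(1)] y(2) assms(3)] by blast
  then show thesis using that[of "y [^] k"] y char_power[OF assms(1)] by simp
qed

lemma char_kernel_index:
  assumes \<chi>: "\<chi> \<in> chars G p" "\<chi> \<noteq> trivial_char G"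
  shows "char_kernel G \<chi> \<in> normal_of_index G p"
proof -
  interpret h: group_hom G "roots_of_unity_group p" \<chi> using char_group_hom[OF \<chi>(1)] .
  have ker: "kernel G (roots_of_unity_group p) \<chi> = char_kernel G \<chi>"
    by (auto simp: kernel_def char_kernel_def roots_of_unity_group_def)
  have "\<chi> ` carrier G = carrier (roots_of_unity_group p)"
    using nontrivial_char_surj[OF \<chi>] char_root[OF \<chi>(1)]
    by (auto simp: roots_of_unity_group_def)
  from h.FactGroup_iso_set[OF this]
  have "bij_betw (\<lambda>X. the_elem (\<chi> ` X)) (rcosets (char_kernel G \<chi>)) {s. s ^ p = 1}"
    unfolding ker by (auto simp: iso_def FactGroup_def roots_of_unity_group_def)
  then have "card (rcosets (char_kernel G \<chi>)) = card {s::complex. s ^ p = 1}"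
    by (rule bij_betw_same_card)
  then have "card (rcosets (char_kernel G \<chi>)) = p" by (simp add: card_roots_unity_eq p_pos)
  then show ?thesis using h.normal_kernel by (simp add: ker normal_of_index_def)
qed

text \<open>The values of a nontrivial character \<open>\<chi>\<close> are the powers of \<open>z\<close>. Modulo the kernel of \<open>\<chi>\<close>,
  every element is a power of some \<open>x\<close> with \<open>\<chi> x = z\<close>, so \<open>\<psi>\<close> is determined by \<open>\<psi> x\<close>.\<close>

lemma char_kernel_subset_power:
  assumes \<chi>: "\<chi> \<in> chars G p" "\<chi> \<noteq> trivial_char G" and \<psi>: "\<psi> \<in> chars G p"
    and sub: "char_kernel G \<chi> \<subseteq> char_kernel G \<psi>"
  obtains k where "k < p" "\<psi> = char_pow G \<chi> k"
proof -
  obtain x where x: "x \<in> carrier G" "\<chi> x = z" using nontrivial_char_surj[OF \<chi> z_root] .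
  obtain k where k: "k < p" "\<psi> x = z ^ k"
    using root_of_unity_powers[OF prime z_root z_neq_1 char_root[OF \<psi> x(1)]] .
  have "\<psi> y = \<chi> y ^ k" if y: "y \<in> carrier G" for y
  proof -
    obtain j where j: "\<chi> y = z ^ j"
      using root_of_unity_powers[OF prime z_root z_neq_1 char_root[OF \<chi>(1) y]] by blast
    have "\<chi> (y \<otimes> inv (x [^] j)) = 1"
      using x y j \<chi>(1) by (simp add: char_mult char_inv char_power root_nonzero z_root)
    moreover have "y \<otimes> inv (x [^] j) \<in> carrier G" using x(1) y by simp
    ultimately have "y \<otimes> inv (x [^] j) \<in> char_kernel G \<psi>"
      using sub unfolding char_kernel_def by blast
    then have "\<psi> y * inverse (\<psi> x ^ j) = 1"
      using x y \<psi> by (simp add: char_kernel_def char_mult char_inv char_power)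
    then have "\<psi> y = \<psi> x ^ j"
      using char_nonzero[OF \<psi> x(1)] by (simp add: field_simps)
    then show ?thesis by (simp add: k j mult.commute flip: power_mult)
  qed
  then have "\<psi> = char_pow G \<chi> k"
    by (intro chars_eqI[OF \<psi> char_pow_in_chars[OF \<chi>(1)]]) (simp add: char_pow_def)
  then show thesis using that k by blast
qed

lemma char_kernel_pow:
  assumes "\<chi> \<in> chars G p" "\<not> p dvd k"
  shows "char_kernel G (char_pow G \<chi> k) = char_kernel G \<chi>"
proof -
  have "\<chi> x ^ k = 1 \<longleftrightarrow> \<chi> x = 1" if "x \<in> carrier G" for x
    using root_of_unity_power_eq_1_iff[OF prime char_root[OF assms(1) that], of k] assms(2) by auto
  then show ?thesis by (auto simp: char_kernel_def char_pow_def)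
qed

text \<open>Otherwise \<open>\<psi>\<close> would be a power of \<open>\<chi>\<close>, and nontrivial powers have the same kernel.\<close>

lemma char_kernels_differ:
  assumes \<chi>: "\<chi> \<in> chars G p" "\<chi> \<noteq> trivial_char G" and \<psi>: "\<psi> \<in> chars G p" "\<psi> \<noteq> trivial_char G"
    and ne: "char_kernel G \<chi> \<noteq> char_kernel G \<psi>"
  obtains x where "x \<in> carrier G" "\<chi> x = 1" "\<psi> x \<noteq> 1"
proof -
  have "\<not> char_kernel G \<chi> \<subseteq> char_kernel G \<psi>"
  proof
    assume "char_kernel G \<chi> \<subseteq> char_kernel G \<psi>"
    then obtain k where k: "k < p" "\<psi> = char_pow G \<chi> k"
      using char_kernel_subset_power[OF \<chi> \<psi>(1)] by blast
    have "k \<noteq> 0" using \<psi>(2) k by (auto simp: char_pow_def trivial_char_def)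
    then have "\<not> p dvd k" using k(1) by (simp add: nat_dvd_not_less)
    then show False using char_kernel_pow[OF \<chi>(1)] k(2) ne by simp
  qed
  then show thesis using that by (auto simp: char_kernel_def)
qed

text \<open>The nontrivial characters with a given kernel are the \<open>p - 1\<close> nontrivial powers of one of
  them. The count is made relative to a set \<open>L\<close> of characters closed under powers, so that it applies
  to all characters as well as to the twists of one representation.\<close>

lemma card_index_p_subgroups:
  assumes \<kappa>: "\<And>K. K \<in> normal_of_index G p \<Longrightarrow> \<kappa> K \<in> chars G p \<and> \<kappa> K \<noteq> trivial_char G \<and> char_kernel G (\<kappa> K) = K"
    and L: "L \<subseteq> chars G p" "finite L" "trivial_char G \<in> L" "\<And>\<chi> k. \<chi> \<in> L \<Longrightarrow> char_pow G \<chi> k \<in> L"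
  shows "finite {K \<in> normal_of_index G p. \<kappa> K \<in> L}"
    and "card {K \<in> normal_of_index G p. \<kappa> K \<in> L} * (p - 1) = card L - 1"
proof -
  define A where "A = {K \<in> normal_of_index G p. \<kappa> K \<in> L}"
  have bij: "bij_betw (\<lambda>(K, k). char_pow G (\<kappa> K) k) (A \<times> {1..<p}) (L - {trivial_char G})"
    (is "bij_betw ?f ?D ?L")
    unfolding bij_betw_def
  proof
    show "inj_on ?f ?D"
    proof (rule inj_onI, clarify)
      fix K k K' k' assume K: "K \<in> A" "K' \<in> A" and k: "k \<in> {1..<p}" "k' \<in> {1..<p}"
        and eq: "char_pow G (\<kappa> K) k = char_pow G (\<kappa> K') k'"
      have kd: "\<not> p dvd k" "\<not> p dvd k'" using k by (auto simp: nat_dvd_not_less)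
      have \<kappa>K: "\<kappa> K \<in> chars G p" "\<kappa> K \<noteq> trivial_char G" "char_kernel G (\<kappa> K) = K"
        "\<kappa> K' \<in> chars G p" "char_kernel G (\<kappa> K') = K'" using K \<kappa> by (auto simp: A_def)
      have KK: "K = K'" using char_kernel_pow[OF \<kappa>K(1) kd(1)] char_kernel_pow[OF \<kappa>K(4) kd(2)] eq \<kappa>K by simp
      obtain x where x: "x \<in> carrier G" "\<kappa> K x = z" using nontrivial_char_surj[OF \<kappa>K(1,2) z_root] .
      have "z ^ k = z ^ k'" using fun_cong[OF eq, of x] x KK by (simp add: char_pow_def)
      then have "k = k'" using root_of_unity_power_inj[OF prime z_root z_neq_1] k by simp
      with KK show "K = K' \<and> k = k'" by simp
    qed
    show "?f ` ?D = ?L"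
    proof (intro equalityI subsetI)
      fix \<chi> assume "\<chi> \<in> ?f ` ?D"
      then obtain K k where K: "K \<in> A" "k \<in> {1..<p}" "\<chi> = char_pow G (\<kappa> K) k" by auto
      then have \<kappa>K: "\<kappa> K \<in> chars G p" "\<kappa> K \<noteq> trivial_char G" "\<kappa> K \<in> L" using \<kappa> by (auto simp: A_def)
      obtain x where x: "x \<in> carrier G" "\<kappa> K x = z" using nontrivial_char_surj[OF \<kappa>K(1,2) z_root] .
      have "z ^ k \<noteq> 1"
        using K(2) root_of_unity_power_eq_1_iff[OF prime z_root z_neq_1] by (auto simp: nat_dvd_not_less)
      then have "\<chi> x \<noteq> trivial_char G x" using K x by (simp add: char_pow_def trivial_char_def)
      then show "\<chi> \<in> ?L" using K L(4) \<kappa>K by auto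
    next
      fix \<chi> assume "\<chi> \<in> ?L"
      then have \<chi>: "\<chi> \<in> L" "\<chi> \<in> chars G p" "\<chi> \<noteq> trivial_char G" using L by auto
      define K where "K = char_kernel G \<chi>"
      have K: "K \<in> normal_of_index G p" unfolding K_def by (rule char_kernel_index[OF \<chi>(2,3)])
      then have \<kappa>K: "\<kappa> K \<in> chars G p" "\<kappa> K \<noteq> trivial_char G" "char_kernel G (\<kappa> K) = char_kernel G \<chi>"
        using \<kappa> by (auto simp: K_def)
      obtain j where "\<kappa> K = char_pow G \<chi> j"
        using char_kernel_subset_power[OF \<chi>(2,3) \<kappa>K(1)] \<kappa>K(3) by auto
      then have "K \<in> A" using L(4)[OF \<chi>(1)] K by (auto simp: A_def)
      moreover obtain k where k: "k < p" "\<chi> = char_pow G (\<kappa> K) k"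
        using char_kernel_subset_power[OF \<kappa>K(1,2) \<chi>(2)] \<kappa>K(3) by auto
      moreover have "k \<noteq> 0"
      proof
        assume "k = 0"
        then have "\<chi> = trivial_char G" unfolding k(2) by (auto simp: char_pow_def trivial_char_def)
        with \<chi>(3) show False by simp
      qed
      ultimately show "\<chi> \<in> ?f ` ?D"
        by (intro image_eqI[of _ _ "(K, k)"]) auto
    qed
  qed
  have "finite ?D" using bij_betw_finite[OF bij] L(2) by simp
  then show "finite {K \<in> normal_of_index G p. \<kappa> K \<in> L}"
    using p_gt_1 by (auto simp: A_def dest: finite_cartesian_productD1)
  have "card ?D = card (L - {trivial_char G})" by (rule bij_betw_same_card[OF bij])
  then show "card {K \<in> normal_of_index G p. \<kappa> K \<in> L} * (p - 1) = card L - 1"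
    using L(2,3) by (simp add: A_def card_cartesian_product)
qed

section \<open>Representations up to conjugation and their twists\<close>

definition conj_by :: "complex mat set \<Rightarrow> ('a \<Rightarrow> complex mat set) \<Rightarrow> 'a \<Rightarrow> complex mat set" where
  "conj_by g \<rho> = (\<lambda>x\<in>carrier G. conjugate g (\<rho> x))"

lemma rep_closed: "\<rho> \<in> reps G p \<Longrightarrow> x \<in> carrier G \<Longrightarrow> \<rho> x \<in> carrier (PSL p)"
  by (auto simp: reps_def hom_def)

lemma rep_mult: "\<rho> \<in> reps G p \<Longrightarrow> x \<in> carrier G \<Longrightarrow> y \<in> carrier G \<Longrightarrow> \<rho> (x \<otimes> y) = \<rho> x \<diamondop> \<rho> y"
  by (auto simp: reps_def hom_def)

lemma rep_image_subgroup:
  assumes "\<rho> \<in> reps G p"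
  shows "subgroup (\<rho> ` carrier G) (PSL p)"
proof -
  interpret group_hom G "PSL p" \<rho>
    using assms by (simp add: group_hom_def group_hom_axioms_def reps_def is_group PSL.is_group)
  show ?thesis by (rule img_is_subgroup)
qed

lemma irreducible_reps_iff:
  "\<rho> \<in> irreducible_reps G p \<longleftrightarrow> \<rho> \<in> reps G p \<and> irreducible_subgroup p (\<rho> ` carrier G)"
  by (simp add: irreducible_reps_def)

lemma conj_group:
  assumes "g \<in> carrier (PSL p)" "x \<in> carrier (PSL p)" "y \<in> carrier (PSL p)"
  shows "conjugate g (x \<diamondop> y) =
    (conjugate g x) \<diamondop> (conjugate g y)"
proof -
  have "Pinv g \<diamondop> (g \<diamondop> w) = w" if "w \<in> carrier (PSL p)" for w
    using that assms(1) by (simp flip: PSL.m_assoc)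
  then show ?thesis using assms by (simp add: PSL.m_assoc)
qed

lemma conj_by_rep:
  assumes "\<rho> \<in> reps G p" "g \<in> carrier (PSL p)"
  shows "conj_by g \<rho> \<in> reps G p"
  using assms unfolding reps_def conj_by_def
  by (auto simp: hom_def conj_group Pi_iff)

lemma conj_class_iff:
  "\<rho> \<in> reps G p \<Longrightarrow> \<sigma> \<in> conj_class G p \<rho> \<longleftrightarrow> (\<exists>g\<in>carrier (PSL p). \<sigma> = conj_by g \<rho>)"
  unfolding conj_class_def
proof safe
  fix g assume "\<rho> \<in> reps G p" "\<sigma> \<in> reps G p" "g \<in> carrier (PSL p)"
    "\<forall>x\<in>carrier G. \<sigma> x = conjugate g (\<rho> x)"
  then show "\<exists>g\<in>carrier (PSL p). \<sigma> = conj_by g \<rho>"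
    by (intro bexI[of _ g]) (auto simp: conj_by_def reps_def intro!: extensionalityI[of _ "carrier G"])
qed (use conj_by_rep in \<open>auto simp: conj_by_def\<close>)

lemma conj_by_conj_by:
  assumes "\<rho> \<in> reps G p" "g \<in> carrier (PSL p)" "h \<in> carrier (PSL p)"
  shows "conj_by h (conj_by g \<rho>) = conj_by (h \<diamondop> g) \<rho>"
  using assms rep_closed[OF assms(1)]
  by (auto simp: conj_by_def PSL.inv_mult_group PSL.m_assoc intro!: restrict_ext)

lemma conj_by_one: "\<rho> \<in> reps G p \<Longrightarrow> conj_by \<one>\<^bsub>PSL p\<^esub> \<rho> = \<rho>"
proof -
  assume \<rho>: "\<rho> \<in> reps G p"
  then have "\<rho> \<in> extensional (carrier G)" by (simp add: reps_def)
  from extensionalityI[OF restrict_extensional this] show ?thesis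
    unfolding conj_by_def using rep_closed[OF \<rho>] by simp
qed

lemma conj_class_conj_by:
  assumes "\<rho> \<in> reps G p" "g \<in> carrier (PSL p)"
  shows "conj_class G p (conj_by g \<rho>) = conj_class G p \<rho>"
proof (rule Set.set_eqI)
  fix \<sigma>
  have "\<exists>h'\<in>carrier (PSL p). conj_by h \<rho> = conj_by h' (conj_by g \<rho>)" if "h \<in> carrier (PSL p)" for h
    using assms that
    by (intro bexI[of _ "h \<diamondop> Pinv g"]) (auto simp: conj_by_conj_by PSL.m_assoc)
  moreover have "\<exists>h'\<in>carrier (PSL p). conj_by h (conj_by g \<rho>) = conj_by h' \<rho>" if "h \<in> carrier (PSL p)" for h
    using assms that by (intro bexI[of _ "h \<diamondop> g"]) (auto simp: conj_by_conj_by)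
  ultimately show "\<sigma> \<in> conj_class G p (conj_by g \<rho>) \<longleftrightarrow> \<sigma> \<in> conj_class G p \<rho>"
    using conj_class_iff[OF assms(1)] conj_class_iff[OF conj_by_rep[OF assms]] by metis
qed

lemma conj_class_eq_iff:
  assumes "\<rho> \<in> reps G p" "\<sigma> \<in> reps G p"
  shows "conj_class G p \<rho> = conj_class G p \<sigma> \<longleftrightarrow> (\<exists>g\<in>carrier (PSL p). \<sigma> = conj_by g \<rho>)"
proof
  assume "conj_class G p \<rho> = conj_class G p \<sigma>"
  moreover have "\<sigma> \<in> conj_class G p \<sigma>"
    using conj_class_iff[OF assms(2)] conj_by_one[OF assms(2)] PSL.one_closed by metis
  ultimately show "\<exists>g\<in>carrier (PSL p). \<sigma> = conj_by g \<rho>" using conj_class_iff[OF assms(1)] by blast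
next
  assume "\<exists>g\<in>carrier (PSL p). \<sigma> = conj_by g \<rho>"
  then show "conj_class G p \<rho> = conj_class G p \<sigma>" using conj_class_conj_by[OF assms(1)] by auto
qed

lemma conj_by_irreducible:
  assumes "\<rho> \<in> irreducible_reps G p" "g \<in> carrier (PSL p)"
  shows "conj_by g \<rho> \<in> irreducible_reps G p"
proof -
  have \<rho>: "\<rho> \<in> reps G p" "irreducible_subgroup p (\<rho> ` carrier G)"
    using assms(1) by (auto simp: irreducible_reps_iff)
  have "irreducible_subgroup p (conj_by g \<rho> ` carrier G)"
    by (rule irreducible_subgroup_conj[OF \<rho>(2) assms(2) rep_image_subgroup[OF conj_by_rep[OF \<rho>(1) assms(2)]]])
      (auto simp: conj_by_def)
  then show ?thesis using conj_by_rep[OF \<rho>(1) assms(2)] by (simp add: irreducible_reps_iff)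
qed

text \<open>In other words, \<open>S\<close> centralizes the image of \<open>\<rho>\<close>, and \<open>\<chi>\<close> measures the failure of this
  at the level of SL.\<close>

definition twisted :: "complex mat set \<Rightarrow> ('a \<Rightarrow> complex) \<Rightarrow> ('a \<Rightarrow> complex mat set) \<Rightarrow> bool" where
  "twisted S \<chi> \<rho> \<longleftrightarrow> (\<forall>x\<in>carrier G. comm_scalar S (\<rho> x) (\<chi> x))"

definition twists :: "('a \<Rightarrow> complex mat set) \<Rightarrow> ('a \<Rightarrow> complex) set" where
  "twists \<rho> = {\<chi> \<in> chars G p. \<exists>S. twisted S \<chi> \<rho>}"

lemma twisted_carrier: "twisted S \<chi> \<rho> \<Longrightarrow> S \<in> carrier (PSL p)"
  unfolding twisted_def using comm_scalar_carrier(1) by blast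

lemma twisted_conj_by:
  assumes "twisted S \<chi> \<rho>" "g \<in> carrier (PSL p)"
  shows "twisted (conjugate g S) \<chi> (conj_by g \<rho>)"
  using assms comm_scalar_conj by (simp add: twisted_def conj_by_def)

lemma twisted_pow: "twisted S \<chi> \<rho> \<Longrightarrow> twisted (S [^]\<^bsub>PSL p\<^esub> (k::nat)) (char_pow G \<chi> k) \<rho>"
  using comm_scalar_pow_left by (simp add: twisted_def char_pow_def)

lemma twists_pow: "\<chi> \<in> twists \<rho> \<Longrightarrow> char_pow G \<chi> k \<in> twists \<rho>"
  using twisted_pow char_pow_in_chars unfolding twists_def by blast

lemma trivial_twisted: "\<rho> \<in> reps G p \<Longrightarrow> twisted \<one>\<^bsub>PSL p\<^esub> (trivial_char G) \<rho>"
  unfolding twisted_def trivial_char_def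
  using comm_scalar_sym[OF comm_scalar_one_right] rep_closed by fastforce

lemma trivial_twist: "\<rho> \<in> reps G p \<Longrightarrow> trivial_char G \<in> twists \<rho>"
  using trivial_twisted trivial_char_in_chars unfolding twists_def by blast

text \<open>The quotient of two elements realizing the same twist commutes with \<open>\<rho>\<close> at the level of SL.\<close>

lemma twisted_unique:
  assumes "\<rho> \<in> irreducible_reps G p" "twisted S \<chi> \<rho>" "twisted T \<chi> \<rho>"
  shows "S = T"
proof -
  have ST: "S \<in> carrier (PSL p)" "T \<in> carrier (PSL p)" using assms twisted_carrier by blast+
  have "S \<diamondop> Pinv T = \<one>\<^bsub>PSL p\<^esub>"
  proof (rule irreducible_commutant)
    show "irreducible_subgroup p (\<rho> ` carrier G)" using assms by (simp add: irreducible_reps_iff)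
    fix X assume "X \<in> \<rho> ` carrier G"
    then obtain x where x: "x \<in> carrier G" "X = \<rho> x" by blast
    then have "comm_scalar S X (\<chi> x)" "comm_scalar T X (\<chi> x)" using assms by (auto simp: twisted_def)
    then show "comm_scalar (S \<diamondop> Pinv T) X 1"
      using comm_scalar_mult_left[OF _ comm_scalar_inv_left] comm_scalar_nonzero by fastforce
  qed (use ST in simp)
  then show ?thesis using ST by (metis PSL.inv_closed PSL.inv_equality PSL.inv_inv)
qed

lemma twist_of_centralizing:
  assumes "\<rho> \<in> reps G p" "S \<in> carrier (PSL p)"
    and comm: "\<And>x. x \<in> carrier G \<Longrightarrow> S \<diamondop> \<rho> x = \<rho> x \<diamondop> S"
  obtains \<chi> where "\<chi> \<in> twists \<rho>" "twisted S \<chi> \<rho>"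
proof -
  have "\<exists>s. comm_scalar S (\<rho> x) s" if "x \<in> carrier G" for x
    using comm_scalar_iff_commute[OF assms(2) rep_closed[OF assms(1) that]] comm that by blast
  then obtain f where f: "\<And>x. x \<in> carrier G \<Longrightarrow> comm_scalar S (\<rho> x) (f x)" by metis
  define \<chi> where "\<chi> = restrict f (carrier G)"
  have \<chi>: "comm_scalar S (\<rho> x) (\<chi> x)" if "x \<in> carrier G" for x using f that by (simp add: \<chi>_def)
  have "\<chi> (x \<otimes> y) = \<chi> x * \<chi> y" if "x \<in> carrier G" "y \<in> carrier G" for x y
    using comm_scalar_mult_right[OF \<chi>[OF that(1)] \<chi>[OF that(2)]] \<chi>[OF m_closed[OF that]]
    unfolding rep_mult[OF assms(1) that] by (intro comm_scalar_unique)
  then have "\<chi> \<in> chars G p" using comm_scalar_root[OF \<chi>] by (auto simp: chars_iff \<chi>_def)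
  moreover have "twisted S \<chi> \<rho>" using \<chi> by (simp add: twisted_def)
  ultimately show thesis using that unfolding twists_def by blast
qed

end

context prime_degree_reps
begin

section \<open>Pseudo-components in terms of twists\<close>

text \<open>The homomorphism \<open>\<phi>\<close> to the cyclic group, as a character: the generator corresponds to \<open>z\<close>.\<close>

definition level_char :: "('a \<Rightarrow> complex mat set) \<Rightarrow> 'a \<Rightarrow> complex" where
  "level_char \<phi> = (\<lambda>x\<in>carrier G. THE s. comm_scalar (clock_bar z) (\<phi> x) s)"

lemma level_char:
  assumes \<phi>: "\<phi> \<in> hom G (PSL p\<lparr>carrier := C_bar p\<rparr>)"
  shows "x \<in> carrier G \<Longrightarrow> comm_scalar (clock_bar z) (\<phi> x) (level_char \<phi> x)"
    and "level_char \<phi> \<in> chars G p"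
    and "char_kernel G (level_char \<phi>) = kernel G (PSL p\<lparr>carrier := C_bar p\<rparr>) \<phi>"
proof -
  have C: "\<phi> x \<in> C_bar p" if "x \<in> carrier G" for x using \<phi> that by (auto simp: hom_def)
  have spec: "comm_scalar (clock_bar z) (\<phi> x) (level_char \<phi> x)" if x: "x \<in> carrier G" for x
  proof -
    obtain s where s: "comm_scalar (clock_bar z) (\<phi> x) s" using C_bar_comm_scalar[OF C[OF x]] .
    then have "(THE s. comm_scalar (clock_bar z) (\<phi> x) s) = s"
      using comm_scalar_unique by blast
    with s x show ?thesis by (simp add: level_char_def)
  qed
  then show "x \<in> carrier G \<Longrightarrow> comm_scalar (clock_bar z) (\<phi> x) (level_char \<phi> x)" .
  have "level_char \<phi> (x \<otimes> y) = level_char \<phi> x * level_char \<phi> y"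
    if xy: "x \<in> carrier G" "y \<in> carrier G" for x y
  proof -
    have "\<phi> (x \<otimes> y) = \<phi> x \<diamondop> \<phi> y" using \<phi> xy by (auto simp: hom_def)
    then show ?thesis
      using comm_scalar_unique spec[OF m_closed[OF xy]] comm_scalar_mult_right[OF spec[OF xy(1)] spec[OF xy(2)]]
      by simp
  qed
  then show "level_char \<phi> \<in> chars G p"
    using comm_scalar_root[OF spec] by (auto simp: chars_iff level_char_def)
  have "level_char \<phi> x = 1 \<longleftrightarrow> \<phi> x = \<one>\<^bsub>PSL p\<^esub>" if x: "x \<in> carrier G" for x
  proof
    assume "level_char \<phi> x = 1"
    then have "comm_scalar (clock_bar z) (\<phi> x) 1" using spec[OF x] by simp
    then show "\<phi> x = \<one>\<^bsub>PSL p\<^esub>"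
      using C_bar_inj[OF C[OF x] subgroup.one_closed[OF C_bar_subgroup]]
        comm_scalar_one_right[OF clock_bar_closed[OF z_root]] by simp
  next
    assume "\<phi> x = \<one>\<^bsub>PSL p\<^esub>"
    then show "level_char \<phi> x = 1"
      using comm_scalar_unique[OF spec[OF x]] comm_scalar_one_right[OF clock_bar_closed[OF z_root]] by simp
  qed
  then show "char_kernel G (level_char \<phi>) = kernel G (PSL p\<lparr>carrier := C_bar p\<rparr>) \<phi>"
    by (auto simp: char_kernel_def kernel_def)
qed

lemma in_pseudo_component_form_iff:
  assumes \<phi>: "\<phi> \<in> hom G (PSL p\<lparr>carrier := C_bar p\<rparr>)"
  shows "\<rho> ` carrier G \<subseteq> D_bar p <#>\<^bsub>PSL p\<^esub> C_bar p \<and> (\<forall>x\<in>carrier G. quot_map p (\<rho> x) = \<phi> x)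
    \<longleftrightarrow> twisted (clock_bar z) (level_char \<phi>) \<rho>"
proof -
  have C: "\<phi> x \<in> C_bar p" if "x \<in> carrier G" for x using \<phi> that by (auto simp: hom_def)
  have "\<rho> x \<in> D_bar p <#>\<^bsub>PSL p\<^esub> C_bar p \<and> quot_map p (\<rho> x) = \<phi> x \<longleftrightarrow>
      comm_scalar (clock_bar z) (\<rho> x) (level_char \<phi> x)" if x: "x \<in> carrier G" for x
    using quot_map_eq_iff[OF C[OF x] level_char(1)[OF \<phi> x]] in_semidirect_iff[of "\<rho> x"] by blast
  then show ?thesis unfolding twisted_def by blast
qed

text \<open>The element \<open>S\<close> realizing a nontrivial twist of \<open>\<rho>\<close> forms a Weyl pair with a suitable
  \<open>\<rho> x\<close>, hence is conjugate to the clock element.\<close>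

lemma pseudo_component_iff:
  assumes \<phi>: "\<phi> \<in> hom G (PSL p\<lparr>carrier := C_bar p\<rparr>)" "level_char \<phi> \<noteq> trivial_char G"
    and \<rho>: "\<rho> \<in> irreducible_reps G p"
  shows "conj_class G p \<rho> \<in> pseudo_component G p \<phi> \<longleftrightarrow> level_char \<phi> \<in> twists \<rho>"
proof
  have \<rho>r: "\<rho> \<in> reps G p" using \<rho> by (simp add: irreducible_reps_iff)
  {
    assume "conj_class G p \<rho> \<in> pseudo_component G p \<phi>"
    then obtain \<sigma> where \<sigma>: "\<sigma> \<in> irreducible_reps G p" "conj_class G p \<rho> = conj_class G p \<sigma>"
      "twisted (clock_bar z) (level_char \<phi>) \<sigma>"
      unfolding pseudo_component_def using in_pseudo_component_form_iff[OF \<phi>(1)] by blast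
    have \<sigma>r: "\<sigma> \<in> reps G p" using \<sigma> by (simp add: irreducible_reps_iff)
    obtain g where "g \<in> carrier (PSL p)" "\<rho> = conj_by g \<sigma>"
      using conj_class_eq_iff[OF \<sigma>r \<rho>r] \<sigma>(2) by metis
    then show "level_char \<phi> \<in> twists \<rho>"
      using twisted_conj_by[OF \<sigma>(3)] level_char(2)[OF \<phi>(1)] unfolding twists_def by blast
  next
    assume "level_char \<phi> \<in> twists \<rho>"
    then obtain S where S: "twisted S (level_char \<phi>) \<rho>" unfolding twists_def by blast
    obtain x where x: "x \<in> carrier G" "level_char \<phi> x = z"
      using nontrivial_char_surj[OF level_char(2)[OF \<phi>(1)] \<phi>(2) z_root] .
    have "comm_scalar S (\<rho> x) z" using S x unfolding twisted_def by metis
    then obtain g where g: "g \<in> carrier (PSL p)" "clock_bar z = conjugate g S"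
      using Weyl_pairs_conjugate[OF _ clock_shift z_neq_1] by metis
    have "twisted (clock_bar z) (level_char \<phi>) (conj_by g \<rho>)"
      using twisted_conj_by[OF S g(1)] g(2) by simp
    then have "conj_class G p (conj_by g \<rho>) \<in> pseudo_component G p \<phi>"
      using in_pseudo_component_form_iff[OF \<phi>(1)] conj_by_irreducible[OF \<rho> g(1)]
      unfolding pseudo_component_def by blast
    then show "conj_class G p \<rho> \<in> pseudo_component G p \<phi>" using conj_class_conj_by[OF \<rho>r g(1)] by simp
  }
qed

section \<open>Bad and abelian representations\<close>

text \<open>A centralizing element realizes some twist, and the trivial twist is realized only by the
  identity.\<close>

lemma bad_reps_iff:
  "\<rho> \<in> bad_reps G p \<longleftrightarrow> \<rho> \<in> irreducible_reps G p \<and> (\<exists>\<chi>\<in>twists \<rho>. \<chi> \<noteq> trivial_char G)"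
proof -
  have "centralizer (PSL p) (\<rho> ` carrier G) \<noteq> {\<one>\<^bsub>PSL p\<^esub>} \<longleftrightarrow> (\<exists>\<chi>\<in>twists \<rho>. \<chi> \<noteq> trivial_char G)"
    if \<rho>: "\<rho> \<in> irreducible_reps G p"
  proof
    have \<rho>r: "\<rho> \<in> reps G p" using \<rho> by (simp add: irreducible_reps_iff)
    {
      assume "centralizer (PSL p) (\<rho> ` carrier G) \<noteq> {\<one>\<^bsub>PSL p\<^esub>}"
      moreover have "\<one>\<^bsub>PSL p\<^esub> \<in> centralizer (PSL p) (\<rho> ` carrier G)"
        using rep_closed[OF \<rho>r] by (auto simp: centralizer_def)
      ultimately obtain S where S: "S \<in> centralizer (PSL p) (\<rho> ` carrier G)" "S \<noteq> \<one>\<^bsub>PSL p\<^esub>" by blast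
      then obtain \<chi> where \<chi>: "\<chi> \<in> twists \<rho>" "twisted S \<chi> \<rho>"
        using twist_of_centralizing[OF \<rho>r, of S] by (auto simp: centralizer_def)
      have "\<chi> \<noteq> trivial_char G"
        using twisted_unique[OF \<rho> _ trivial_twisted[OF \<rho>r]] \<chi>(2) S(2) by blast
      then show "\<exists>\<chi>\<in>twists \<rho>. \<chi> \<noteq> trivial_char G" using \<chi>(1) by blast
    next
      assume "\<exists>\<chi>\<in>twists \<rho>. \<chi> \<noteq> trivial_char G"
      then obtain \<chi> S where \<chi>: "\<chi> \<in> chars G p" "\<chi> \<noteq> trivial_char G" "twisted S \<chi> \<rho>"
        unfolding twists_def by blast
      have "S \<diamondop> \<rho> x = \<rho> x \<diamondop> S" if "x \<in> carrier G" for x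
        using \<chi>(3) that comm_scalar_iff_commute[OF twisted_carrier[OF \<chi>(3)] rep_closed[OF \<rho>r that]]
        unfolding twisted_def by blast
      then have "S \<in> centralizer (PSL p) (\<rho> ` carrier G)"
        using twisted_carrier[OF \<chi>(3)] by (auto simp: centralizer_def)
      moreover have "S \<noteq> \<one>\<^bsub>PSL p\<^esub>"
      proof
        assume S: "S = \<one>\<^bsub>PSL p\<^esub>"
        obtain x where x: "x \<in> carrier G" "\<chi> x \<noteq> 1" using nontrivial_char[OF \<chi>(1,2)] .
        have "comm_scalar S (\<rho> x) (\<chi> x)" using \<chi>(3) x(1) by (simp add: twisted_def)
        moreover have "comm_scalar S (\<rho> x) (trivial_char G x)"
          using trivial_twisted[OF \<rho>r] x(1) S by (simp add: twisted_def)
        ultimately show False using comm_scalar_unique x by (auto simp: trivial_char_def)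
      qed
      ultimately show "centralizer (PSL p) (\<rho> ` carrier G) \<noteq> {\<one>\<^bsub>PSL p\<^esub>}" by blast
    }
  qed
  then show ?thesis
    by (auto simp: bad_reps_def bad_subgroup_def irreducible_reps_iff)
qed

lemma abelian_irreducible_reps_iff:
  "\<rho> \<in> abelian_irreducible_reps G p \<longleftrightarrow> \<rho> \<in> irreducible_reps G p \<and>
     (\<forall>x\<in>carrier G. \<forall>y\<in>carrier G. \<rho> x \<diamondop> \<rho> y = \<rho> y \<diamondop> \<rho> x)"
proof -
  have "comm_group (PSL p\<lparr>carrier := \<rho> ` carrier G\<rparr>) \<longleftrightarrow>
     (\<forall>x\<in>carrier G. \<forall>y\<in>carrier G. \<rho> x \<diamondop> \<rho> y = \<rho> y \<diamondop> \<rho> x)"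
    if \<rho>: "\<rho> \<in> irreducible_reps G p"
  proof
    assume "comm_group (PSL p\<lparr>carrier := \<rho> ` carrier G\<rparr>)"
    then interpret c: comm_group "PSL p\<lparr>carrier := \<rho> ` carrier G\<rparr>" .
    show "\<forall>x\<in>carrier G. \<forall>y\<in>carrier G. \<rho> x \<diamondop> \<rho> y = \<rho> y \<diamondop> \<rho> x"
      using c.m_comm by simp
  next
    assume "\<forall>x\<in>carrier G. \<forall>y\<in>carrier G. \<rho> x \<diamondop> \<rho> y = \<rho> y \<diamondop> \<rho> x"
    moreover have "group (PSL p\<lparr>carrier := \<rho> ` carrier G\<rparr>)"
      using subgroup.subgroup_is_group[OF rep_image_subgroup PSL.is_group] \<rho>
      by (simp add: irreducible_reps_iff)
    ultimately show "comm_group (PSL p\<lparr>carrier := \<rho> ` carrier G\<rparr>)"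
      by (intro group.group_comm_groupI) auto
  qed
  then show ?thesis by (auto simp: abelian_irreducible_reps_def)
qed

text \<open>The scalar of \<open>S ^ i T ^ j\<close> with \<open>S\<close> depends only on \<open>j\<close>, that with \<open>T\<close> only on \<open>i\<close>.\<close>

lemma Weyl_pair_prescribed_scalars:
  assumes ST: "comm_scalar S T s" "s \<noteq> 1" and ab: "a ^ p = 1" "b ^ p = 1"
  obtains i j :: nat where
    "comm_scalar (S [^]\<^bsub>PSL p\<^esub> i \<diamondop> T [^]\<^bsub>PSL p\<^esub> j) S a"
    "comm_scalar (S [^]\<^bsub>PSL p\<^esub> i \<diamondop> T [^]\<^bsub>PSL p\<^esub> j) T b"
proof -
  have s: "s ^ p = 1" using comm_scalar_root[OF ST(1)] .
  have ST': "S \<in> carrier (PSL p)" "T \<in> carrier (PSL p)" using comm_scalar_carrier[OF ST(1)] by auto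
  obtain i where i: "b = s ^ i" using root_of_unity_powers[OF prime s ST(2) ab(2)] by blast
  have "inverse s ^ p = 1" "inverse s \<noteq> 1" using s ST(2) by (auto simp: power_inverse)
  then obtain j where j: "a = inverse s ^ j" using root_of_unity_powers[OF prime _ _ ab(1)] by blast
  have "comm_scalar (S [^]\<^bsub>PSL p\<^esub> i \<diamondop> T [^]\<^bsub>PSL p\<^esub> j) S (1 ^ i * inverse s ^ j)"
    by (intro comm_scalar_mult_left comm_scalar_pow_left comm_scalar_self comm_scalar_sym ST ST')
  moreover have "comm_scalar (S [^]\<^bsub>PSL p\<^esub> i \<diamondop> T [^]\<^bsub>PSL p\<^esub> j) T (s ^ i * 1 ^ j)"
    by (intro comm_scalar_mult_left comm_scalar_pow_left comm_scalar_self ST ST')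
  ultimately show thesis using that[of i j] i j by simp
qed

lemma Weyl_pair_scalars_determine:
  assumes ST: "comm_scalar S T s" "s \<noteq> 1"
    and U: "comm_scalar S U a" "comm_scalar T U b" and V: "comm_scalar S V a" "comm_scalar T V b"
  shows "U = V"
proof -
  have UV: "U \<in> carrier (PSL p)" "V \<in> carrier (PSL p)" using comm_scalar_carrier U V by blast+
  have "comm_scalar (U \<diamondop> Pinv V) X 1" if "comm_scalar X U c" "comm_scalar X V c" for X c
    using comm_scalar_sym[OF comm_scalar_mult_right[OF that(1) comm_scalar_inv_right[OF that(2)]]]
      comm_scalar_nonzero[OF that(1)] by simp
  then have "U \<diamondop> Pinv V = \<one>\<^bsub>PSL p\<^esub>"
    using Weyl_pair_commutant[OF ST] U V by blast
  then show ?thesis using UV by (metis PSL.inv_closed PSL.inv_equality PSL.inv_inv)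
qed

text \<open>If all lifts commuted, the image would be trivial by Schur's lemma, hence reducible.\<close>

lemma abelian_irreducible_Weyl_pair:
  assumes \<rho>: "\<rho> \<in> abelian_irreducible_reps G p"
  obtains x y s where "x \<in> carrier G" "y \<in> carrier G" "comm_scalar (\<rho> x) (\<rho> y) s" "s \<noteq> 1"
proof (rule ccontr)
  assume no: "\<not> thesis"
  note found = that
  have irr: "irreducible_subgroup p (\<rho> ` carrier G)" and \<rho>r: "\<rho> \<in> reps G p"
    using \<rho> by (auto simp: abelian_irreducible_reps_iff irreducible_reps_iff)
  have comm: "comm_scalar (\<rho> x) (\<rho> y) 1" if xy: "x \<in> carrier G" "y \<in> carrier G" for x y
  proof -
    have "\<rho> x \<diamondop> \<rho> y = \<rho> y \<diamondop> \<rho> x" using \<rho> xy by (simp add: abelian_irreducible_reps_iff)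
    then obtain s where s: "comm_scalar (\<rho> x) (\<rho> y) s"
      using comm_scalar_iff_commute rep_closed[OF \<rho>r] xy by blast
    moreover have "s = 1" using found[OF xy s] no by blast
    ultimately show ?thesis by simp
  qed
  have "\<rho> x = \<one>\<^bsub>PSL p\<^esub>" if "x \<in> carrier G" for x
    using irreducible_commutant[OF irr rep_closed[OF \<rho>r that]] comm that by blast
  then have "\<rho> ` carrier G = {\<one>\<^bsub>PSL p\<^esub>}" using one_closed by force
  then show False using irreducible_nontrivial[OF irr] by blast
qed

text \<open>Let \<open>\<rho> x\<close>, \<open>\<rho> y\<close> be a Weyl pair. A twist is determined by its values at \<open>x\<close> and \<open>y\<close>, and all
  pairs of values occur: the image is abelian, so its elements realize twists, among them the products
  of powers of \<open>\<rho> x\<close> and \<open>\<rho> y\<close>.\<close>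

lemma card_twists_abelian:
  assumes \<rho>: "\<rho> \<in> abelian_irreducible_reps G p"
  shows "finite (twists \<rho>)" "card (twists \<rho>) = p ^ 2"
proof -
  have \<rho>i: "\<rho> \<in> irreducible_reps G p"
    and comm: "\<And>x y. x \<in> carrier G \<Longrightarrow> y \<in> carrier G \<Longrightarrow> \<rho> x \<diamondop> \<rho> y = \<rho> y \<diamondop> \<rho> x"
    using \<rho> by (auto simp: abelian_irreducible_reps_iff)
  have \<rho>r: "\<rho> \<in> reps G p" using \<rho>i by (simp add: irreducible_reps_iff)
  obtain x y s where xy: "x \<in> carrier G" "y \<in> carrier G" and s: "comm_scalar (\<rho> x) (\<rho> y) s" "s \<noteq> 1"
    using abelian_irreducible_Weyl_pair[OF \<rho>] .
  define R where "R = {s::complex. s ^ p = 1}"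
  have bij: "bij_betw (\<lambda>\<chi>. (\<chi> x, \<chi> y)) (twists \<rho>) (R \<times> R)"
    unfolding bij_betw_def
  proof
    show "inj_on (\<lambda>\<chi>. (\<chi> x, \<chi> y)) (twists \<rho>)"
    proof (rule inj_onI)
      fix \<chi> \<psi> assume \<chi>: "\<chi> \<in> twists \<rho>" and \<psi>: "\<psi> \<in> twists \<rho>" and eq: "(\<chi> x, \<chi> y) = (\<psi> x, \<psi> y)"
      obtain S where S: "twisted S \<chi> \<rho>" using \<chi> by (auto simp: twists_def)
      obtain T where T: "twisted T \<psi> \<rho>" using \<psi> by (auto simp: twists_def)
      have "comm_scalar (\<rho> w) S (inverse (\<chi> w))" "comm_scalar (\<rho> w) T (inverse (\<psi> w))" if "w \<in> carrier G" for w
        using S T that comm_scalar_sym by (auto simp: twisted_def)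
      from this[OF xy(1)] this[OF xy(2)] have "S = T"
        using Weyl_pair_scalars_determine[OF s, of S "inverse (\<chi> x)" "inverse (\<chi> y)" T] eq by simp
      then have "\<chi> w = \<psi> w" if "w \<in> carrier G" for w
        using S T that comm_scalar_unique unfolding twisted_def by blast
      then show "\<chi> = \<psi>" using chars_eqI \<chi> \<psi> by (auto simp: twists_def)
    qed
    show "(\<lambda>\<chi>. (\<chi> x, \<chi> y)) ` twists \<rho> = R \<times> R"
    proof (intro equalityI subsetI)
      fix ab assume "ab \<in> (\<lambda>\<chi>. (\<chi> x, \<chi> y)) ` twists \<rho>"
      then show "ab \<in> R \<times> R" using char_root xy by (auto simp: R_def twists_def)
    next
      fix ab assume "ab \<in> R \<times> R"
      then obtain a b where ab: "ab = (a, b)" "a ^ p = 1" "b ^ p = 1" by (auto simp: R_def)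
      obtain i j :: nat where ij: "comm_scalar (\<rho> x [^]\<^bsub>PSL p\<^esub> i \<diamondop> \<rho> y [^]\<^bsub>PSL p\<^esub> j) (\<rho> x) a"
        "comm_scalar (\<rho> x [^]\<^bsub>PSL p\<^esub> i \<diamondop> \<rho> y [^]\<^bsub>PSL p\<^esub> j) (\<rho> y) b"
        using Weyl_pair_prescribed_scalars[OF s ab(2,3)] .
      define w where "w = x [^] i \<otimes> y [^] j"
      have w: "w \<in> carrier G" using xy by (simp add: w_def)
      interpret h: group_hom G "PSL p" \<rho>
        using \<rho>r by (simp add: group_hom_def group_hom_axioms_def reps_def is_group PSL.is_group)
      have \<rho>w: "\<rho> w = \<rho> x [^]\<^bsub>PSL p\<^esub> i \<diamondop> \<rho> y [^]\<^bsub>PSL p\<^esub> j"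
        using xy by (simp add: w_def h.hom_nat_pow)
      obtain \<chi> where \<chi>: "\<chi> \<in> twists \<rho>" "twisted (\<rho> w) \<chi> \<rho>"
        using twist_of_centralizing[OF \<rho>r rep_closed[OF \<rho>r w] comm[OF w]] .
      have "\<chi> x = a" "\<chi> y = b"
        using \<chi>(2) xy ij comm_scalar_unique unfolding twisted_def \<rho>w by blast+
      then show "ab \<in> (\<lambda>\<chi>. (\<chi> x, \<chi> y)) ` twists \<rho>" using \<chi>(1) ab(1) by force
    qed
  qed
  have R: "finite R" "card R = p" unfolding R_def using p_pos by (auto simp: card_roots_unity_eq finite_roots_unity)
  then show "finite (twists \<rho>)" using bij_betw_finite[OF bij] by simp
  show "card (twists \<rho>) = p ^ 2"
    using bij_betw_same_card[OF bij] R by (simp add: card_cartesian_product power2_eq_square)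
qed

section \<open>Two independent twists\<close>

text \<open>Let \<open>S\<close>, \<open>T\<close> realize twists with different kernels. They commute up to a scalar by Schur's
  lemma, and the scalar is not 1: otherwise some \<open>\<rho> x\<close> would commute with \<open>S\<close>, hence with \<open>T\<close>
  (as \<open>S\<close> has distinct eigenvalues), although the second character is nontrivial at \<open>x\<close>.\<close>

lemma independent_twists_Weyl_pair:
  assumes \<rho>: "\<rho> \<in> irreducible_reps G p"
    and \<chi>: "\<chi> \<in> chars G p" "\<chi> \<noteq> trivial_char G" and \<psi>: "\<psi> \<in> chars G p" "\<psi> \<noteq> trivial_char G"
    and ne: "char_kernel G \<chi> \<noteq> char_kernel G \<psi>"
    and S: "twisted S \<chi> \<rho>" and T: "twisted T \<psi> \<rho>"
  obtains m where "comm_scalar S T m" "m \<noteq> 1"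
proof -
  have ST: "S \<in> carrier (PSL p)" "T \<in> carrier (PSL p)" using S T twisted_carrier by blast+
  have irr: "irreducible_subgroup p (\<rho> ` carrier G)" using \<rho> by (simp add: irreducible_reps_iff)
  define \<theta> where "\<theta> = (\<lambda>x. \<chi> x * \<psi> x)"
  have "twisted (S \<diamondop> T) \<theta> \<rho>" "twisted (T \<diamondop> S) \<theta> \<rho>"
    using S T comm_scalar_mult_left[of S _ "\<chi> _" T "\<psi> _"] comm_scalar_mult_left[of T _ "\<psi> _" S "\<chi> _"]
    unfolding twisted_def \<theta>_def by (auto simp: mult.commute)
  then have "S \<diamondop> T = T \<diamondop> S" using twisted_unique[OF \<rho>] by blast
  then obtain m where m: "comm_scalar S T m" using comm_scalar_iff_commute[OF ST] by blast
  have "m \<noteq> 1"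
  proof
    assume m1: "m = 1"
    obtain x where x: "x \<in> carrier G" "\<chi> x = 1" "\<psi> x \<noteq> 1"
      using char_kernels_differ[OF \<chi> \<psi> ne] .
    obtain y where y: "y \<in> carrier G" "\<chi> y \<noteq> 1" using nontrivial_char[OF \<chi>] .
    have "comm_scalar S (\<rho> y) (\<chi> y)" "comm_scalar S (\<rho> x) 1" "comm_scalar T (\<rho> x) (\<psi> x)"
      using S T x y unfolding twisted_def by metis+
    moreover have "comm_scalar T (\<rho> x) 1"
      using Weyl_element_centralizer_commutative[OF calculation(1) y(2) m[unfolded m1] calculation(2)] .
    ultimately show False using comm_scalar_unique x(3) by blast
  qed
  then show thesis using that m by blast
qed

text \<open>\<open>\<rho> x \<rho> y\<close> and \<open>\<rho> y \<rho> x\<close> have the same commutation scalars with the Weyl pair.\<close>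

lemma independent_twists_abelian:
  assumes \<rho>: "\<rho> \<in> irreducible_reps G p" and \<chi>: "\<chi> \<in> chars G p" and \<psi>: "\<psi> \<in> chars G p"
    and S: "twisted S \<chi> \<rho>" and T: "twisted T \<psi> \<rho>" and m: "comm_scalar S T m" "m \<noteq> 1"
  shows "\<rho> \<in> abelian_irreducible_reps G p"
proof -
  have \<rho>r: "\<rho> \<in> reps G p" using \<rho> by (simp add: irreducible_reps_iff)
  have "\<rho> x \<diamondop> \<rho> y = \<rho> y \<diamondop> \<rho> x" if xy: "x \<in> carrier G" "y \<in> carrier G" for x y
  proof -
    have "comm_scalar S (\<rho> x \<diamondop> \<rho> y) (\<chi> x * \<chi> y)" "comm_scalar S (\<rho> y \<diamondop> \<rho> x) (\<chi> y * \<chi> x)"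
      "comm_scalar T (\<rho> x \<diamondop> \<rho> y) (\<psi> x * \<psi> y)" "comm_scalar T (\<rho> y \<diamondop> \<rho> x) (\<psi> y * \<psi> x)"
      using S T xy by (auto simp: twisted_def intro!: comm_scalar_mult_right)
    then show ?thesis using Weyl_pair_scalars_determine[OF m] by (simp add: mult.commute)
  qed
  then show ?thesis using \<rho> by (simp add: abelian_irreducible_reps_iff)
qed

text \<open>Since commutation scalars with a Weyl pair determine an element of PSL and can be prescribed,
  the values of two characters define a representation. It has these characters as twists, realized
  by the standard Weyl pair with commutator \<open>m\<close>.\<close>

definition Weyl_rep :: "('a \<Rightarrow> complex) \<Rightarrow> ('a \<Rightarrow> complex) \<Rightarrow> complex \<Rightarrow> 'a \<Rightarrow> complex mat set" where
  "Weyl_rep \<chi> \<psi> m = (\<lambda>x\<in>carrier G.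
     THE U. comm_scalar (clock_bar m) U (\<chi> x) \<and> comm_scalar shift_bar U (\<psi> x))"

lemma Weyl_rep_eq:
  assumes "m ^ p = 1" "m \<noteq> 1" "x \<in> carrier G"
    "comm_scalar (clock_bar m) U (\<chi> x)" "comm_scalar shift_bar U (\<psi> x)"
  shows "Weyl_rep \<chi> \<psi> m x = U"
  unfolding Weyl_rep_def
  using assms Weyl_pair_scalars_determine[OF comm_scalar_clock_shift[OF assms(1)] assms(2)]
  by (auto intro!: the_equality)

lemma Weyl_rep_twisted:
  assumes m: "m ^ p = 1" "m \<noteq> 1" and \<chi>: "\<chi> \<in> chars G p" and \<psi>: "\<psi> \<in> chars G p"
  shows "twisted (clock_bar m) \<chi> (Weyl_rep \<chi> \<psi> m)" "twisted shift_bar \<psi> (Weyl_rep \<chi> \<psi> m)"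
proof -
  have "comm_scalar (clock_bar m) (Weyl_rep \<chi> \<psi> m x) (\<chi> x) \<and> comm_scalar shift_bar (Weyl_rep \<chi> \<psi> m x) (\<psi> x)"
    if x: "x \<in> carrier G" for x
  proof -
    have "inverse (\<chi> x) ^ p = 1" "inverse (\<psi> x) ^ p = 1"
      using char_root[OF \<chi> x] char_root[OF \<psi> x] by (auto simp: power_inverse)
    then obtain U where "comm_scalar U (clock_bar m) (inverse (\<chi> x))" "comm_scalar U shift_bar (inverse (\<psi> x))"
      using Weyl_pair_prescribed_scalars[OF comm_scalar_clock_shift[OF m(1)] m(2)] by metis
    then have U: "comm_scalar (clock_bar m) U (\<chi> x)" "comm_scalar shift_bar U (\<psi> x)"
      using comm_scalar_sym by fastforce+
    then show ?thesis using Weyl_rep_eq[OF m x, of U \<chi> \<psi>] by simp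
  qed
  then show "twisted (clock_bar m) \<chi> (Weyl_rep \<chi> \<psi> m)" "twisted shift_bar \<psi> (Weyl_rep \<chi> \<psi> m)"
    by (auto simp: twisted_def)
qed

text \<open>The image contains a Weyl pair: take \<open>x\<close> in the kernel of \<open>\<chi>\<close> only and \<open>y\<close> in the kernel
  of \<open>\<psi>\<close> only.\<close>

lemma Weyl_rep_irreducible:
  assumes m: "m ^ p = 1" "m \<noteq> 1"
    and \<chi>: "\<chi> \<in> chars G p" "\<chi> \<noteq> trivial_char G" and \<psi>: "\<psi> \<in> chars G p" "\<psi> \<noteq> trivial_char G"
    and ne: "char_kernel G \<chi> \<noteq> char_kernel G \<psi>"
  shows "Weyl_rep \<chi> \<psi> m \<in> irreducible_reps G p"
proof -
  define \<rho> where "\<rho> = Weyl_rep \<chi> \<psi> m"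
  have S: "\<And>x. x \<in> carrier G \<Longrightarrow> comm_scalar (clock_bar m) (\<rho> x) (\<chi> x)"
    and T: "\<And>x. x \<in> carrier G \<Longrightarrow> comm_scalar shift_bar (\<rho> x) (\<psi> x)"
    using Weyl_rep_twisted[OF m \<chi>(1) \<psi>(1)] by (auto simp: twisted_def \<rho>_def)
  have "\<rho> (x \<otimes> y) = \<rho> x \<diamondop> \<rho> y" if xy: "x \<in> carrier G" "y \<in> carrier G" for x y
    unfolding \<rho>_def[symmetric] using xy S T comm_scalar_mult_right[OF S S, of x y] comm_scalar_mult_right[OF T T, of x y]
    unfolding \<rho>_def by (intro Weyl_rep_eq[OF m]) (auto simp: char_mult \<chi> \<psi>)
  moreover have "\<rho> x \<in> carrier (PSL p)" if "x \<in> carrier G" for x using comm_scalar_carrier(2)[OF S[OF that]] .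
  ultimately have \<rho>r: "\<rho> \<in> reps G p" by (auto simp: reps_def hom_def \<rho>_def Weyl_rep_def)
  obtain x where x: "x \<in> carrier G" "\<chi> x = 1" "\<psi> x \<noteq> 1" using char_kernels_differ[OF \<chi> \<psi> ne] .
  obtain y where y: "y \<in> carrier G" "\<psi> y = 1" "\<chi> y \<noteq> 1" using char_kernels_differ[OF \<psi> \<chi> ne[symmetric]] .
  have "\<rho> x \<diamondop> \<rho> y = \<rho> y \<diamondop> \<rho> x"
    using Weyl_pair_scalars_determine[OF comm_scalar_clock_shift[OF m(1)] m(2)]
      comm_scalar_mult_right[OF S[OF x(1)] S[OF y(1)]] comm_scalar_mult_right[OF T[OF x(1)] T[OF y(1)]]
      comm_scalar_mult_right[OF S[OF y(1)] S[OF x(1)]] comm_scalar_mult_right[OF T[OF y(1)] T[OF x(1)]]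
    by (simp add: mult.commute)
  then obtain s where s: "comm_scalar (\<rho> x) (\<rho> y) s"
    using comm_scalar_iff_commute rep_closed[OF \<rho>r] x y by blast
  have "s \<noteq> 1"
  proof
    assume "s = 1"
    then have "comm_scalar (\<rho> y) (\<rho> x) 1" using comm_scalar_sym[OF s] by simp
    moreover have "comm_scalar (\<rho> y) shift_bar 1" using comm_scalar_sym[OF T[OF y(1)]] y(2) by simp
    ultimately have "comm_scalar shift_bar (\<rho> x) 1"
      using Weyl_element_centralizer_commutative[OF comm_scalar_sym[OF S[OF y(1)]]] y(3) by simp
    then show False using comm_scalar_unique[OF T[OF x(1)]] x(3) by simp
  qed
  then have "irreducible_subgroup p (\<rho> ` carrier G)"
    using subgroup_containing_Weyl_pair_irreducible[OF rep_image_subgroup[OF \<rho>r] _ _ s] x y by blast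
  then show ?thesis using \<rho>r by (simp add: irreducible_reps_iff \<rho>_def)
qed

text \<open>The parameter \<open>m\<close> is the commutator of the elements that realize the two twists. These elements
  are unique, so \<open>m\<close> is an invariant of the class; conversely, after a conjugation that brings
  them to the standard Weyl pair, the scalars with this pair determine the representation.\<close>

lemma classes_with_two_twists:
  assumes \<chi>: "\<chi> \<in> chars G p" "\<chi> \<noteq> trivial_char G" and \<psi>: "\<psi> \<in> chars G p" "\<psi> \<noteq> trivial_char G"
    and ne: "char_kernel G \<chi> \<noteq> char_kernel G \<psi>"
  shows "bij_betw (\<lambda>m. conj_class G p (Weyl_rep \<chi> \<psi> m)) ({m. m ^ p = 1} - {1})
    {conj_class G p \<rho> | \<rho>. \<rho> \<in> irreducible_reps G p \<and> \<chi> \<in> twists \<rho> \<and> \<psi> \<in> twists \<rho>}"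
  (is "bij_betw ?f ?M ?C")
  unfolding bij_betw_def
proof
  have irr: "Weyl_rep \<chi> \<psi> m \<in> irreducible_reps G p" "Weyl_rep \<chi> \<psi> m \<in> reps G p"
    if "m ^ p = 1" "m \<noteq> 1" for m
    using Weyl_rep_irreducible[OF that \<chi> \<psi> ne] by (auto simp: irreducible_reps_iff)
  show "inj_on ?f ?M"
  proof (rule inj_onI)
    fix m n assume "m \<in> ?M" "n \<in> ?M"
      and eq: "conj_class G p (Weyl_rep \<chi> \<psi> m) = conj_class G p (Weyl_rep \<chi> \<psi> n)"
    then have m: "m ^ p = 1" "m \<noteq> 1" and n: "n ^ p = 1" "n \<noteq> 1" by auto
    obtain g where g: "g \<in> carrier (PSL p)" "Weyl_rep \<chi> \<psi> n = conj_by g (Weyl_rep \<chi> \<psi> m)"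
      using eq conj_class_eq_iff irr(2)[OF m] irr(2)[OF n] by blast
    have "clock_bar n = conjugate g (clock_bar m)"
      "shift_bar = conjugate g shift_bar"
      using twisted_unique[OF irr(1)[OF n]] Weyl_rep_twisted[OF n \<chi>(1) \<psi>(1)]
        twisted_conj_by[OF Weyl_rep_twisted(1)[OF m \<chi>(1) \<psi>(1)] g(1)]
        twisted_conj_by[OF Weyl_rep_twisted(2)[OF m \<chi>(1) \<psi>(1)] g(1)]
      unfolding g(2)[symmetric] by blast+
    then have "comm_scalar (clock_bar n) shift_bar m"
      using comm_scalar_conj[OF comm_scalar_clock_shift[OF m(1)] g(1)] by simp
    then show "m = n" using comm_scalar_unique[OF _ comm_scalar_clock_shift[OF n(1)]] by simp
  qed
  show "?f ` ?M =
    ?C"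
  proof (intro equalityI subsetI)
    fix c assume "c \<in> ?f ` ?M"
    then obtain m where m: "m ^ p = 1" "m \<noteq> 1" "c = conj_class G p (Weyl_rep \<chi> \<psi> m)" by blast
    then show "c \<in> ?C"
      using irr(1)[OF m(1,2)] Weyl_rep_twisted[OF m(1,2) \<chi>(1) \<psi>(1)] \<chi>(1) \<psi>(1) unfolding twists_def by blast
  next
    fix c assume "c \<in> ?C"
    then obtain \<rho> S T where \<rho>: "\<rho> \<in> irreducible_reps G p" "c = conj_class G p \<rho>"
      and S: "twisted S \<chi> \<rho>" and T: "twisted T \<psi> \<rho>" unfolding twists_def by blast
    have \<rho>r: "\<rho> \<in> reps G p" using \<rho> by (simp add: irreducible_reps_iff)
    obtain m where m: "comm_scalar S T m" "m \<noteq> 1"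
      using independent_twists_Weyl_pair[OF \<rho>(1) \<chi> \<psi> ne S T] .
    have mp: "m ^ p = 1" using comm_scalar_root[OF m(1)] .
    obtain g where g: "g \<in> carrier (PSL p)" "clock_bar m = conjugate g S"
      "shift_bar = conjugate g T"
      using Weyl_pairs_conjugate[OF m(1) comm_scalar_clock_shift[OF mp] m(2)] .
    have tw: "twisted (clock_bar m) \<chi> (conj_by g \<rho>)" "twisted shift_bar \<psi> (conj_by g \<rho>)"
      using twisted_conj_by[OF S g(1)] twisted_conj_by[OF T g(1)] g by auto
    have "Weyl_rep \<chi> \<psi> m = conj_by g \<rho>"
    proof (rule extensionalityI[of _ "carrier G"])
      show "Weyl_rep \<chi> \<psi> m x = conj_by g \<rho> x" if "x \<in> carrier G" for x
        using tw that by (intro Weyl_rep_eq[OF mp m(2) that]) (auto simp: twisted_def)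
    qed (auto simp: Weyl_rep_def conj_by_def)
    then have "c = conj_class G p (Weyl_rep \<chi> \<psi> m)" using conj_class_conj_by[OF \<rho>r g(1)] \<rho>(2) by simp
    then show "c \<in> ?f ` ?M" using mp m(2) by blast
  qed
qed

end

section \<open>The number of characters\<close>

text \<open>The same construction as in \<open>ab_mod_p_space\<close>, for any group. It is a vector space as
  soon as the group is abelian of exponent \<open>p\<close>.\<close>

definition elementary_space :: "('a, 'b) monoid_scheme \<Rightarrow> (int, 'a) module" where
  "elementary_space E =
     \<lparr>carrier = carrier E, monoid.mult = undefined, one = undefined, zero = \<one>\<^bsub>E\<^esub>,
      add = (\<lambda>x y. x \<otimes>\<^bsub>E\<^esub> y), module.smult = (\<lambda>k x. x [^]\<^bsub>E\<^esub> k)\<rparr>"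

lemma ab_mod_p_space_eq: "ab_mod_p_space G p = elementary_space (ab_mod_p G p)"
  by (simp add: ab_mod_p_space_def elementary_space_def)

lemma elementary_space_simps [simp]:
  "carrier (elementary_space E) = carrier E" "\<zero>\<^bsub>elementary_space E\<^esub> = \<one>\<^bsub>E\<^esub>"
  "x \<oplus>\<^bsub>elementary_space E\<^esub> y = x \<otimes>\<^bsub>E\<^esub> y" "k \<odot>\<^bsub>elementary_space E\<^esub> x = x [^]\<^bsub>E\<^esub> k"
  by (simp_all add: elementary_space_def)

lemma residue_ring_simps:
  "carrier (residue_ring m) = {0..m - 1}" "x \<otimes>\<^bsub>residue_ring m\<^esub> y = (x * y) mod m"
  "x \<oplus>\<^bsub>residue_ring m\<^esub> y = (x + y) mod m" "\<one>\<^bsub>residue_ring m\<^esub> = 1" "\<zero>\<^bsub>residue_ring m\<^esub> = 0"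
  by (simp_all add: residue_ring_def)

locale elementary_abelian = prime_degree_root p z + comm_group E for p z and E (structure) +
  assumes exponent: "x \<in> carrier E \<Longrightarrow> x [^] p = \<one>"
begin

sublocale prime_degree_reps p z E ..

lemma int_pow_mod: "x \<in> carrier E \<Longrightarrow> x [^] (k mod int p) = x [^] (k::int)"
proof -
  assume x: "x \<in> carrier E"
  have "x [^] (int p * (k div int p)) = \<one>"
    using int_pow_pow[OF x, of "int p" "k div int p"] exponent[OF x] by (simp add: int_pow_int)
  moreover have "x [^] k = x [^] (int p * (k div int p)) \<otimes> x [^] (k mod int p)"
    using int_pow_mult[OF x, of "int p * (k div int p)" "k mod int p"] by simp
  ultimately show ?thesis using x by simp
qed

lemma elementary_vectorspace: "vectorspace (residue_ring (int p)) (elementary_space E)"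
proof (rule vs_criteria)
  show "field (residue_ring (int p))"
    using residues_prime.is_field[of p] prime by (simp add: residues_prime_def)
  show "\<forall>v\<in>carrier (elementary_space E). \<exists>w\<in>carrier (elementary_space E).
      v \<oplus>\<^bsub>elementary_space E\<^esub> w = \<zero>\<^bsub>elementary_space E\<^esub>"
    by (auto intro: bexI[of _ "inv _"] r_inv)
qed (auto simp: residue_ring_simps m_ac int_pow_mod int_pow_mult int_pow_pow int_pow_distrib mult.commute)

sublocale V: vectorspace "residue_ring (int p)" "elementary_space E"
  by (rule elementary_vectorspace)

lemma char_int_pow:
  assumes "\<psi> \<in> chars E p" "x \<in> carrier E" "k \<ge> 0"
  shows "\<psi> (x [^] (k::int)) = \<psi> x ^ nat k"
  using char_power[OF assms(1,2), of "nat k"] assms(3) int_pow_int[of E x "nat k"] by simp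

lemma char_lincomb:
  assumes \<psi>: "\<psi> \<in> chars E p" and "finite B" "B \<subseteq> carrier E" "a \<in> B \<rightarrow> {0..int p - 1}"
  shows "\<psi> (V.lincomb a B) = (\<Prod>b\<in>B. \<psi> b ^ nat (a b))"
  using assms(2-4)
proof (induction B)
  case empty
  then show ?case using char_one[OF \<psi>] by (simp add: V.lincomb_def)
next
  case (insert b B)
  have c: "V.lincomb a B \<in> carrier E"
    using V.lincomb_closed[of B a] insert by (auto simp: residue_ring_simps)
  have "V.lincomb a (B \<union> {b}) = b [^] a b \<otimes> V.lincomb a B"
    using V.lincomb_insert[of B a b] insert by (auto simp: residue_ring_simps)
  then show ?case
    using insert c \<psi> by (simp add: char_mult char_int_pow)
qed

text \<open>Restriction to a basis identifies the characters with all families of \<open>p\<close>-th roots of unity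
  indexed by the basis.\<close>

lemma card_chars_elementary:
  assumes fin: "finite S" "S \<subseteq> carrier E" "generate E S = carrier E"
  shows "finite (chars E p)" "card (chars E p) = p ^ V.dim"
proof -
  have "V.gen_set S"
  proof -
    have sub: "submodule (residue_ring (int p)) (V.span S) (elementary_space E)"
      using V.span_is_submodule fin(2) by simp
    have "subgroup (V.span S) E"
    proof (rule subgroupI)
      show "V.span S \<subseteq> carrier E" using submodule.subset[OF sub] by simp
      show "V.span S \<noteq> {}" using submodule.zero_closed[OF sub] by auto
      fix x assume x: "x \<in> V.span S"
      then have xc: "x \<in> carrier E" using submodule.subset[OF sub] by auto
      have "x [^] ((-1::int) mod int p) \<in> V.span S"
        using submodule.smult_closed[OF sub _ x, of "(-1) mod int p"] p_pos
        by (simp add: residue_ring_simps)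
      then show "inv x \<in> V.span S"
        using int_pow_mod[OF xc, of "-1"] int_pow_neg[OF xc, of 1] xc by simp
    next
      fix x y assume "x \<in> V.span S" "y \<in> V.span S"
      then show "x \<otimes> y \<in> V.span S" using submodule.m_closed[OF sub] by simp
    qed
    moreover have "S \<subseteq> V.span S" using V.in_own_span fin(2) by simp
    ultimately have "generate E S \<subseteq> V.span S" by (intro generate_subgroup_incl)
    then show ?thesis using fin(3) submodule.subset[OF sub] by auto
  qed
  then have "V.fin_dim" using fin unfolding V.fin_dim_def by auto
  then obtain B where B: "finite B" "V.basis B" using V.finite_basis_exists by blast
  have Bc: "B \<subseteq> carrier E" using B(2) by (simp add: V.basis_def)
  define F where "F = {0..int p - 1}"
  have coord: "\<exists>!a. a \<in> B \<rightarrow>\<^sub>E F \<and> V.lincomb a B = v" if "v \<in> carrier E" for v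
    using V.basis_criterion[OF B(1)] Bc B(2) that by (simp add: residue_ring_simps F_def)
  define co where "co v = (THE a. a \<in> B \<rightarrow>\<^sub>E F \<and> V.lincomb a B = v)" for v
  have co: "co v \<in> B \<rightarrow>\<^sub>E F" "V.lincomb (co v) B = v" if "v \<in> carrier E" for v
    using theI'[OF coord[OF that]] by (auto simp: co_def)
  have co_eq: "co v = a" if "v \<in> carrier E" "a \<in> B \<rightarrow>\<^sub>E F" "V.lincomb a B = v" for v a
    using coord[OF that(1)] co[OF that(1)] that by blast
  have co_F: "co v b \<in> F" if "v \<in> carrier E" "b \<in> B" for v b
    using co(1)[OF that(1)] that(2) by (rule PiE_mem)
  define R where "R = {s::complex. s ^ p = 1}"
  have bij: "bij_betw (\<lambda>\<psi>. restrict \<psi> B) (chars E p) (B \<rightarrow>\<^sub>E R)"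
    unfolding bij_betw_def
  proof
    show "inj_on (\<lambda>\<psi>. restrict \<psi> B) (chars E p)"
    proof (rule inj_onI)
      fix \<psi> \<theta> assume \<psi>: "\<psi> \<in> chars E p" and \<theta>: "\<theta> \<in> chars E p" and eq: "restrict \<psi> B = restrict \<theta> B"
      have eqB: "\<psi> b = \<theta> b" if "b \<in> B" for b using fun_cong[OF eq, of b] that by simp
      show "\<psi> = \<theta>"
      proof (rule chars_eqI[OF \<psi> \<theta>])
        fix v assume v: "v \<in> carrier E"
        have "co v \<in> B \<rightarrow> {0..int p - 1}" using co(1)[OF v] by (auto simp: F_def)
        then have "\<psi> (V.lincomb (co v) B) = \<theta> (V.lincomb (co v) B)"
          using char_lincomb[OF \<psi> B(1) Bc] char_lincomb[OF \<theta> B(1) Bc] eqB by simp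
        then show "\<psi> v = \<theta> v" using co(2)[OF v] by simp
      qed
    qed
    show "(\<lambda>\<psi>. restrict \<psi> B) ` chars E p = B \<rightarrow>\<^sub>E R"
    proof (intro equalityI subsetI)
      fix f assume "f \<in> (\<lambda>\<psi>. restrict \<psi> B) ` chars E p"
      then show "f \<in> B \<rightarrow>\<^sub>E R" using char_root Bc by (auto simp: R_def)
    next
      fix f assume f: "f \<in> B \<rightarrow>\<^sub>E R"
      have fp: "f b ^ p = 1" if "b \<in> B" for b using PiE_mem[OF f that] by (simp add: R_def)
      have f_mod: "f b ^ nat ((i + j) mod int p) = f b ^ nat i * f b ^ nat j"
        if "b \<in> B" "i \<in> F" "j \<in> F" for b i j
      proof -
        have ij: "i \<ge> 0" "j \<ge> 0" using that by (auto simp: F_def)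
        have "nat ((i + j) mod int p) = (nat i + nat j) mod p"
          using ij by (simp add: nat_mod_distrib nat_add_distrib)
        moreover have "f b ^ k = f b ^ (k mod p)" for k
        proof -
          have "f b ^ k = f b ^ (p * (k div p) + k mod p)" by simp
          also have "\<dots> = (f b ^ p) ^ (k div p) * f b ^ (k mod p)" by (simp only: power_add power_mult)
          finally show ?thesis using fp[OF that(1)] by simp
        qed
        ultimately show ?thesis by (metis power_add)
      qed
      define \<psi> where "\<psi> = (\<lambda>v\<in>carrier E. \<Prod>b\<in>B. f b ^ nat (co v b))"
      have "\<psi> (v \<otimes> w) = \<psi> v * \<psi> w" if v: "v \<in> carrier E" and w: "w \<in> carrier E" for v w
      proof -
        have "V.lincomb (\<lambda>b. co v b \<oplus>\<^bsub>residue_ring (int p)\<^esub> co w b) B = v \<otimes> w"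
          using V.lincomb_sum[OF B(1), of "co v" "co w"] Bc co[OF v] co[OF w]
          by (auto simp: residue_ring_simps F_def PiE_iff)
        moreover have "V.lincomb (\<lambda>b\<in>B. (co v b + co w b) mod int p) B =
            V.lincomb (\<lambda>b. co v b \<oplus>\<^bsub>residue_ring (int p)\<^esub> co w b) B"
          by (rule V.lincomb_cong) (use Bc p_pos in \<open>auto simp: residue_ring_simps\<close>)
        ultimately have "co (v \<otimes> w) = (\<lambda>b\<in>B. (co v b + co w b) mod int p)"
          using v w p_pos by (intro co_eq) (auto simp: F_def)
        then have "\<psi> (v \<otimes> w) = (\<Prod>b\<in>B. f b ^ nat ((co v b + co w b) mod int p))"
          using v w by (simp add: \<psi>_def)
        also have "\<dots> = (\<Prod>b\<in>B. f b ^ nat (co v b) * f b ^ nat (co w b))"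
          by (rule prod.cong[OF refl], rule f_mod) (use co_F v w in auto)
        also have "\<dots> = \<psi> v * \<psi> w" using v w by (simp add: \<psi>_def prod.distrib)
        finally show ?thesis .
      qed
      moreover have "\<psi> v ^ p = 1" if v: "v \<in> carrier E" for v
      proof -
        have "(f b ^ k) ^ p = 1" if "b \<in> B" for b k
        proof -
          have "(f b ^ k) ^ p = (f b ^ p) ^ k" by (simp only: power_mult[symmetric] mult.commute)
          then show ?thesis using fp[OF that] by simp
        qed
        then show ?thesis using v by (simp add: \<psi>_def prod_power_distrib)
      qed
      ultimately have \<psi>: "\<psi> \<in> chars E p" by (auto simp: chars_iff \<psi>_def)
      have "\<psi> b = f b" if b: "b \<in> B" for b
      proof -
        have bc: "b \<in> carrier E" using b Bc by auto
        define e where "e = (\<lambda>c\<in>B. if c = b then 1 else (0::int))"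
        have eF: "e \<in> B \<rightarrow>\<^sub>E F" using p_gt_1 by (auto simp: e_def F_def)
        have "V.lincomb e B = b [^] e b \<otimes> V.lincomb e (B - {b})"
          using V.lincomb_del2[OF B(1), of e b] Bc eF b by (auto simp: residue_ring_simps F_def PiE_iff)
        moreover have "V.lincomb e (B - {b}) = \<one>"
        proof -
          have "V.lincomb e (B - {b}) = V.lincomb (\<lambda>_. 0) (B - {b})"
            by (rule V.lincomb_cong) (use Bc p_pos in \<open>auto simp: e_def residue_ring_simps\<close>)
          also have "\<dots> = \<one>"
          proof -
            have "finsum (elementary_space E) (\<lambda>v. \<one>) (B - {b}) = \<one>"
              using V.M.add.finprod_one_eqI[of "B - {b}" "\<lambda>_. \<one>"] by simp
            then show ?thesis by (simp add: V.lincomb_def)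
          qed
          finally show ?thesis .
        qed
        ultimately have "V.lincomb e B = b" using bc b by (simp add: e_def)
        then have "co b = e" using co_eq[OF bc eF] by simp
        then have "\<psi> b = (\<Prod>c\<in>B. if c = b then f c else 1)"
          using bc by (auto simp: \<psi>_def e_def intro!: prod.cong)
        then show ?thesis using B(1) b by simp
      qed
      then have "restrict \<psi> B = f" using f by (intro PiE_ext[of _ B "\<lambda>_. UNIV"]) auto
      then show "f \<in> (\<lambda>\<psi>. restrict \<psi> B) ` chars E p" using \<psi> by blast
    qed
  qed
  have R: "finite R" "card R = p" unfolding R_def using p_pos by (auto simp: card_roots_unity_eq finite_roots_unity)
  have dim: "V.dim = card B" using V.dim_basis[OF B] .
  show "finite (chars E p)" using bij_betw_finite[OF bij] R(1) B(1) by (simp add: finite_PiE)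
  show "card (chars E p) = p ^ V.dim"
    using bij_betw_same_card[OF bij] R B(1) dim by (simp add: card_PiE)
qed

end

context prime_degree_reps
begin

text \<open>The characters have values in an abelian group of exponent \<open>p\<close>, so they kill commutators and
  \<open>p\<close>-th powers. This lemma transports the count from the quotient by these to \<open>G\<close>.\<close>

lemma chars_quotient_bij:
  assumes N: "N \<lhd> G" and kill: "\<And>\<chi> n. \<chi> \<in> chars G p \<Longrightarrow> n \<in> N \<Longrightarrow> \<chi> n = 1"
  shows "bij_betw (\<lambda>\<psi>. \<lambda>x\<in>carrier G. \<psi> (N #> x)) (chars (G Mod N) p) (chars G p)"
    (is "bij_betw ?f _ _")
proof -
  have q: "(\<lambda>x. N #> x) \<in> hom G (G Mod N)" using normal.r_coset_hom_Mod[OF N] .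
  interpret Q: group "G Mod N" using normal.factorgroup_is_group[OF N] .
  have carrier: "carrier (G Mod N) = (\<lambda>x. N #> x) ` carrier G" by (rule carrier_FactGroup)
  show ?thesis
    unfolding bij_betw_def
  proof
    show "inj_on ?f (chars (G Mod N) p)"
    proof (rule inj_onI)
      fix \<psi> \<theta> assume \<psi>: "\<psi> \<in> chars (G Mod N) p" and \<theta>: "\<theta> \<in> chars (G Mod N) p"
        and eq: "(\<lambda>x\<in>carrier G. \<psi> (N #> x)) = (\<lambda>x\<in>carrier G. \<theta> (N #> x))"
      have "\<psi> (N #> x) = \<theta> (N #> x)" if "x \<in> carrier G" for x using fun_cong[OF eq, of x] that by simp
      then show "\<psi> = \<theta>" using \<psi> \<theta> carrier
        by (intro extensionalityI[of _ "carrier (G Mod N)"]) (auto simp: chars_def)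
    qed
    show "?f ` chars (G Mod N) p = chars G p"
    proof (intro equalityI subsetI)
      fix \<chi> assume "\<chi> \<in> ?f ` chars (G Mod N) p"
      then obtain \<psi> where \<psi>: "\<psi> \<in> chars (G Mod N) p" "\<chi> = (\<lambda>x\<in>carrier G. \<psi> (N #> x))" by blast
      have "\<psi> (N #> (x \<otimes> y)) = \<psi> (N #> x) * \<psi> (N #> y)" if "x \<in> carrier G" "y \<in> carrier G" for x y
      proof -
        have "N #> (x \<otimes> y) = (N #> x) \<otimes>\<^bsub>G Mod N\<^esub> (N #> y)" using hom_mult[OF q that] .
        then show ?thesis using \<psi>(1) that carrier unfolding chars_iff by (metis image_eqI)
      qed
      moreover have "\<psi> (N #> x) ^ p = 1" if "x \<in> carrier G" for x
        using \<psi>(1) that carrier unfolding chars_iff by (metis image_eqI)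
      ultimately show "\<chi> \<in> chars G p" by (auto simp: \<psi>(2) chars_iff)
    next
      fix \<chi> assume \<chi>: "\<chi> \<in> chars G p"
      interpret h: group_hom G "roots_of_unity_group p" \<chi> using char_group_hom[OF \<chi>] .
      have "N \<subseteq> kernel G (roots_of_unity_group p) \<chi>"
        using kill[OF \<chi>] normal_imp_subgroup[OF N] subgroup.subset
        by (fastforce simp: kernel_def roots_of_unity_group_def)
      then obtain g where g: "g \<in> hom (G Mod N) (roots_of_unity_group p)"
        "\<And>x. x \<in> carrier G \<Longrightarrow> g (N #> x) = \<chi> x"
        using h.FactGroup_universal_kernel[OF N] by blast
      have "restrict g (carrier (G Mod N)) \<in> chars (G Mod N) p"
        using g(1) Q.m_closed by (auto simp: chars_def hom_def)
      moreover have "\<chi> = (\<lambda>x\<in>carrier G. restrict g (carrier (G Mod N)) (N #> x))"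
        using \<chi> g(2) carrier by (intro extensionalityI[of _ "carrier G"]) (auto simp: chars_def)
      ultimately show "\<chi> \<in> ?f ` chars (G Mod N) p" by blast
    qed
  qed
qed

lemma quotient_generated:
  assumes N: "N \<lhd> G" and S: "finite S" "S \<subseteq> carrier G" "generate G S = carrier G"
  shows "finite ((\<lambda>x. N #> x) ` S)" "(\<lambda>x. N #> x) ` S \<subseteq> carrier (G Mod N)"
    "generate (G Mod N) ((\<lambda>x. N #> x) ` S) = carrier (G Mod N)"
proof -
  interpret h: group_hom G "G Mod N" "\<lambda>x. N #> x"
    using normal.r_coset_hom_Mod[OF N] normal.factorgroup_is_group[OF N]
    by (simp add: group_hom_def group_hom_axioms_def is_group)
  show "finite ((\<lambda>x. N #> x) ` S)" using S by simp
  show "(\<lambda>x. N #> x) ` S \<subseteq> carrier (G Mod N)" using S by (auto simp: carrier_FactGroup)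
  show "generate (G Mod N) ((\<lambda>x. N #> x) ` S) = carrier (G Mod N)"
    using h.generate_img[OF S(2)] S(3) by (simp add: carrier_FactGroup)
qed

lemma card_chars:
  assumes "finitely_generated G"
  shows "finite (chars G p)" "card (chars G p) = p ^ p_rank G p"
proof -
  obtain S where S: "finite S" "S \<subseteq> carrier G" "generate G S = carrier G"
    using assms unfolding finitely_generated_def by blast
  define N where "N = derived G (carrier G)"
  have N: "N \<lhd> G" unfolding N_def using derived_is_normal[OF normal_self] .
  have A: "abelianization G = G Mod N" by (simp add: abelianization_def N_def)
  interpret A: comm_group "G Mod N" unfolding N_def by (rule derived_quot_is_comm_group)
  interpret A: prime_degree_reps p z "G Mod N" ..
  define M where "M = (\<lambda>x. x [^]\<^bsub>G Mod N\<^esub> p) ` carrier (G Mod N)"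
  have Mhom: "group_hom (G Mod N) (G Mod N) (\<lambda>x. x [^]\<^bsub>G Mod N\<^esub> p)"
    unfolding group_hom_def group_hom_axioms_def
    using A.is_group A.nat_pow_distrib by (auto intro!: homI simp del: mult_FactGroup)
  have Msub: "subgroup M (G Mod N)" unfolding M_def using group_hom.img_is_subgroup[OF Mhom] .
  have M: "M \<lhd> (G Mod N)" using A.subgroup_imp_normal[OF Msub] .
  have E: "ab_mod_p G p = G Mod N Mod M" by (simp add: ab_mod_p_def A M_def)
  interpret E: comm_group "G Mod N Mod M" by (rule A.abelian_FactGroup[OF Msub])
  interpret E: elementary_abelian p z "G Mod N Mod M"
  proof
    fix x assume "x \<in> carrier (G Mod N Mod M)"
    then obtain y where y: "y \<in> carrier (G Mod N)" "x = M #>\<^bsub>G Mod N\<^esub> y" by (auto simp: carrier_FactGroup)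
    have "x [^]\<^bsub>G Mod N Mod M\<^esub> p = M #>\<^bsub>G Mod N\<^esub> (y [^]\<^bsub>G Mod N\<^esub> p)"
      unfolding y(2) by (rule normal.FactGroup_pow[OF M y(1)])
    also have "\<dots> = M" using y(1) A.coset_join2[OF _ Msub] by (simp add: M_def)
    finally show "x [^]\<^bsub>G Mod N Mod M\<^esub> p = \<one>\<^bsub>G Mod N Mod M\<^esub>" by simp
  qed
  have killN: "\<chi> n = 1" if \<chi>: "\<chi> \<in> chars G p" and n: "n \<in> N" for \<chi> n
  proof -
    have "char_kernel G \<chi> \<lhd> G"
    proof -
      interpret h: group_hom G "roots_of_unity_group p" \<chi> using char_group_hom[OF \<chi>] .
      have "kernel G (roots_of_unity_group p) \<chi> = char_kernel G \<chi>"
        by (auto simp: kernel_def char_kernel_def roots_of_unity_group_def)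
      then show ?thesis using h.normal_kernel by simp
    qed
    moreover have "derived_set G (carrier G) \<subseteq> char_kernel G \<chi>"
      using \<chi> char_nonzero[OF \<chi>] by (auto simp: char_kernel_def char_mult char_inv field_simps)
    ultimately have "N \<subseteq> char_kernel G \<chi>"
      unfolding N_def derived_def using generate_subgroup_incl normal_imp_subgroup by blast
    then show ?thesis using n by (auto simp: char_kernel_def)
  qed
  have b1: "bij_betw (\<lambda>\<psi>. \<lambda>x\<in>carrier G. \<psi> (N #> x)) (chars (G Mod N) p) (chars G p)"
    by (rule chars_quotient_bij[OF N]) (rule killN)
  have killM: "\<chi> n = 1" if \<chi>: "\<chi> \<in> chars (G Mod N) p" and n: "n \<in> M" for \<chi> n
    using n A.char_power[OF \<chi>] A.char_root[OF \<chi>] by (auto simp: M_def)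
  have b2: "bij_betw (\<lambda>\<psi>. \<lambda>x\<in>carrier (G Mod N). \<psi> (M #>\<^bsub>G Mod N\<^esub> x)) (chars (G Mod N Mod M) p) (chars (G Mod N) p)"
    by (rule A.chars_quotient_bij[OF M]) (rule killM)
  have fin: "finite (chars (G Mod N Mod M) p)"
    "card (chars (G Mod N Mod M) p) = p ^ vectorspace.dim (residue_ring (int p)) (elementary_space (G Mod N Mod M))"
    using E.card_chars_elementary A.quotient_generated[OF M quotient_generated[OF N S]] by auto
  show "finite (chars G p)" using fin(1) bij_betw_finite[OF b1] bij_betw_finite[OF b2] by blast
  show "card (chars G p) = p ^ p_rank G p"
    using fin(2) bij_betw_same_card[OF b1] bij_betw_same_card[OF b2]
    by (simp add: p_rank_def ab_mod_p_space_eq E)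
qed

end

section \<open>Counting\<close>

context prime_degree_reps
begin

lemma level_char_of_index_p:
  assumes "K \<in> normal_of_index G p" "\<phi> \<in> hom G (PSL p\<lparr>carrier := C_bar p\<rparr>)"
    "kernel G (PSL p\<lparr>carrier := C_bar p\<rparr>) \<phi> = K"
  shows "level_char \<phi> \<in> chars G p \<and> level_char \<phi> \<noteq> trivial_char G \<and> char_kernel G (level_char \<phi>) = K"
proof -
  have ker: "char_kernel G (level_char \<phi>) = K" using level_char(3)[OF assms(2)] assms(3) by simp
  have "level_char \<phi> \<noteq> trivial_char G"
  proof
    assume "level_char \<phi> = trivial_char G"
    then have "K = carrier G" using ker by (auto simp: char_kernel_def trivial_char_def)
    then have "rcosets K = {carrier G}"
      using coset_join2[OF _ subgroup_self] one_closed by (auto simp: RCOSETS_def)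
    then have "card (rcosets K) = 1" by simp
    then show False using assms(1) p_gt_1 by (simp add: normal_of_index_def)
  qed
  then show ?thesis using level_char(2)[OF assms(2)] ker by blast
qed

text \<open>Everything is read off from the twists. The cardinalities are stated without division, as
  they come out of the counts.\<close>

lemma pseudo_components:
  fixes \<phi> :: "'a set \<Rightarrow> 'a \<Rightarrow> complex mat set"
  assumes fg: "finitely_generated G"
    and \<phi>: "\<And>K. K \<in> normal_of_index G p \<Longrightarrow> \<phi> K \<in> hom G (PSL p\<lparr>carrier := C_bar p\<rparr>) \<and>
      kernel G (PSL p\<lparr>carrier := C_bar p\<rparr>) (\<phi> K) = K"
  defines "\<N> \<equiv> normal_of_index G p"
    and "\<P> \<equiv> \<lambda>K. pseudo_component G p (\<phi> K)"
  shows "chi_sing G p = (\<Union>K\<in>\<N>. \<P> K)"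
    and "finite \<N>" and "card \<N> * (p - 1) = p ^ p_rank G p - 1"
    and "\<And>K K'. K \<in> \<N> \<Longrightarrow> K' \<in> \<N> \<Longrightarrow> K \<noteq> K' \<Longrightarrow> finite (\<P> K \<inter> \<P> K')"
    and "\<And>K K'. K \<in> \<N> \<Longrightarrow> K' \<in> \<N> \<Longrightarrow> K \<noteq> K' \<Longrightarrow> card (\<P> K \<inter> \<P> K') = p - 1"
    and "\<And>K K'. K \<in> \<N> \<Longrightarrow> K' \<in> \<N> \<Longrightarrow> K \<noteq> K' \<Longrightarrow> \<P> K \<inter> \<P> K' \<subseteq> chi_abelian G p"
    and "\<And>c. c \<in> chi_abelian G p \<Longrightarrow> card {K \<in> \<N>. c \<in> \<P> K} = p + 1"
    and "finite (chi_abelian G p)"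
    and "card (chi_abelian G p) * ((p + 1) * p) = card \<N> * (card \<N> - 1) * (p - 1)"
proof -
  define \<kappa> where "\<kappa> K = level_char (\<phi> K)" for K
  have \<kappa>: "\<kappa> K \<in> chars G p \<and> \<kappa> K \<noteq> trivial_char G \<and> char_kernel G (\<kappa> K) = K" if "K \<in> normal_of_index G p" for K
    unfolding \<kappa>_def using level_char_of_index_p[OF that] \<phi>[OF that] by blast
  have PC: "conj_class G p \<rho> \<in> \<P> K \<longleftrightarrow> \<kappa> K \<in> twists \<rho>"
    if "K \<in> \<N>" "\<rho> \<in> irreducible_reps G p" for K \<rho>
    unfolding \<P>_def \<kappa>_def using that \<phi> \<kappa> pseudo_component_iff by (simp add: \<N>_def \<kappa>_def)
  have PC_irr: "\<exists>\<rho>. \<rho> \<in> irreducible_reps G p \<and> c = conj_class G p \<rho>" if "c \<in> \<P> K" for c K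
    using that unfolding \<P>_def pseudo_component_def by blast
  note fin = card_chars[OF fg]
  show N: "finite \<N>" "card \<N> * (p - 1) = p ^ p_rank G p - 1"
  proof -
    have "{K \<in> normal_of_index G p. \<kappa> K \<in> chars G p} = \<N>" using \<kappa> by (auto simp: \<N>_def)
    then show "finite \<N>" "card \<N> * (p - 1) = p ^ p_rank G p - 1"
      using card_index_p_subgroups[of \<kappa> "chars G p"] \<kappa> fin trivial_char_in_chars char_pow_in_chars by auto
  qed
  show "chi_sing G p = (\<Union>K\<in>\<N>. \<P> K)"
  proof (intro equalityI subsetI)
    fix c assume "c \<in> chi_sing G p"
    then obtain \<rho> where \<rho>: "\<rho> \<in> bad_reps G p" "c = conj_class G p \<rho>" by (auto simp: chi_sing_def)
    then obtain \<chi> where \<chi>: "\<rho> \<in> irreducible_reps G p" "\<chi> \<in> twists \<rho>" "\<chi> \<noteq> trivial_char G"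
      by (auto simp: bad_reps_iff)
    then have \<chi>c: "\<chi> \<in> chars G p" by (simp add: twists_def)
    define K where "K = char_kernel G \<chi>"
    have K: "K \<in> \<N>" unfolding K_def \<N>_def by (rule char_kernel_index[OF \<chi>c \<chi>(3)])
    then obtain k where "\<kappa> K = char_pow G \<chi> k"
      using char_kernel_subset_power[OF \<chi>c \<chi>(3), of "\<kappa> K"] \<kappa>[of K] by (auto simp: K_def \<N>_def)
    then have "\<kappa> K \<in> twists \<rho>" using twists_pow[OF \<chi>(2)] by simp
    then show "c \<in> (\<Union>K\<in>\<N>. \<P> K)" using PC[OF K \<chi>(1)] K \<rho>(2) by blast
  next
    fix c assume "c \<in> (\<Union>K\<in>\<N>. \<P> K)"
    then obtain K \<rho> where K: "K \<in> \<N>" "c \<in> \<P> K" and \<rho>: "\<rho> \<in> irreducible_reps G p" "c = conj_class G p \<rho>"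
      using PC_irr by blast
    then have "\<kappa> K \<in> twists \<rho>" using PC by blast
    then have "\<rho> \<in> bad_reps G p" using \<rho> \<kappa> K(1) by (auto simp: bad_reps_iff \<N>_def)
    then show "c \<in> chi_sing G p" using \<rho> by (auto simp: chi_sing_def chi_irr_def)
  qed
  have inter: "finite (\<P> K \<inter> \<P> K') \<and> card (\<P> K \<inter> \<P> K') = p - 1 \<and> \<P> K \<inter> \<P> K' \<subseteq> chi_abelian G p"
    if K: "K \<in> \<N>" "K' \<in> \<N>" "K \<noteq> K'" for K K'
  proof -
    have kk: "\<kappa> K \<in> chars G p" "\<kappa> K \<noteq> trivial_char G" "\<kappa> K' \<in> chars G p" "\<kappa> K' \<noteq> trivial_char G"
      "char_kernel G (\<kappa> K) \<noteq> char_kernel G (\<kappa> K')" using \<kappa> K by (auto simp: \<N>_def)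
    have I: "\<P> K \<inter> \<P> K' =
        {conj_class G p \<rho> | \<rho>. \<rho> \<in> irreducible_reps G p \<and> \<kappa> K \<in> twists \<rho> \<and> \<kappa> K' \<in> twists \<rho>}"
      using PC[OF K(1)] PC[OF K(2)] PC_irr by blast
    have bij: "bij_betw (\<lambda>m. conj_class G p (Weyl_rep (\<kappa> K) (\<kappa> K') m)) ({m. m ^ p = 1} - {1}) (\<P> K \<inter> \<P> K')"
      unfolding I by (rule classes_with_two_twists[OF kk])
    have roots: "finite {m::complex. m ^ p = 1}" "card {m::complex. m ^ p = 1} = p"
      using p_pos by (auto simp: card_roots_unity_eq finite_roots_unity)
    have "conj_class G p \<rho> \<in> chi_abelian G p"
      if \<rho>: "\<rho> \<in> irreducible_reps G p" "\<kappa> K \<in> twists \<rho>" "\<kappa> K' \<in> twists \<rho>" for \<rho>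
    proof -
      obtain S T where ST: "twisted S (\<kappa> K) \<rho>" "twisted T (\<kappa> K') \<rho>"
        using \<rho>(2,3) unfolding twists_def by blast
      obtain m where "comm_scalar S T m" "m \<noteq> 1"
        using independent_twists_Weyl_pair[OF \<rho>(1) kk ST] .
      then have "\<rho> \<in> abelian_irreducible_reps G p"
        using independent_twists_abelian[OF \<rho>(1) kk(1,3) ST] by blast
      then show ?thesis by (simp add: chi_abelian_def)
    qed
    then have "\<P> K \<inter> \<P> K' \<subseteq> chi_abelian G p" unfolding I by blast
    moreover have "finite (\<P> K \<inter> \<P> K')" using bij_betw_finite[OF bij] roots(1) by simp
    moreover have "card (\<P> K \<inter> \<P> K') = p - 1"
      using bij_betw_same_card[OF bij] roots by (simp add: p_pos)
    ultimately show ?thesis by blast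
  qed
  then show "\<And>K K'. K \<in> \<N> \<Longrightarrow> K' \<in> \<N> \<Longrightarrow> K \<noteq> K' \<Longrightarrow> finite (\<P> K \<inter> \<P> K')"
    "\<And>K K'. K \<in> \<N> \<Longrightarrow> K' \<in> \<N> \<Longrightarrow> K \<noteq> K' \<Longrightarrow> card (\<P> K \<inter> \<P> K') = p - 1"
    "\<And>K K'. K \<in> \<N> \<Longrightarrow> K' \<in> \<N> \<Longrightarrow> K \<noteq> K' \<Longrightarrow> \<P> K \<inter> \<P> K' \<subseteq> chi_abelian G p" by blast+
  have count: "card {K \<in> \<N>. c \<in> \<P> K} = p + 1" if c: "c \<in> chi_abelian G p" for c
  proof -
    obtain \<rho> where \<rho>: "\<rho> \<in> abelian_irreducible_reps G p" "c = conj_class G p \<rho>"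
      using c by (auto simp: chi_abelian_def)
    then have \<rho>i: "\<rho> \<in> irreducible_reps G p" "\<rho> \<in> reps G p"
      by (auto simp: abelian_irreducible_reps_iff irreducible_reps_iff)
    have eq: "{K \<in> \<N>. c \<in> \<P> K} = {K \<in> normal_of_index G p. \<kappa> K \<in> twists \<rho>}"
      using PC[OF _ \<rho>i(1)] \<rho>(2) by (auto simp: \<N>_def)
    have "card {K \<in> \<N>. c \<in> \<P> K} * (p - 1) = p ^ 2 - 1"
    proof -
      have "twists \<rho> \<subseteq> chars G p" by (auto simp: twists_def)
      from card_index_p_subgroups(2)[OF \<kappa> this card_twists_abelian(1)[OF \<rho>(1)] trivial_twist[OF \<rho>i(2)] twists_pow]
      show ?thesis unfolding eq card_twists_abelian(2)[OF \<rho>(1)] .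
    qed
    also have "p ^ 2 - 1 = (p + 1) * (p - 1)" by (cases p) (auto simp: power2_eq_square)
    finally show ?thesis using p_gt_1 mult_right_cancel[of "p - 1"] by (metis less_numeral_extra(3) zero_less_diff)
  qed
  then show "\<And>c. c \<in> chi_abelian G p \<Longrightarrow> card {K \<in> \<N>. c \<in> \<P> K} = p + 1" .
  \<comment> \<open>Double counting: an abelian class lies in \<open>(p + 1) p\<close> ordered pairs of distinct
    pseudo-components, and each such pair has \<open>p - 1\<close> common classes, all of them abelian.\<close>
  define Q where "Q = {(K, K'). K \<in> \<N> \<and> K' \<in> \<N> \<and> K \<noteq> K'}"
  have off: "card {(K, K'). K \<in> A \<and> K' \<in> A \<and> K \<noteq> K'} = card A * (card A - 1)"
    if "finite A" for A :: "'a set set"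
  proof -
    have "{(K, K'). K \<in> A \<and> K' \<in> A \<and> K \<noteq> K'} = (SIGMA K:A. A - {K})" by auto
    then show ?thesis using that by (simp add: card_SigmaI)
  qed
  have Qfin: "finite Q" by (rule finite_subset[of _ "\<N> \<times> \<N>"]) (use N in \<open>auto simp: Q_def\<close>)
  have cover: "\<exists>q\<in>Q. c \<in> \<P> (fst q) \<inter> \<P> (snd q)" if c: "c \<in> chi_abelian G p" for c
  proof -
    have "\<not> card {K \<in> \<N>. c \<in> \<P> K} \<le> Suc 0" using count[OF c] p_gt_1 by simp
    then obtain K K' where "K \<in> {K \<in> \<N>. c \<in> \<P> K}" "K' \<in> {K \<in> \<N>. c \<in> \<P> K}" "K \<noteq> K'"
      using card_le_Suc0_iff_eq[of "{K \<in> \<N>. c \<in> \<P> K}"] N(1) by auto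
    then show ?thesis by (intro bexI[of _ "(K, K')"]) (auto simp: Q_def)
  qed
  have "chi_abelian G p \<subseteq> (\<Union>q\<in>Q. \<P> (fst q) \<inter> \<P> (snd q))" using cover by blast
  moreover have "finite (\<Union>q\<in>Q. \<P> (fst q) \<inter> \<P> (snd q))" using Qfin inter by (auto simp: Q_def)
  ultimately show abfin: "finite (chi_abelian G p)" by (rule finite_subset)
  have "(\<Sum>c\<in>chi_abelian G p. card {q \<in> Q. c \<in> \<P> (fst q) \<inter> \<P> (snd q)}) = (\<Sum>q\<in>Q. p - 1)"
  proof (rule sum_multicount_gen[OF abfin Qfin], rule ballI)
    fix q assume "q \<in> Q"
    then obtain K K' where q: "q = (K, K')" "K \<in> \<N>" "K' \<in> \<N>" "K \<noteq> K'" by (auto simp: Q_def)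
    then have "{c \<in> chi_abelian G p. c \<in> \<P> (fst q) \<inter> \<P> (snd q)} = \<P> K \<inter> \<P> K'" using inter by auto
    then show "card {c \<in> chi_abelian G p. c \<in> \<P> (fst q) \<inter> \<P> (snd q)} = p - 1" using inter q by simp
  qed
  moreover have "card {q \<in> Q. c \<in> \<P> (fst q) \<inter> \<P> (snd q)} = (p + 1) * p" if c: "c \<in> chi_abelian G p" for c
  proof -
    have "{q \<in> Q. c \<in> \<P> (fst q) \<inter> \<P> (snd q)} =
      {(K, K'). K \<in> {K \<in> \<N>. c \<in> \<P> K} \<and> K' \<in> {K \<in> \<N>. c \<in> \<P> K} \<and> K \<noteq> K'}" by (auto simp: Q_def)
    then show ?thesis using off[of "{K \<in> \<N>. c \<in> \<P> K}"] N(1) count[OF c] by simp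
  qed
  moreover have "card Q = card \<N> * (card \<N> - 1)" unfolding Q_def by (rule off[OF N(1)])
  ultimately show "card (chi_abelian G p) * ((p + 1) * p) = card \<N> * (card \<N> - 1) * (p - 1)" by simp
qed

end

theorem theorem3:
  fixes G :: "('a, 'b) monoid_scheme"
    and p r :: nat
    and \<rho>bar :: "'a set \<Rightarrow> 'a \<Rightarrow> complex mat set"
  assumes "group G"
    and "finitely_generated G"
    and "prime p"
    and "r = p_rank G p"
    and "\<forall>K\<in>normal_of_index G p.
           \<rho>bar K \<in> hom G (PSL p\<lparr>carrier := C_bar p\<rparr>) \<and>
           kernel G (PSL p\<lparr>carrier := C_bar p\<rparr>) (\<rho>bar K) = K"
  shows
    "(chi_sing G p = (\<Union>K\<in>normal_of_index G p. pseudo_component G p (\<rho>bar K)) \<and>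
      finite (normal_of_index G p) \<and>
      real (card (normal_of_index G p)) = (real p ^ r - 1) / (real p - 1)) \<and>
     (\<forall>K\<in>normal_of_index G p. \<forall>K'\<in>normal_of_index G p. K \<noteq> K' \<longrightarrow>
        finite (pseudo_component G p (\<rho>bar K) \<inter> pseudo_component G p (\<rho>bar K')) \<and>
        card (pseudo_component G p (\<rho>bar K) \<inter> pseudo_component G p (\<rho>bar K')) = p - 1 \<and>
        pseudo_component G p (\<rho>bar K) \<inter> pseudo_component G p (\<rho>bar K') \<subseteq> chi_abelian G p) \<and>
     (\<forall>c\<in>chi_abelian G p.
        finite {K \<in> normal_of_index G p. c \<in> pseudo_component G p (\<rho>bar K)} \<and>
        card {K \<in> normal_of_index G p. c \<in> pseudo_component G p (\<rho>bar K)} = p + 1) \<and>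
     (finite (chi_abelian G p) \<and>
      real (card (chi_abelian G p)) =
        (real p ^ r - 1) * (real p powi (int r - 1) - 1) / (real p ^ 2 - 1))"
proof -
  obtain z :: complex where z: "z ^ p = 1" "z \<noteq> 1" using primitive_root_exists[OF \<open>prime p\<close>] .
  interpret prime_degree_reps p z G
    using assms(1,3) z by (simp add: prime_degree_reps_def prime_degree_root_def prime_degree_def
        prime_degree_root_axioms_def)
  have \<phi>: "\<rho>bar K \<in> hom G (PSL p\<lparr>carrier := C_bar p\<rparr>) \<and>
      kernel G (PSL p\<lparr>carrier := C_bar p\<rparr>) (\<rho>bar K) = K" if "K \<in> normal_of_index G p" for K
    using assms(5) that by blast
  note main = pseudo_components[OF assms(2) \<phi>]
  define N where "N = real (card (normal_of_index G p))"
  define P where "P = real p"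
  have P: "P > 1" using p_gt_1 by (simp add: P_def)
  have NP: "N * (P - 1) = P ^ r - 1"
  proof -
    have "real (card (normal_of_index G p) * (p - 1)) = real (p ^ r - 1)"
      using main(3) assms(4) by simp
    then show ?thesis using p_pos by (simp add: N_def P_def of_nat_diff)
  qed
  then have N: "N = (P ^ r - 1) / (P - 1)" using P by (simp add: field_simps)
  have "real (card (chi_abelian G p)) = (P ^ r - 1) * (P powi (int r - 1) - 1) / (P ^ 2 - 1)"
  proof -
    have "real (card (chi_abelian G p)) * ((P + 1) * P) = real (card (chi_abelian G p) * ((p + 1) * p))"
      by (simp add: P_def algebra_simps)
    also have "\<dots> = real (card (normal_of_index G p) * (card (normal_of_index G p) - 1)) * real (p - 1)"
      by (simp only: main(9) of_nat_mult)
    also have "real (p - 1) = P - 1" using p_pos by (simp add: P_def of_nat_diff)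
    also have "real (card (normal_of_index G p) * (card (normal_of_index G p) - 1)) = N * (N - 1)"
      by (cases "card (normal_of_index G p)") (auto simp: N_def algebra_simps)
    finally have card: "real (card (chi_abelian G p)) * ((P + 1) * P) = N * (N - 1) * (P - 1)" .
    \<comment> \<open>The exponent is an integer because \<open>r - 1\<close> is negative for \<open>r = 0\<close>.\<close>
    have "P * P powi (int r - 1) = P ^ r"
      using P power_int_add[of P 1 "int r - 1"] by simp
    then have "(N - 1) * (P - 1) = P * (P powi (int r - 1) - 1)"
      using NP by (simp add: algebra_simps)
    then have "real (card (chi_abelian G p)) * ((P + 1) * P) * (P - 1) =
        (P ^ r - 1) * (P * (P powi (int r - 1) - 1))"
      unfolding card using NP by (metis mult.assoc mult.commute)
    then have "P * (real (card (chi_abelian G p)) * (P ^ 2 - 1)) =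
        P * ((P ^ r - 1) * (P powi (int r - 1) - 1))"
      by (simp add: power2_eq_square algebra_simps)
    then have "real (card (chi_abelian G p)) * (P ^ 2 - 1) = (P ^ r - 1) * (P powi (int r - 1) - 1)"
      using P by simp
    moreover have "P ^ 2 - 1 \<noteq> 0" using P by (simp add: power2_eq_1_iff)
    ultimately show ?thesis by (simp add: eq_divide_eq)
  qed
  moreover have "finite {K \<in> normal_of_index G p. c \<in> pseudo_component G p (\<rho>bar K)}" for c
    using main(2) by simp
  ultimately show ?thesis
    using main(1,2,4-8) N unfolding N_def P_def by auto
qed

end
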